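(* Let $R$ be a commutative Noetherian ring and let $x_1,\dots,x_n\in R$ ($n\ge1$). Then there is an equality of subcategories of $\mathsf{D_{sg}}(R)$ $$\mathsf{C}(x_1\cdots x_n)=\operatorname{smd}(\mathsf{C}(x_1)\ast\cdots\ast\mathsf{C}(x_n)).$$
   Context: All subcategories are strictly full (full and closed under isomorphism). $\mathsf{D_{sg}}(R)$ denotes the singularity category of $R$: the Verdier quotient of the bounded derived category $\mathsf{D^b}(R)$ of finitely generated $R$-modules by the perfect complexes. For $x\in R$, $\mathsf{C}(x)$ is the subcategory of $\mathsf{D_{sg}}(R)$ consisting of the objects $X$ such that the morphism $X\xrightarrow{x}X$ in $\mathsf{D_{sg}}(R)$ given by multiplication by $x$ is zero. For subcategories $\mathcal X,\mathcal Y$ of a triangulated category $\mathcal T$, $\mathcal X\ast\mathcal Y$ is the subcategory of $\mathcal T$ consisting of the objects $E$ for which there is an exact triangle $X\to E\to Y\to X[1]$ in $\mathcal T$ with $X\in\mathcal X$ and $Y\in\mathcal Y$; the operation $\ast$ is associative. $\operatorname{smd}\mathcal X$ is the subcategory of all direct summands of objects of $\mathcal X$. *)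

theory Defs
  imports "HOL-Algebra.Module" "HOL-Algebra.Ring_Divisibility"
begin

section \<open>Linear triangulated categories and Verdier quotients\<close>

text \<open>
  The data of a triangulated category which is linear over a ring with elements of type \<open>'r\<close>.
  The composite \<open>g \<cdot> f\<close> is "first \<open>f\<close>, then \<open>g\<close>".  A triangle
  \<open>X \<rightarrow> Y \<rightarrow> Z \<rightarrow> X[1]\<close> is the triple of its three arrows.  All operations are only meaningful
  on objects, (composable, parallel) arrows and scalars of the category at hand.
\<close>

record ('o, 'm, 'r) tricat =
  Obj :: "'o set"
  Arr :: "'m set"
  Dom :: "'m \<Rightarrow> 'o"
  Cod :: "'m \<Rightarrow> 'o"
  Ident :: "'o \<Rightarrow> 'm"
  Comp :: "'m \<Rightarrow> 'm \<Rightarrow> 'm"  (infixl \<open>\<cdot>\<index>\<close> 70)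
  Zero :: "'o \<Rightarrow> 'o \<Rightarrow> 'm"
  Plus :: "'m \<Rightarrow> 'm \<Rightarrow> 'm"
  Scale :: "'r \<Rightarrow> 'm \<Rightarrow> 'm"
  ShObj :: "'o \<Rightarrow> 'o"
  ShArr :: "'m \<Rightarrow> 'm"
  Tri :: "('m \<times> 'm \<times> 'm) set"

definition homs :: "('o, 'm, 'r) tricat \<Rightarrow> 'o \<Rightarrow> 'o \<Rightarrow> 'm set" where
  "homs T X Y = {f \<in> Arr T. Dom T f = X \<and> Cod T f = Y}"

definition iso_arr :: "('o, 'm, 'r) tricat \<Rightarrow> 'm \<Rightarrow> bool" where
  "iso_arr T f \<longleftrightarrow> f \<in> Arr T \<and>
     (\<exists>g \<in> homs T (Cod T f) (Dom T f).
        g \<cdot>\<^bsub>T\<^esub> f = Ident T (Dom T f) \<and> f \<cdot>\<^bsub>T\<^esub> g = Ident T (Cod T f))"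

definition iso_obj :: "('o, 'm, 'r) tricat \<Rightarrow> 'o \<Rightarrow> 'o \<Rightarrow> bool" where
  "iso_obj T X Y \<longleftrightarrow> (\<exists>f \<in> homs T X Y. iso_arr T f)"

definition candidate_triangle :: "('o, 'm, 'r) tricat \<Rightarrow> 'm \<times> 'm \<times> 'm \<Rightarrow> bool" where
  "candidate_triangle T = (\<lambda>(u, v, w). u \<in> Arr T \<and> v \<in> Arr T \<and> w \<in> Arr T \<and>
     Dom T v = Cod T u \<and> Dom T w = Cod T v \<and> Cod T w = ShObj T (Dom T u))"

definition iso_triangles ::
    "('o, 'm, 'r) tricat \<Rightarrow> 'm \<times> 'm \<times> 'm \<Rightarrow> 'm \<times> 'm \<times> 'm \<Rightarrow> bool" where
  "iso_triangles T = (\<lambda>(u, v, w) (u', v', w').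
     \<exists>a b c. iso_arr T a \<and> iso_arr T b \<and> iso_arr T c \<and>
       a \<in> homs T (Dom T u) (Dom T u') \<and>
       b \<in> homs T (Dom T v) (Dom T v') \<and>
       c \<in> homs T (Dom T w) (Dom T w') \<and>
       b \<cdot>\<^bsub>T\<^esub> u = u' \<cdot>\<^bsub>T\<^esub> a \<and> c \<cdot>\<^bsub>T\<^esub> v = v' \<cdot>\<^bsub>T\<^esub> b \<and> ShArr T a \<cdot>\<^bsub>T\<^esub> w = w' \<cdot>\<^bsub>T\<^esub> c)"

definition triangle_closure ::
    "('o, 'm, 'r) tricat \<Rightarrow> ('m \<times> 'm \<times> 'm) set \<Rightarrow> ('m \<times> 'm \<times> 'm) set" where
  "triangle_closure T \<Delta> =
     {\<tau>. candidate_triangle T \<tau> \<and> (\<exists>\<sigma> \<in> \<Delta>. iso_triangles T \<sigma> \<tau>)}"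

text \<open>
  The Verdier quotient \<open>T / S\<close> by (the full subcategory on) a set \<open>S\<close> of objects, by calculus of
  fractions.  The denominators are the arrows whose cone lies in \<open>S\<close>.  A roof \<open>(s, f)\<close> stands for
  \<open>X \<leftarrow> W \<rightarrow> Y\<close> with denominator \<open>s : W \<rightarrow> X\<close> and \<open>f : W \<rightarrow> Y\<close>, that is for \<open>f s\<^sup>-\<^sup>1\<close>.
\<close>

definition denoms :: "('o, 'm, 'r) tricat \<Rightarrow> 'o set \<Rightarrow> 'm set" where
  "denoms T S = {s. \<exists>v w. (s, v, w) \<in> Tri T \<and> Cod T v \<in> S}"

definition roofs :: "('o, 'm, 'r) tricat \<Rightarrow> 'o set \<Rightarrow> ('m \<times> 'm) set" where
  "roofs T S = {(s, f). s \<in> denoms T S \<and> f \<in> Arr T \<and> Dom T s = Dom T f}"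

definition roof_class :: "('o, 'm, 'r) tricat \<Rightarrow> 'o set \<Rightarrow> 'm \<Rightarrow> 'm \<Rightarrow> ('m \<times> 'm) set" where
  "roof_class T S s f =
     {(t, g) \<in> roofs T S. Cod T t = Cod T s \<and> Cod T g = Cod T f \<and>
        (\<exists>W. \<exists>p \<in> homs T W (Dom T s). \<exists>q \<in> homs T W (Dom T t).
           s \<cdot>\<^bsub>T\<^esub> p = t \<cdot>\<^bsub>T\<^esub> q \<and> s \<cdot>\<^bsub>T\<^esub> p \<in> denoms T S \<and> f \<cdot>\<^bsub>T\<^esub> p = g \<cdot>\<^bsub>T\<^esub> q)}"

type_synonym ('o, 'm) fraction = "'o \<times> ('m \<times> 'm) set \<times> 'o"

definition fraction :: "('o, 'm, 'r) tricat \<Rightarrow> 'o set \<Rightarrow> 'm \<Rightarrow> 'm \<Rightarrow> ('o, 'm) fraction" where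
  "fraction T S s f = (Cod T s, roof_class T S s f, Cod T f)"

text \<open>
  The operations on fractions are given on representatives; the unions below run over all choices
  of representatives, hence collapse to a single class.  In \<open>Comp\<close>, \<open>f \<cdot> t' = t \<cdot> f'\<close> completes
  the two roofs to a larger one.  In \<open>Plus\<close>, the two fractions are brought to a common denominator.
\<close>

definition verdier_category ::
    "('o, 'm, 'r) tricat \<Rightarrow> 'o set \<Rightarrow> ('o, ('o, 'm) fraction, 'r) tricat" where
  "verdier_category T S = \<lparr>
     Obj = Obj T,
     Arr = {fraction T S s f |s f. (s, f) \<in> roofs T S},
     Dom = (\<lambda>(X, A, Y). X),
     Cod = (\<lambda>(X, A, Y). Y),
     Ident = (\<lambda>X. fraction T S (Ident T X) (Ident T X)),
     Comp = (\<lambda>(Y, B, Z) (X, A, Y').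
       (X, \<Union>{roof_class T S (s \<cdot>\<^bsub>T\<^esub> t') (g \<cdot>\<^bsub>T\<^esub> f') |s f t g t' f'.
              (s, f) \<in> A \<and> (t, g) \<in> B \<and> t' \<in> denoms T S \<and> f' \<in> Arr T \<and>
              Dom T f' = Dom T t' \<and> Cod T t' = Dom T s \<and> Cod T f' = Dom T t \<and>
              f \<cdot>\<^bsub>T\<^esub> t' = t \<cdot>\<^bsub>T\<^esub> f'}, Z)),
     Zero = (\<lambda>X Y. fraction T S (Ident T X) (Zero T X Y)),
     Plus = (\<lambda>(X, A, Y) (X', B, Y').
       (X, \<Union>{roof_class T S s (Plus T f g) |s f g. (s, f) \<in> A \<and> (s, g) \<in> B}, Y)),
     Scale = (\<lambda>r (X, A, Y). (X, \<Union>{roof_class T S s (Scale T r f) |s f. (s, f) \<in> A}, Y)),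
     ShObj = ShObj T,
     ShArr = (\<lambda>(X, A, Y).
       (ShObj T X, \<Union>{roof_class T S (ShArr T s) (ShArr T f) |s f. (s, f) \<in> A}, ShObj T Y)),
     Tri = {} \<rparr>"

definition quotient_arr :: "('o, 'm, 'r) tricat \<Rightarrow> 'o set \<Rightarrow> 'm \<Rightarrow> ('o, 'm) fraction" where
  "quotient_arr T S f = fraction T S (Ident T (Dom T f)) f"

definition verdier_quotient ::
    "('o, 'm, 'r) tricat \<Rightarrow> 'o set \<Rightarrow> ('o, ('o, 'm) fraction, 'r) tricat" where
  "verdier_quotient T S = (verdier_category T S)
     \<lparr>Tri := triangle_closure (verdier_category T S)
        ((\<lambda>(u, v, w). (quotient_arr T S u, quotient_arr T S v, quotient_arr T S w)) ` Tri T)\<rparr>"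


section \<open>Operations on strictly full subcategories\<close>

text \<open>Strictly full subcategories are represented by their (isomorphism-closed) sets of objects.\<close>

definition star :: "('o, 'm, 'r) tricat \<Rightarrow> 'o set \<Rightarrow> 'o set \<Rightarrow> 'o set" where
  "star T \<X> \<Y> = {E \<in> Obj T. \<exists>u v w. (u, v, w) \<in> Tri T \<and>
     Dom T u \<in> \<X> \<and> Cod T u = E \<and> Cod T v \<in> \<Y>}"

text \<open>
  The iterated product, bracketed to the right.  The empty product, the zero objects, is the unit.
\<close>

fun star_list :: "('o, 'm, 'r) tricat \<Rightarrow> 'o set list \<Rightarrow> 'o set" where
  "star_list T [] = {X \<in> Obj T. Ident T X = Zero T X X}"
| "star_list T [\<X>] = \<X>"
| "star_list T (\<X> # \<Y> # \<Z>s) = star T \<X> (star_list T (\<Y> # \<Z>s))"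

definition biproduct :: "('o, 'm, 'r) tricat \<Rightarrow> 'o \<Rightarrow> 'o \<Rightarrow> 'o \<Rightarrow> bool" where
  "biproduct T F E E' \<longleftrightarrow>
     (\<exists>i \<in> homs T E F. \<exists>p \<in> homs T F E. \<exists>i' \<in> homs T E' F. \<exists>p' \<in> homs T F E'.
        p \<cdot>\<^bsub>T\<^esub> i = Ident T E \<and> p' \<cdot>\<^bsub>T\<^esub> i' = Ident T E' \<and>
        p \<cdot>\<^bsub>T\<^esub> i' = Zero T E' E \<and> p' \<cdot>\<^bsub>T\<^esub> i = Zero T E E' \<and>
        Plus T (i \<cdot>\<^bsub>T\<^esub> p) (i' \<cdot>\<^bsub>T\<^esub> p') = Ident T F)"

definition smd :: "('o, 'm, 'r) tricat \<Rightarrow> 'o set \<Rightarrow> 'o set" where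
  "smd T \<X> = {E \<in> Obj T. \<exists>F \<in> \<X>. \<exists>E' \<in> Obj T. biproduct T F E E'}"

definition mult_null :: "('o, 'm, 'r) tricat \<Rightarrow> 'r \<Rightarrow> 'o set" where
  "mult_null T x = {X \<in> Obj T. Scale T x (Ident T X) = Zero T X X}"


section \<open>The bounded homotopy category of finitely generated modules\<close>

text \<open>
  Modules live in a fixed universe of elements, so that the categories below are HOL constants
  depending on the ring only.  Up to isomorphism every finitely generated module \<open>M\<close> has its
  elements in this universe: if \<open>m\<^sub>1, \<dots>, m\<^sub>k\<close> generate \<open>M\<close>, represent each element by a chosen
  coefficient vector \<open>Pair (Scal a\<^sub>1) (Pair (Scal a\<^sub>2) \<dots>)\<close> of it and transport the structure.
  The universe is moreover closed under pairing, so direct sums can be formed literally.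
\<close>

datatype 'a elt = Scal 'a | Pair (pfst: "'a elt") (psnd: "'a elt")

type_synonym 'a emodule = "('a, 'a elt) module"

definition lin_maps ::
    "('a, 'm) ring_scheme \<Rightarrow> 'a emodule \<Rightarrow> 'a emodule \<Rightarrow> ('a elt \<Rightarrow> 'a elt) set" where
  "lin_maps R M N = {f \<in> carrier M \<rightarrow> carrier N.
     (\<forall>m \<in> carrier M. \<forall>m' \<in> carrier M. f (m \<oplus>\<^bsub>M\<^esub> m') = f m \<oplus>\<^bsub>N\<^esub> f m') \<and>
     (\<forall>r \<in> carrier R. \<forall>m \<in> carrier M. f (r \<odot>\<^bsub>M\<^esub> m) = r \<odot>\<^bsub>N\<^esub> f m)}"

definition fin_gen :: "('a, 'm) ring_scheme \<Rightarrow> 'a emodule \<Rightarrow> bool" where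
  "fin_gen R M \<longleftrightarrow> (\<exists>A. finite A \<and> A \<subseteq> carrier M \<and>
     (\<forall>N. submodule N R M \<and> A \<subseteq> N \<longrightarrow> N = carrier M))"

text \<open>
  For finitely generated \<open>P\<close> the lifting property against surjections within the universe is full
  projectivity, as the universe contains a surjection from a finite free module onto \<open>P\<close>.
\<close>

definition projective :: "('a, 'm) ring_scheme \<Rightarrow> 'a emodule \<Rightarrow> bool" where
  "projective R P \<longleftrightarrow>
     (\<forall>M N. \<forall>g \<in> lin_maps R M N. \<forall>f \<in> lin_maps R P N.
        module R M \<and> module R N \<and> g ` carrier M = carrier N \<longrightarrow>
        (\<exists>h \<in> lin_maps R P M. \<forall>x \<in> carrier P. g (h x) = f x))"

text \<open>
  A module is a record extending rings; the multiplicative fields play no role here.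
\<close>

definition dir_sum :: "'a emodule \<Rightarrow> 'a emodule \<Rightarrow> 'a emodule" where
  "dir_sum M N = \<lparr>
     carrier = {Pair m n |m n. m \<in> carrier M \<and> n \<in> carrier N},
     monoid.mult = undefined, one = undefined,
     zero = Pair \<zero>\<^bsub>M\<^esub> \<zero>\<^bsub>N\<^esub>,
     add = (\<lambda>p q. Pair (pfst p \<oplus>\<^bsub>M\<^esub> pfst q) (psnd p \<oplus>\<^bsub>N\<^esub> psnd q)),
     smult = (\<lambda>r p. Pair (r \<odot>\<^bsub>M\<^esub> pfst p) (r \<odot>\<^bsub>N\<^esub> psnd p)) \<rparr>"

record 'a cplx =
  Mdl :: "int \<Rightarrow> 'a emodule"
  Dif :: "int \<Rightarrow> 'a elt \<Rightarrow> 'a elt"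

definition bounded_cplxs :: "('a, 'm) ring_scheme \<Rightarrow> 'a cplx set" where
  "bounded_cplxs R = {X.
     (\<forall>i. module R (Mdl X i) \<and> fin_gen R (Mdl X i)) \<and>
     (\<forall>i. Dif X i \<in> lin_maps R (Mdl X i) (Mdl X (i + 1))) \<and>
     (\<forall>i. \<forall>m \<in> carrier (Mdl X i). Dif X (i + 1) (Dif X i m) = \<zero>\<^bsub>Mdl X (i + 2)\<^esub>) \<and>
     finite {i. carrier (Mdl X i) \<noteq> {\<zero>\<^bsub>Mdl X i\<^esub>}}}"

type_synonym 'a cmap = "int \<Rightarrow> 'a elt \<Rightarrow> 'a elt"

definition chain_maps :: "('a, 'm) ring_scheme \<Rightarrow> 'a cplx \<Rightarrow> 'a cplx \<Rightarrow> 'a cmap set" where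
  "chain_maps R X Y = {f.
     (\<forall>i. f i \<in> lin_maps R (Mdl X i) (Mdl Y i)) \<and>
     (\<forall>i. \<forall>m \<in> carrier (Mdl X i). f (i + 1) (Dif X i m) = Dif Y i (f i m))}"

definition homotopic ::
    "('a, 'm) ring_scheme \<Rightarrow> 'a cplx \<Rightarrow> 'a cplx \<Rightarrow> 'a cmap \<Rightarrow> 'a cmap \<Rightarrow> bool" where
  "homotopic R X Y f g \<longleftrightarrow>
     (\<exists>h. (\<forall>i. h i \<in> lin_maps R (Mdl X i) (Mdl Y (i - 1))) \<and>
        (\<forall>i. \<forall>m \<in> carrier (Mdl X i).
           f i m = g i m \<oplus>\<^bsub>Mdl Y i\<^esub>
             (Dif Y (i - 1) (h i m) \<oplus>\<^bsub>Mdl Y i\<^esub> h (i + 1) (Dif X i m))))"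

text \<open>
  Chain maps are total functions with arbitrary values outside the carriers; a homotopy class
  contains all such extensions, so equality of classes is the intended equality of arrows.
\<close>

definition homotopy_class ::
    "('a, 'm) ring_scheme \<Rightarrow> 'a cplx \<Rightarrow> 'a cplx \<Rightarrow> 'a cmap \<Rightarrow> 'a cmap set" where
  "homotopy_class R X Y f = {g \<in> chain_maps R X Y. homotopic R X Y f g}"

type_synonym 'a karr = "'a cplx \<times> 'a cmap set \<times> 'a cplx"

definition karr :: "('a, 'm) ring_scheme \<Rightarrow> 'a cplx \<Rightarrow> 'a cplx \<Rightarrow> 'a cmap \<Rightarrow> 'a karr" where
  "karr R X Y f = (X, homotopy_class R X Y f, Y)"

definition shift_cplx :: "'a cplx \<Rightarrow> 'a cplx" where
  "shift_cplx X = \<lparr>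
     Mdl = (\<lambda>i. Mdl X (i + 1)),
     Dif = (\<lambda>i m. \<ominus>\<^bsub>Mdl X (i + 2)\<^esub> Dif X (i + 1) m) \<rparr>"

definition cone :: "'a cplx \<Rightarrow> 'a cplx \<Rightarrow> 'a cmap \<Rightarrow> 'a cplx" where
  "cone X Y f = \<lparr>
     Mdl = (\<lambda>i. dir_sum (Mdl X (i + 1)) (Mdl Y i)),
     Dif = (\<lambda>i p. Pair (\<ominus>\<^bsub>Mdl X (i + 2)\<^esub> Dif X (i + 1) (pfst p))
                       (f (i + 1) (pfst p) \<oplus>\<^bsub>Mdl Y (i + 1)\<^esub> Dif Y i (psnd p))) \<rparr>"

definition standard_triangle ::
    "('a, 'm) ring_scheme \<Rightarrow> 'a cplx \<Rightarrow> 'a cplx \<Rightarrow> 'a cmap \<Rightarrow> 'a karr \<times> 'a karr \<times> 'a karr" where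
  "standard_triangle R X Y f =
     (karr R X Y f,
      karr R Y (cone X Y f) (\<lambda>i m. Pair \<zero>\<^bsub>Mdl X (i + 1)\<^esub> m),
      karr R (cone X Y f) (shift_cplx X) (\<lambda>i. pfst))"

definition homotopy_category :: "('a, 'm) ring_scheme \<Rightarrow> ('a cplx, 'a karr, 'a) tricat" where
  "homotopy_category R = \<lparr>
     Obj = bounded_cplxs R,
     Arr = {karr R X Y f |X Y f.
              X \<in> bounded_cplxs R \<and> Y \<in> bounded_cplxs R \<and> f \<in> chain_maps R X Y},
     Dom = (\<lambda>(X, F, Y). X),
     Cod = (\<lambda>(X, F, Y). Y),
     Ident = (\<lambda>X. karr R X X (\<lambda>i m. m)),
     Comp = (\<lambda>(Y, G, Z) (X, F, Y').
       (X, \<Union>{homotopy_class R X Z (\<lambda>i m. g i (f i m)) |f g. f \<in> F \<and> g \<in> G}, Z)),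
     Zero = (\<lambda>X Y. karr R X Y (\<lambda>i m. \<zero>\<^bsub>Mdl Y i\<^esub>)),
     Plus = (\<lambda>(X, F, Y) (X', G, Y').
       (X, \<Union>{homotopy_class R X Y (\<lambda>i m. f i m \<oplus>\<^bsub>Mdl Y i\<^esub> g i m) |f g. f \<in> F \<and> g \<in> G}, Y)),
     Scale = (\<lambda>r (X, F, Y).
       (X, \<Union>{homotopy_class R X Y (\<lambda>i m. r \<odot>\<^bsub>Mdl Y i\<^esub> f i m) |f. f \<in> F}, Y)),
     ShObj = shift_cplx,
     ShArr = (\<lambda>(X, F, Y).
       (shift_cplx X,
        \<Union>{homotopy_class R (shift_cplx X) (shift_cplx Y) (\<lambda>i. f (i + 1)) |f. f \<in> F},
        shift_cplx Y)),
     Tri = {} \<rparr>"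

definition Kb :: "('a, 'm) ring_scheme \<Rightarrow> ('a cplx, 'a karr, 'a) tricat" where
  "Kb R = (homotopy_category R)
     \<lparr>Tri := triangle_closure (homotopy_category R)
        {standard_triangle R X Y f |X Y f.
           X \<in> bounded_cplxs R \<and> Y \<in> bounded_cplxs R \<and> f \<in> chain_maps R X Y}\<rparr>"


section \<open>The derived category and the singularity category\<close>

definition acyclics :: "('a, 'm) ring_scheme \<Rightarrow> 'a cplx set" where
  "acyclics R = {X \<in> bounded_cplxs R. \<forall>i.
     {m \<in> carrier (Mdl X (i + 1)). Dif X (i + 1) m = \<zero>\<^bsub>Mdl X (i + 2)\<^esub>}
       = Dif X i ` carrier (Mdl X i)}"

definition Db :: "('a, 'm) ring_scheme \<Rightarrow> ('a cplx, ('a cplx, 'a karr) fraction, 'a) tricat" where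
  "Db R = verdier_quotient (Kb R) (acyclics R)"

definition perfect :: "('a, 'm) ring_scheme \<Rightarrow> 'a cplx set" where
  "perfect R = {X \<in> bounded_cplxs R. \<exists>P \<in> bounded_cplxs R.
     (\<forall>i. projective R (Mdl P i)) \<and> iso_obj (Db R) X P}"

definition Dsg :: "('a, 'm) ring_scheme \<Rightarrow>
    ('a cplx, ('a cplx, ('a cplx, 'a karr) fraction) fraction, 'a) tricat" where
  "Dsg R = verdier_quotient (Db R) (perfect R)"

end

theory Submission
  imports Defs
begin

text \<open>
  For \<open>X\<close> in the singularity category write \<open>X//r\<close> for the cone of multiplication by \<open>r\<close> on \<open>X\<close>.

  If \<open>E\<close> lies in \<open>C(x) * C(y)\<close>, then multiplication by \<open>y\<close> on \<open>E\<close> dies in the cone of \<open>X \<rightarrow> E\<close>, hence factors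
  through \<open>X \<in> C(x)\<close>, and \<open>xy\<close> annihilates \<open>E\<close>.  Annihilation passes to direct summands, which gives one inclusion
  (\<open>star_mult_null\<close>, \<open>smd_mult_null\<close>).  Conversely, the octahedral axiom for the composite of \<open>x\<close> and \<open>y\<close> places
  \<open>X//xy\<close> in a triangle between \<open>X//x\<close> and \<open>X//y\<close>, so that \<open>X//x\<^sub>1\<dots>x\<^sub>n\<close> is filtered by the \<open>X//x\<^sub>i\<close>
  (\<open>koszul_in_star_list\<close>).  If the product annihilates \<open>X\<close>, its cone is the cone of a zero morphism and has
  \<open>X\<close> as a direct summand (\<open>cone_zero_biproduct\<close>).

  The second argument needs \<open>X//r \<in> C(r)\<close>.  That is not a consequence of the axioms of a triangulated category, in
  which only \<open>r\<^sup>2\<close> is known to annihilate \<open>X//r\<close>.  It holds for complexes, where an explicit homotopy exists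
  (\<open>K_koszul\<close>), and it survives the passage to Verdier quotients because the quotient functor is linear and preserves
  triangles.  It is therefore made part of the notion \<open>triangulated\<close> used here, and the theorem becomes a statement
  about any such category (\<open>mult_null_prod\<close>).

  What remains is to see that the singularity category is of this kind.  The bounded homotopy category is
  (\<open>Kb_triangulated\<close>), and so is the Verdier quotient by any triangulated subcategory
  (\<open>verdier_quotient_triangulated\<close>).  The quotient construction is applied twice: to the acyclic complexes
  (\<open>acyclics_triangulated\<close>) and to the perfect complexes (\<open>perfect_triangulated\<close>).  The latter are closed under cones
  because morphisms out of a bounded complex of projectives are the same in the homotopy and the derived category
  (\<open>projective_hom_lift\<close>).
\<close>

section \<open>Linear categories with a shift\<close>

text \<open>
  The part of the structure that does not involve triangles.  Composability is expressed by equations between domains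
  and codomains instead of hom-sets, so that the simplifier can check it.  Additive inverses are multiples by
  \<open>\<ominus> \<one>\<close>, and the shift is only required to respect scalars because no sum of arrows is ever shifted.
\<close>

locale shift_linear_category = cring R for R :: "('r, 'x) ring_scheme" (structure) +
  fixes T :: "('o, 'm, 'r) tricat"
  assumes dom_obj [simp]: "f \<in> Arr T \<Longrightarrow> Dom T f \<in> Obj T"
    and cod_obj [simp]: "f \<in> Arr T \<Longrightarrow> Cod T f \<in> Obj T"
    and ident_arr [simp]: "X \<in> Obj T \<Longrightarrow> Ident T X \<in> Arr T"
    and ident_dom [simp]: "X \<in> Obj T \<Longrightarrow> Dom T (Ident T X) = X"
    and ident_cod [simp]: "X \<in> Obj T \<Longrightarrow> Cod T (Ident T X) = X"
    and comp_arr [simp]: "\<lbrakk>f \<in> Arr T; g \<in> Arr T; Dom T g = Cod T f\<rbrakk> \<Longrightarrow> g \<cdot>\<^bsub>T\<^esub> f \<in> Arr T"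
    and comp_dom [simp]: "\<lbrakk>f \<in> Arr T; g \<in> Arr T; Dom T g = Cod T f\<rbrakk> \<Longrightarrow> Dom T (g \<cdot>\<^bsub>T\<^esub> f) = Dom T f"
    and comp_cod [simp]: "\<lbrakk>f \<in> Arr T; g \<in> Arr T; Dom T g = Cod T f\<rbrakk> \<Longrightarrow> Cod T (g \<cdot>\<^bsub>T\<^esub> f) = Cod T g"
    and comp_assoc: "\<lbrakk>f \<in> Arr T; g \<in> Arr T; h \<in> Arr T; Dom T g = Cod T f; Dom T h = Cod T g\<rbrakk>
      \<Longrightarrow> h \<cdot>\<^bsub>T\<^esub> g \<cdot>\<^bsub>T\<^esub> f = h \<cdot>\<^bsub>T\<^esub> (g \<cdot>\<^bsub>T\<^esub> f)"
    and ident_left [simp]: "\<lbrakk>f \<in> Arr T; Cod T f = Y\<rbrakk> \<Longrightarrow> Ident T Y \<cdot>\<^bsub>T\<^esub> f = f"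
    and ident_right [simp]: "\<lbrakk>f \<in> Arr T; Dom T f = X\<rbrakk> \<Longrightarrow> f \<cdot>\<^bsub>T\<^esub> Ident T X = f"
    and zero_arr [simp]: "\<lbrakk>X \<in> Obj T; Y \<in> Obj T\<rbrakk> \<Longrightarrow> Zero T X Y \<in> Arr T"
    and zero_dom [simp]: "\<lbrakk>X \<in> Obj T; Y \<in> Obj T\<rbrakk> \<Longrightarrow> Dom T (Zero T X Y) = X"
    and zero_cod [simp]: "\<lbrakk>X \<in> Obj T; Y \<in> Obj T\<rbrakk> \<Longrightarrow> Cod T (Zero T X Y) = Y"
    and plus_arr [simp]: "\<lbrakk>f \<in> Arr T; g \<in> Arr T; Dom T f = Dom T g; Cod T f = Cod T g\<rbrakk> \<Longrightarrow> Plus T f g \<in> Arr T"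
    and plus_dom [simp]: "\<lbrakk>f \<in> Arr T; g \<in> Arr T; Dom T f = Dom T g; Cod T f = Cod T g\<rbrakk> \<Longrightarrow> Dom T (Plus T f g) = Dom T f"
    and plus_cod [simp]: "\<lbrakk>f \<in> Arr T; g \<in> Arr T; Dom T f = Dom T g; Cod T f = Cod T g\<rbrakk> \<Longrightarrow> Cod T (Plus T f g) = Cod T f"
    and plus_assoc: "\<lbrakk>f \<in> Arr T; g \<in> Arr T; h \<in> Arr T; Dom T f = Dom T g; Cod T f = Cod T g; Dom T g = Dom T h; Cod T g = Cod T h\<rbrakk>
       \<Longrightarrow> Plus T (Plus T f g) h = Plus T f (Plus T g h)"
    and plus_comm: "\<lbrakk>f \<in> Arr T; g \<in> Arr T; Dom T f = Dom T g; Cod T f = Cod T g\<rbrakk> \<Longrightarrow> Plus T f g = Plus T g f"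
    and plus_zero [simp]: "\<lbrakk>f \<in> Arr T; Dom T f = X; Cod T f = Y\<rbrakk> \<Longrightarrow> Plus T f (Zero T X Y) = f"
    and scale_arr [simp]: "\<lbrakk>r \<in> carrier R; f \<in> Arr T\<rbrakk> \<Longrightarrow> Scale T r f \<in> Arr T"
    and scale_dom [simp]: "\<lbrakk>r \<in> carrier R; f \<in> Arr T\<rbrakk> \<Longrightarrow> Dom T (Scale T r f) = Dom T f"
    and scale_cod [simp]: "\<lbrakk>r \<in> carrier R; f \<in> Arr T\<rbrakk> \<Longrightarrow> Cod T (Scale T r f) = Cod T f"
    and scale_zero [simp]: "f \<in> Arr T \<Longrightarrow> Scale T \<zero> f = Zero T (Dom T f) (Cod T f)"
    and scale_one [simp]: "f \<in> Arr T \<Longrightarrow> Scale T \<one> f = f"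
    and scale_mult: "\<lbrakk>r \<in> carrier R; s \<in> carrier R; f \<in> Arr T\<rbrakk> \<Longrightarrow> Scale T (r \<otimes> s) f = Scale T r (Scale T s f)"
    and scale_add: "\<lbrakk>r \<in> carrier R; s \<in> carrier R; f \<in> Arr T\<rbrakk> \<Longrightarrow> Scale T (r \<oplus> s) f = Plus T (Scale T r f) (Scale T s f)"
    and comp_plus_left: "\<lbrakk>f \<in> Arr T; g \<in> Arr T; h \<in> Arr T; Dom T f = Cod T h; Dom T g = Cod T h; Cod T f = Cod T g\<rbrakk>
       \<Longrightarrow> Plus T f g \<cdot>\<^bsub>T\<^esub> h = Plus T (f \<cdot>\<^bsub>T\<^esub> h) (g \<cdot>\<^bsub>T\<^esub> h)"
    and comp_plus_right: "\<lbrakk>f \<in> Arr T; g \<in> Arr T; h \<in> Arr T; Dom T h = Cod T f; Dom T h = Cod T g; Dom T f = Dom T g\<rbrakk>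
       \<Longrightarrow> h \<cdot>\<^bsub>T\<^esub> Plus T f g = Plus T (h \<cdot>\<^bsub>T\<^esub> f) (h \<cdot>\<^bsub>T\<^esub> g)"
    and comp_scale_left [simp]: "\<lbrakk>r \<in> carrier R; f \<in> Arr T; g \<in> Arr T; Dom T g = Cod T f\<rbrakk>
       \<Longrightarrow> Scale T r g \<cdot>\<^bsub>T\<^esub> f = Scale T r (g \<cdot>\<^bsub>T\<^esub> f)"
    and comp_scale_right [simp]: "\<lbrakk>r \<in> carrier R; f \<in> Arr T; g \<in> Arr T; Dom T g = Cod T f\<rbrakk>
       \<Longrightarrow> g \<cdot>\<^bsub>T\<^esub> Scale T r f = Scale T r (g \<cdot>\<^bsub>T\<^esub> f)"
    and sh_obj [simp]: "X \<in> Obj T \<Longrightarrow> ShObj T X \<in> Obj T"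
    and sh_arr [simp]: "f \<in> Arr T \<Longrightarrow> ShArr T f \<in> Arr T"
    and sh_dom [simp]: "f \<in> Arr T \<Longrightarrow> Dom T (ShArr T f) = ShObj T (Dom T f)"
    and sh_cod [simp]: "f \<in> Arr T \<Longrightarrow> Cod T (ShArr T f) = ShObj T (Cod T f)"
    and sh_comp: "\<lbrakk>f \<in> Arr T; g \<in> Arr T; Dom T g = Cod T f\<rbrakk> \<Longrightarrow> ShArr T (g \<cdot>\<^bsub>T\<^esub> f) = ShArr T g \<cdot>\<^bsub>T\<^esub> ShArr T f"
    and sh_ident [simp]: "X \<in> Obj T \<Longrightarrow> ShArr T (Ident T X) = Ident T (ShObj T X)"
    and sh_scale [simp]: "\<lbrakk>r \<in> carrier R; f \<in> Arr T\<rbrakk> \<Longrightarrow> ShArr T (Scale T r f) = Scale T r (ShArr T f)"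
begin

abbreviation cmp (infixl "\<bullet>" 70) where "g \<bullet> f \<equiv> g \<cdot>\<^bsub>T\<^esub> f"
abbreviation "neg f \<equiv> Scale T (\<ominus> \<one>) f"

lemma zero_comp [simp]: "\<lbrakk>f \<in> Arr T; Cod T f = Y; Z \<in> Obj T\<rbrakk> \<Longrightarrow> Zero T Y Z \<bullet> f = Zero T (Dom T f) Z"
  using comp_scale_left[of \<zero> f "Zero T Y Z"] by auto

lemma comp_zero [simp]: "\<lbrakk>f \<in> Arr T; Dom T f = Y; X \<in> Obj T\<rbrakk> \<Longrightarrow> f \<bullet> Zero T X Y = Zero T X (Cod T f)"
  using comp_scale_right[of \<zero> "Zero T X Y" f] by auto

lemma scale_Zero [simp]: "\<lbrakk>r \<in> carrier R; X \<in> Obj T; Y \<in> Obj T\<rbrakk> \<Longrightarrow> Scale T r (Zero T X Y) = Zero T X Y"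
  using scale_mult[of r \<zero> "Zero T X Y"] by simp

lemma sh_Zero [simp]: "\<lbrakk>X \<in> Obj T; Y \<in> Obj T\<rbrakk> \<Longrightarrow> ShArr T (Zero T X Y) = Zero T (ShObj T X) (ShObj T Y)"
  using sh_scale[of \<zero> "Zero T X Y"] by simp

lemma zero_plus [simp]: "\<lbrakk>f \<in> Arr T; Dom T f = X; Cod T f = Y\<rbrakk> \<Longrightarrow> Plus T (Zero T X Y) f = f"
  using plus_comm[of "Zero T X Y" f] by auto

lemma plus_neg [simp]: "f \<in> Arr T \<Longrightarrow> Plus T f (neg f) = Zero T (Dom T f) (Cod T f)"
  using scale_add[of \<one> "\<ominus> \<one>" f] by (simp add: r_neg)

lemma neg_neg [simp]: "f \<in> Arr T \<Longrightarrow> neg (neg f) = f"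
  using scale_mult[of "\<ominus> \<one>" "\<ominus> \<one>" f] by (simp add: l_minus)

lemma neg_plus [simp]: "f \<in> Arr T \<Longrightarrow> Plus T (neg f) f = Zero T (Dom T f) (Cod T f)"
  using plus_comm[of f "neg f"] by simp

lemma eq_if_minus_zero:
  assumes "f \<in> Arr T" "g \<in> Arr T" "Dom T f = Dom T g" "Cod T f = Cod T g"
    and "Plus T f (neg g) = Zero T (Dom T f) (Cod T f)"
  shows "f = g"
proof -
  have "g = Plus T (Plus T f (neg g)) g"
    using assms by simp
  also have "\<dots> = f"
    using assms by (subst plus_assoc) simp_all
  finally show ?thesis by simp
qed

lemma comp_cancel:
  "\<lbrakk>f \<in> Arr T; g \<in> Arr T; h \<in> Arr T; g \<bullet> f = Ident T (Dom T f); Dom T g = Cod T f; Cod T h = Dom T f\<rbrakk>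
    \<Longrightarrow> g \<bullet> (f \<bullet> h) = h"
  by (simp flip: comp_assoc)

lemma comp_reassoc:
  "\<lbrakk>g \<bullet> f = k; f \<in> Arr T; g \<in> Arr T; h \<in> Arr T; Dom T g = Cod T f; Cod T h = Dom T f\<rbrakk>
    \<Longrightarrow> g \<bullet> (f \<bullet> h) = k \<bullet> h"
  by (simp flip: comp_assoc)

lemma homs_iff: "f \<in> homs T X Y \<longleftrightarrow> f \<in> Arr T \<and> Dom T f = X \<and> Cod T f = Y"
  by (auto simp: homs_def)

lemma isoE:
  assumes "iso_arr T f"
  obtains g where "f \<in> Arr T" "g \<in> Arr T" "Dom T g = Cod T f" "Cod T g = Dom T f"
    "g \<bullet> f = Ident T (Dom T f)" "f \<bullet> g = Ident T (Cod T f)" "iso_arr T g"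
proof -
  obtain g where g: "f \<in> Arr T" "g \<in> Arr T" "Dom T g = Cod T f" "Cod T g = Dom T f"
    "g \<bullet> f = Ident T (Dom T f)" "f \<bullet> g = Ident T (Cod T f)"
    using assms by (auto simp: iso_arr_def homs_iff)
  moreover from g have "iso_arr T g" unfolding iso_arr_def homs_iff Bex_def by (intro conjI exI[of _ f]) simp_all
  ultimately show thesis by (rule that)
qed

lemma isoI:
  assumes "f \<in> Arr T" "g \<in> Arr T" "Dom T g = Cod T f" "Cod T g = Dom T f"
    "g \<bullet> f = Ident T (Dom T f)" "f \<bullet> g = Ident T (Cod T f)"
  shows "iso_arr T f"
  using assms unfolding iso_arr_def homs_iff Bex_def by (intro conjI exI[of _ g]) simp_all

lemma square_inverse:
  assumes sq: "b \<bullet> u = u' \<bullet> a"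
    and "u \<in> Arr T" "u' \<in> Arr T" "a \<in> Arr T" "a' \<in> Arr T" "b \<in> Arr T" "b' \<in> Arr T"
    and "Dom T b = Cod T u" "Dom T u' = Cod T a" "Dom T a = Dom T u" "Cod T u' = Cod T b"
    and "Dom T a' = Cod T a" "Cod T a' = Dom T a" "Dom T b' = Cod T b" "Cod T b' = Dom T b"
    and "a \<bullet> a' = Ident T (Cod T a)" "b' \<bullet> b = Ident T (Dom T b)"
  shows "b' \<bullet> u' = u \<bullet> a'"
proof -
  have "b' \<bullet> u' = b' \<bullet> (u' \<bullet> a \<bullet> a')" using assms(2-) by (simp add: comp_assoc)
  also have "\<dots> = u \<bullet> a'" unfolding sq[symmetric] using assms(2-) by (simp add: comp_assoc comp_cancel)
  finally show ?thesis .
qed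

lemma iso_arr_arr: "iso_arr T f \<Longrightarrow> f \<in> Arr T"
  by (simp add: iso_arr_def)

lemma iso_ident [simp]: "X \<in> Obj T \<Longrightarrow> iso_arr T (Ident T X)"
  by (rule isoI[of _ "Ident T X"]) simp_all

lemma iso_comp:
  assumes "iso_arr T f" "iso_arr T g" "Dom T g = Cod T f"
  shows "iso_arr T (g \<bullet> f)"
proof -
  obtain f' where f: "f \<in> Arr T" "f' \<in> Arr T" "Dom T f' = Cod T f" "Cod T f' = Dom T f"
    "f' \<bullet> f = Ident T (Dom T f)" "f \<bullet> f' = Ident T (Cod T f)" using assms(1) by (rule isoE)
  obtain g' where g: "g \<in> Arr T" "g' \<in> Arr T" "Dom T g' = Cod T g" "Cod T g' = Dom T g"
    "g' \<bullet> g = Ident T (Dom T g)" "g \<bullet> g' = Ident T (Cod T g)" using assms(2) by (rule isoE)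
  show ?thesis
    by (rule isoI[of _ "f' \<bullet> g'"]) (use f g assms(3) in \<open>simp_all add: comp_assoc comp_cancel\<close>)
qed

lemma iso_sh: assumes "iso_arr T f" shows "iso_arr T (ShArr T f)"
proof -
  obtain f' where f: "f \<in> Arr T" "f' \<in> Arr T" "Dom T f' = Cod T f" "Cod T f' = Dom T f"
    "f' \<bullet> f = Ident T (Dom T f)" "f \<bullet> f' = Ident T (Cod T f)" using assms(1) by (rule isoE)
  show ?thesis
    by (rule isoI[of _ "ShArr T f'"]) (use f in \<open>simp_all flip: sh_comp\<close>)
qed

lemma iso_neg_ident [simp]: "X \<in> Obj T \<Longrightarrow> iso_arr T (neg (Ident T X))"
  by (rule isoI[of _ "neg (Ident T X)"]) simp_all

lemma iso_obj_refl: "X \<in> Obj T \<Longrightarrow> iso_obj T X X"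
  unfolding iso_obj_def by (rule bexI[of _ "Ident T X"]) (simp_all add: homs_iff)

lemma iso_objE:
  assumes "iso_obj T X Y"
  obtains f where "iso_arr T f" "f \<in> Arr T" "Dom T f = X" "Cod T f = Y"
  using assms unfolding iso_obj_def Bex_def by (auto simp: homs_iff)

lemma iso_objI: "iso_arr T f \<Longrightarrow> Dom T f = X \<Longrightarrow> Cod T f = Y \<Longrightarrow> iso_obj T X Y"
  unfolding iso_obj_def by (rule bexI[of _ f]) (simp_all add: homs_iff iso_arr_arr)

lemma iso_obj_sym:
  assumes "iso_obj T X Y" shows "iso_obj T Y X"
proof -
  obtain f where f: "iso_arr T f" "f \<in> Arr T" "Dom T f = X" "Cod T f = Y" using assms by (rule iso_objE)
  obtain g where g: "g \<in> Arr T" "Dom T g = Cod T f" "Cod T g = Dom T f" "iso_arr T g"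
    using f(1) by (rule isoE)
  show ?thesis by (rule iso_objI[of g]) (use f g in simp_all)
qed

lemma iso_obj_trans:
  assumes "iso_obj T X Y" "iso_obj T Y Z" shows "iso_obj T X Z"
proof -
  obtain f where f: "iso_arr T f" "f \<in> Arr T" "Dom T f = X" "Cod T f = Y" using assms(1) by (rule iso_objE)
  obtain g where g: "iso_arr T g" "g \<in> Arr T" "Dom T g = Y" "Cod T g = Z" using assms(2) by (rule iso_objE)
  show ?thesis by (rule iso_objI[of "g \<bullet> f"]) (use f g in \<open>simp_all add: iso_comp\<close>)
qed

lemma iso_obj_objs: "iso_obj T X Y \<Longrightarrow> X \<in> Obj T" "iso_obj T X Y \<Longrightarrow> Y \<in> Obj T"
  by (auto elim!: iso_objE)

lemma zero_objs_iso:
  assumes "X \<in> Obj T" "Y \<in> Obj T" "Ident T X = Zero T X X" "Ident T Y = Zero T Y Y"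
  shows "iso_obj T X Y"
proof -
  have "iso_arr T (Zero T X Y)"
    by (rule isoI[of _ "Zero T Y X"]) (use assms in simp_all)
  from iso_objI[OF this refl refl] show ?thesis using assms by simp
qed

lemma iso_trianglesE:
  assumes "iso_triangles T (u, v, w) (u', v', w')"
  obtains a b c where "iso_arr T a" "iso_arr T b" "iso_arr T c" "a \<in> Arr T" "b \<in> Arr T" "c \<in> Arr T"
    "Dom T a = Dom T u" "Cod T a = Dom T u'" "Dom T b = Dom T v" "Cod T b = Dom T v'"
    "Dom T c = Dom T w" "Cod T c = Dom T w'"
    "b \<bullet> u = u' \<bullet> a" "c \<bullet> v = v' \<bullet> b" "ShArr T a \<bullet> w = w' \<bullet> c"
  using assms unfolding iso_triangles_def homs_iff by auto

lemma iso_trianglesI: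
  assumes "iso_arr T a" "iso_arr T b" "iso_arr T c"
    "Dom T a = Dom T u" "Cod T a = Dom T u'" "Dom T b = Dom T v" "Cod T b = Dom T v'"
    "Dom T c = Dom T w" "Cod T c = Dom T w'"
    "b \<bullet> u = u' \<bullet> a" "c \<bullet> v = v' \<bullet> b" "ShArr T a \<bullet> w = w' \<bullet> c"
  shows "iso_triangles T (u, v, w) (u', v', w')"
  using assms unfolding iso_triangles_def homs_iff prod.case
  by (intro exI[of _ a] exI[of _ b] exI[of _ c]) (simp add: iso_arr_arr)

lemma candidate_iff: "candidate_triangle T (u, v, w) \<longleftrightarrow> u \<in> Arr T \<and> v \<in> Arr T \<and> w \<in> Arr T \<and>
     Dom T v = Cod T u \<and> Dom T w = Cod T v \<and> Cod T w = ShObj T (Dom T u)"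
  by (simp add: candidate_triangle_def)

lemma iso_triangles_refl: "candidate_triangle T (u, v, w) \<Longrightarrow> iso_triangles T (u, v, w) (u, v, w)"
  by (rule iso_trianglesI[of "Ident T (Dom T u)" "Ident T (Dom T v)" "Ident T (Dom T w)"])
    (simp_all add: candidate_iff)

lemma iso_triangles_trans:
  assumes c: "candidate_triangle T (u, v, w)" "candidate_triangle T (u', v', w')" "candidate_triangle T (u'', v'', w'')"
    and 1: "iso_triangles T (u, v, w) (u', v', w')" and 2: "iso_triangles T (u', v', w') (u'', v'', w'')"
  shows "iso_triangles T (u, v, w) (u'', v'', w'')"
proof -
  obtain a b c where abc: "iso_arr T a" "iso_arr T b" "iso_arr T c" "a \<in> Arr T" "b \<in> Arr T" "c \<in> Arr T"
    "Dom T a = Dom T u" "Cod T a = Dom T u'" "Dom T b = Dom T v" "Cod T b = Dom T v'"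
    "Dom T c = Dom T w" "Cod T c = Dom T w'"
    "b \<bullet> u = u' \<bullet> a" "c \<bullet> v = v' \<bullet> b" "ShArr T a \<bullet> w = w' \<bullet> c" using 1 by (rule iso_trianglesE)
  obtain a' b' c' where abc': "iso_arr T a'" "iso_arr T b'" "iso_arr T c'" "a' \<in> Arr T" "b' \<in> Arr T" "c' \<in> Arr T"
    "Dom T a' = Dom T u'" "Cod T a' = Dom T u''" "Dom T b' = Dom T v'" "Cod T b' = Dom T v''"
    "Dom T c' = Dom T w'" "Cod T c' = Dom T w''"
    "b' \<bullet> u' = u'' \<bullet> a'" "c' \<bullet> v' = v'' \<bullet> b'" "ShArr T a' \<bullet> w' = w'' \<bullet> c'" using 2 by (rule iso_trianglesE)
  note cc = c[unfolded candidate_iff]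
  have "b' \<bullet> b \<bullet> u = u'' \<bullet> (a' \<bullet> a)" using abc abc' cc
    by (simp add: comp_assoc comp_reassoc[OF abc'(13)])
  moreover have "c' \<bullet> c \<bullet> v = v'' \<bullet> (b' \<bullet> b)" using abc abc' cc
    by (simp add: comp_assoc comp_reassoc[OF abc'(14)])
  moreover have "ShArr T (a' \<bullet> a) \<bullet> w = w'' \<bullet> (c' \<bullet> c)" using abc abc' cc
    by (simp add: comp_assoc sh_comp comp_reassoc[OF abc'(15)])
  ultimately show ?thesis using abc abc' cc
    by (intro iso_trianglesI[of "a' \<bullet> a" "b' \<bullet> b" "c' \<bullet> c"]) (simp_all add: iso_comp)
qed

section \<open>Exact triangles and the five lemma\<close>

lemma neg_eq_zero: "\<lbrakk>f \<in> Arr T; neg f = Zero T X Y; Dom T f = X; Cod T f = Y\<rbrakk> \<Longrightarrow> f = Zero T X Y"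
  using neg_neg[of f] by auto

lemma iso_cancel_left:
  assumes "iso_arr T a" "f \<in> Arr T" "Dom T a = Cod T f" "a \<bullet> f = Zero T (Dom T f) (Cod T a)"
  shows "f = Zero T (Dom T f) (Cod T f)"
proof -
  obtain a' where a: "a \<in> Arr T" "a' \<in> Arr T" "Dom T a' = Cod T a" "Cod T a' = Dom T a"
    "a' \<bullet> a = Ident T (Dom T a)" "a \<bullet> a' = Ident T (Cod T a)" using assms(1) by (rule isoE)
  have "f = a' \<bullet> (a \<bullet> f)" by (rule comp_cancel[symmetric]) (use a assms in simp_all)
  then show ?thesis using a assms by simp
qed

lemma iso_cancel_right:
  assumes "iso_arr T a" "f \<in> Arr T" "Dom T f = Cod T a" "f \<bullet> a = Zero T (Dom T a) (Cod T f)"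
  shows "f = Zero T (Dom T f) (Cod T f)"
proof -
  obtain a' where a: "a \<in> Arr T" "a' \<in> Arr T" "Dom T a' = Cod T a" "Cod T a' = Dom T a"
    "a' \<bullet> a = Ident T (Dom T a)" "a \<bullet> a' = Ident T (Cod T a)" using assms(1) by (rule isoE)
  have "f = f \<bullet> a \<bullet> a'" using a assms(2,3) by (simp add: comp_assoc)
  also have "\<dots> = Zero T (Dom T f) (Cod T f)" unfolding assms(4) using a assms(2,3) by simp
  finally show ?thesis .
qed

definition tri_map where
  "tri_map a b c = (\<lambda>(u, v, w) (u', v', w'). a \<in> Arr T \<and> b \<in> Arr T \<and> c \<in> Arr T \<and>
     Dom T a = Dom T u \<and> Cod T a = Dom T u' \<and> Dom T b = Cod T u \<and> Cod T b = Cod T u' \<and>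
     Dom T c = Cod T v \<and> Cod T c = Cod T v' \<and>
     b \<bullet> u = u' \<bullet> a \<and> c \<bullet> v = v' \<bullet> b \<and> ShArr T a \<bullet> w = w' \<bullet> c)"

lemma tri_mapD:
  assumes "tri_map a b c (u, v, w) (u', v', w')"
  shows "a \<in> Arr T" "b \<in> Arr T" "c \<in> Arr T"
     "Dom T a = Dom T u" "Cod T a = Dom T u'" "Dom T b = Cod T u" "Cod T b = Cod T u'"
     "Dom T c = Cod T v" "Cod T c = Cod T v'"
     "b \<bullet> u = u' \<bullet> a" "c \<bullet> v = v' \<bullet> b" "ShArr T a \<bullet> w = w' \<bullet> c"
  using assms by (simp_all add: tri_map_def)

lemma tri_mapI:
  assumes "a \<in> Arr T" "b \<in> Arr T" "c \<in> Arr T"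
     "Dom T a = Dom T u" "Cod T a = Dom T u'" "Dom T b = Cod T u" "Cod T b = Cod T u'"
     "Dom T c = Cod T v" "Cod T c = Cod T v'"
     "b \<bullet> u = u' \<bullet> a" "c \<bullet> v = v' \<bullet> b" "ShArr T a \<bullet> w = w' \<bullet> c"
  shows "tri_map a b c (u, v, w) (u', v', w')"
  using assms by (simp add: tri_map_def)

lemma candidateD:
  assumes "candidate_triangle T (u, v, w)"
  shows "u \<in> Arr T" "v \<in> Arr T" "w \<in> Arr T" "Dom T v = Cod T u" "Dom T w = Cod T v"
    "Cod T w = ShObj T (Dom T u)"
  using assms by (simp_all add: candidate_iff)

lemma tri_map_comp:
  assumes "candidate_triangle T (u, v, w)" "candidate_triangle T (u', v', w')" "candidate_triangle T (u'', v'', w'')"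
    and 1: "tri_map a b c (u, v, w) (u', v', w')" and 2: "tri_map a' b' c' (u', v', w') (u'', v'', w'')"
  shows "tri_map (a' \<bullet> a) (b' \<bullet> b) (c' \<bullet> c) (u, v, w) (u'', v'', w'')"
proof -
  note cc = candidateD[OF assms(1)] candidateD[OF assms(2)] candidateD[OF assms(3)]
  note m = tri_mapD[OF 1] note m' = tri_mapD[OF 2]
  show ?thesis
    by (rule tri_mapI; (insert m m' cc; simp add: comp_assoc sh_comp
        comp_reassoc[OF m'(10)] comp_reassoc[OF m'(11)] comp_reassoc[OF m'(12)]))
qed

lemma iso_triangles_mapE:
  assumes "iso_triangles T (u, v, w) (u', v', w')"
   "candidate_triangle T (u, v, w)" "candidate_triangle T (u', v', w')"
  obtains a b c where "tri_map a b c (u, v, w) (u', v', w')" "iso_arr T a" "iso_arr T b" "iso_arr T c"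
proof -
  note cc = candidateD[OF assms(2)] candidateD[OF assms(3)]
  obtain a b c where abc: "iso_arr T a" "iso_arr T b" "iso_arr T c" "a \<in> Arr T" "b \<in> Arr T" "c \<in> Arr T"
    "Dom T a = Dom T u" "Cod T a = Dom T u'" "Dom T b = Dom T v" "Cod T b = Dom T v'"
    "Dom T c = Dom T w" "Cod T c = Dom T w'"
    "b \<bullet> u = u' \<bullet> a" "c \<bullet> v = v' \<bullet> b" "ShArr T a \<bullet> w = w' \<bullet> c" using assms(1) by (rule iso_trianglesE)
  show thesis
    by (rule that[of a b c], rule tri_mapI) (use abc cc in simp_all)
qed

lemma tri_map_isoI:
  assumes "tri_map a b c (u, v, w) (u', v', w')" "iso_arr T a" "iso_arr T b" "iso_arr T c"
   "candidate_triangle T (u, v, w)" "candidate_triangle T (u', v', w')"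
  shows "iso_triangles T (u, v, w) (u', v', w')"
  using candidateD[OF assms(5)] candidateD[OF assms(6)] tri_mapD[OF assms(1)]
  by (intro iso_trianglesI[OF assms(2-4)]) simp_all

lemma tri_map_inverse:
  assumes c: "candidate_triangle T (u, v, w)" "candidate_triangle T (u', v', w')"
    and 1: "tri_map a b c (u, v, w) (u', v', w')"
    and a': "a' \<in> Arr T" "Dom T a' = Cod T a" "Cod T a' = Dom T a"
    "a' \<bullet> a = Ident T (Dom T a)" "a \<bullet> a' = Ident T (Cod T a)"
    and b': "b' \<in> Arr T" "Dom T b' = Cod T b" "Cod T b' = Dom T b"
    "b' \<bullet> b = Ident T (Dom T b)" "b \<bullet> b' = Ident T (Cod T b)"
    and c': "c' \<in> Arr T" "Dom T c' = Cod T c" "Cod T c' = Dom T c"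
    "c' \<bullet> c = Ident T (Dom T c)" "c \<bullet> c' = Ident T (Cod T c)"
  shows "tri_map a' b' c' (u', v', w') (u, v, w)"
proof -
  note cc = candidateD[OF c(1)] candidateD[OF c(2)] note m = tri_mapD[OF 1]
  note all = a' b' c' cc m(1-9)
  have 1: "b' \<bullet> u' = u \<bullet> a'" by (rule square_inverse[OF m(10)]) (use all in simp_all)
  have 2: "c' \<bullet> v' = v \<bullet> b'" by (rule square_inverse[OF m(11)]) (use all in simp_all)
  have sa: "ShArr T a' \<bullet> ShArr T a = Ident T (ShObj T (Dom T a))" using all by (simp flip: sh_comp)
  have 3: "ShArr T a' \<bullet> w' = w \<bullet> c'" by (rule square_inverse[OF m(12)]) (use all sa in simp_all)
  show ?thesis by (rule tri_mapI) (use all 1 2 3 in simp_all)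
qed

lemma closure_iff:
  "(u, v, w) \<in> triangle_closure T \<Delta> \<longleftrightarrow> candidate_triangle T (u, v, w) \<and>
    (\<exists>u' v' w'. (u', v', w') \<in> \<Delta> \<and> iso_triangles T (u', v', w') (u, v, w))"
  unfolding triangle_closure_def by (auto simp: Bex_def)

lemma closure_basisE:
  assumes "(u', v', w') \<in> triangle_closure T \<Delta>"
    and cand: "\<forall>\<tau>\<in>\<Delta>. candidate_triangle T \<tau>"
  obtains u v w a b c where "(u, v, w) \<in> \<Delta>" "tri_map a b c (u, v, w) (u', v', w')"
    "iso_arr T a" "iso_arr T b" "iso_arr T c"
    "candidate_triangle T (u, v, w)" "candidate_triangle T (u', v', w')"
proof -
  obtain u v w where 1: "(u, v, w) \<in> \<Delta>" "iso_triangles T (u, v, w) (u', v', w')"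
    and 2: "candidate_triangle T (u', v', w')"
    using assms(1) unfolding closure_iff by blast
  obtain a b c where 3: "tri_map a b c (u, v, w) (u', v', w')" "iso_arr T a" "iso_arr T b" "iso_arr T c"
    using iso_triangles_mapE[OF 1(2) bspec[OF cand 1(1)] 2] .
  show thesis using that[OF 1(1) 3 bspec[OF cand 1(1)] 2] .
qed

end

text \<open>
  These axioms are exactly what the five lemma uses.  The existence of fillers is kept out because in a Verdier quotient
  a filler is obtained by inverting an arrow that the five lemma shows to be an isomorphism.
\<close>

locale exact_triangles = shift_linear_category +
  assumes tri_cand: "(u, v, w) \<in> Tri T \<Longrightarrow> candidate_triangle T (u, v, w)"
    and tri_iso: "\<lbrakk>(u, v, w) \<in> Tri T; candidate_triangle T (u', v', w');
        iso_triangles T (u, v, w) (u', v', w')\<rbrakk> \<Longrightarrow> (u', v', w') \<in> Tri T"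
    and tri_zero: "(u, v, w) \<in> Tri T \<Longrightarrow> v \<bullet> u = Zero T (Dom T u) (Cod T v)"
    and weak_kernel: "\<lbrakk>(u, v, w) \<in> Tri T; h \<in> Arr T; Cod T h = Cod T u;
        v \<bullet> h = Zero T (Dom T h) (Cod T v)\<rbrakk>
        \<Longrightarrow> \<exists>k\<in>Arr T. Dom T k = Dom T h \<and> Cod T k = Dom T u \<and> h = u \<bullet> k"
    and rotate: "(u, v, w) \<in> Tri T \<Longrightarrow> (v, w, neg (ShArr T u)) \<in> Tri T"
begin

lemmas triD = candidateD[OF tri_cand]

text \<open>
  Weak kernels at the consecutive places of the rotated triangle give the exactness of \<open>Hom(E, -)\<close> for every \<open>E\<close>.
  The usual chase then shows that \<open>c\<close> is a monomorphism and, for \<open>E\<close> the codomain of \<open>c\<close>, yields a right inverse.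
\<close>

lemma five_lemma:
  assumes t: "(u, v, w) \<in> Tri T" and t': "(u', v', w') \<in> Tri T"
    and m: "tri_map a b c (u, v, w) (u', v', w')" and isos: "iso_arr T a" "iso_arr T b"
  shows "iso_arr T c"
proof -
  note cc = triD[OF t] triD[OF t'] note mm = tri_mapD[OF m]
  obtain a' where a': "a' \<in> Arr T" "Dom T a' = Cod T a" "Cod T a' = Dom T a"
    "a' \<bullet> a = Ident T (Dom T a)" "a \<bullet> a' = Ident T (Cod T a)" "iso_arr T a'" using isos(1) by (rule isoE)
  obtain b' where b': "b' \<in> Arr T" "Dom T b' = Cod T b" "Cod T b' = Dom T b"
    "b' \<bullet> b = Ident T (Dom T b)" "b \<bullet> b' = Ident T (Cod T b)" "iso_arr T b'" using isos(2) by (rule isoE)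
  note all = a'(1-5) b'(1-5) cc mm(1-9)
  have sq: "b' \<bullet> u' = u \<bullet> a'" by (rule square_inverse[OF mm(10)]) (use all in simp_all)
  have sa: "ShArr T a \<bullet> ShArr T a' = Ident T (ShObj T (Dom T u'))" using all by (simp flip: sh_comp)
  have mono: "k = Zero T (Dom T k) (Dom T c)"
    if k: "k \<in> Arr T" "Cod T k = Dom T c" and "c \<bullet> k = Zero T (Dom T k) (Cod T c)" for k
  proof -
    have "ShArr T a \<bullet> (w \<bullet> k) = w' \<bullet> (c \<bullet> k)"
      using all k by (simp add: mm(12) comp_reassoc[OF mm(12)] flip: comp_assoc)
    then have "ShArr T a \<bullet> (w \<bullet> k) = Zero T (Dom T k) (Cod T (ShArr T a))"
      unfolding that(3) using all k by simp
    with iso_cancel_left[OF iso_sh[OF isos(1)], of "w \<bullet> k"]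
    have "w \<bullet> k = Zero T (Dom T k) (Cod T w)" using all k by simp
    then have "\<exists>k1\<in>Arr T. Dom T k1 = Dom T k \<and> Cod T k1 = Dom T v \<and> k = v \<bullet> k1"
      using weak_kernel[OF rotate[OF t], of k] k all by simp
    then obtain k1 where k1: "k1 \<in> Arr T" "Dom T k1 = Dom T k" "Cod T k1 = Dom T v" and k_eq: "k = v \<bullet> k1"
      by blast
    have "v' \<bullet> (b \<bullet> k1) = c \<bullet> (v \<bullet> k1)" using all k k1 by (simp add: comp_reassoc[OF mm(11)] comp_assoc)
    also note k_eq[symmetric]
    finally have "v' \<bullet> (b \<bullet> k1) = c \<bullet> k" .
    then have "v' \<bullet> (b \<bullet> k1) = Zero T (Dom T k) (Cod T c)" unfolding that(3) .
    then have "\<exists>n\<in>Arr T. Dom T n = Dom T k \<and> Cod T n = Dom T u' \<and> b \<bullet> k1 = u' \<bullet> n"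
      using weak_kernel[OF t', of "b \<bullet> k1"] k k1 all by simp
    then obtain n where n: "n \<in> Arr T" "Dom T n = Dom T k" "Cod T n = Dom T u'" "b \<bullet> k1 = u' \<bullet> n"
      by blast
    have "k1 = b' \<bullet> (b \<bullet> k1)" using all k1 by (simp add: comp_cancel)
    also have "\<dots> = u \<bullet> (a' \<bullet> n)" unfolding n(4) using all n by (simp add: comp_reassoc[OF sq] comp_assoc)
    finally have "v \<bullet> k1 = v \<bullet> u \<bullet> (a' \<bullet> n)" using all n by (simp add: comp_assoc)
    then have "v \<bullet> k1 = Zero T (Dom T k) (Dom T c)" unfolding tri_zero[OF t] using all n by simp
    then show ?thesis unfolding k_eq[symmetric] .
  qed
  note r' = rotate[OF t'] and r = rotate[OF t]
  have z: "ShArr T u' \<bullet> w' = Zero T (Cod T v') (ShObj T (Cod T u'))"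
    by (rule neg_eq_zero) (use tri_zero[OF rotate[OF r']] tri_zero[OF r'] all triD[OF rotate[OF r']] in simp_all)
  have "ShArr T u \<bullet> (ShArr T a' \<bullet> w') = ShArr T (u \<bullet> a') \<bullet> w'" using all by (simp add: sh_comp comp_assoc)
  also have "\<dots> = ShArr T b' \<bullet> (ShArr T u' \<bullet> w')" unfolding sq[symmetric] using all by (simp add: sh_comp comp_assoc)
  also have "\<dots> = Zero T (Cod T v') (ShObj T (Cod T u))" unfolding z using all by simp
  finally have "ShArr T u \<bullet> (ShArr T a' \<bullet> w') = Zero T (Cod T v') (ShObj T (Cod T u))" .
  then have "\<exists>z\<in>Arr T. Dom T z = Cod T v' \<and> Cod T z = Cod T v \<and> ShArr T a' \<bullet> w' = w \<bullet> z"
    using weak_kernel[OF rotate[OF r], of "ShArr T a' \<bullet> w'"] all by simp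
  then obtain z where z: "z \<in> Arr T" "Dom T z = Cod T v'" "Cod T z = Cod T v" "ShArr T a' \<bullet> w' = w \<bullet> z"
    by blast
  define e where "e = Plus T (Ident T (Cod T v')) (neg (c \<bullet> z))"
  have e: "e \<in> Arr T" "Dom T e = Cod T v'" "Cod T e = Cod T v'" unfolding e_def using all z by simp_all
  have wz: "w' \<bullet> (c \<bullet> z) = w'"
  proof -
    have "w' \<bullet> (c \<bullet> z) = ShArr T a \<bullet> (w \<bullet> z)"
      using all z by (simp add: mm(12) flip: comp_assoc)
    also have "\<dots> = w'" unfolding z(4)[symmetric] by (rule comp_cancel) (use all sa in simp_all)
    finally show ?thesis .
  qed
  have "w' \<bullet> e = Zero T (Cod T v') (Cod T w')"
    unfolding e_def using all z wz by (simp add: comp_plus_right)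
  then have "\<exists>n\<in>Arr T. Dom T n = Cod T v' \<and> Cod T n = Cod T u' \<and> e = v' \<bullet> n"
    using weak_kernel[OF r', of e] e all by simp
  then obtain n where n: "n \<in> Arr T" "Dom T n = Cod T v'" "Cod T n = Cod T u'" and e_eq: "e = v' \<bullet> n"
    by blast
  \<comment> \<open>the defect \<open>e\<close> of \<open>z\<close> factors through \<open>n\<close>, which the inverse \<open>b'\<close> of \<open>b\<close> carries back to the first triangle\<close>
  define s where "s = Plus T z (v \<bullet> (b' \<bullet> n))"
  have s: "s \<in> Arr T" "Dom T s = Cod T c" "Cod T s = Dom T c" unfolding s_def using all z n by simp_all
  have "c \<bullet> (v \<bullet> (b' \<bullet> n)) = v' \<bullet> (b \<bullet> (b' \<bullet> n))" using all n by (simp add: comp_reassoc[OF mm(11)] comp_assoc)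
  also have "\<dots> = e" unfolding e_eq using all n by (simp add: comp_cancel)
  finally have "c \<bullet> s = Plus T (c \<bullet> z) e" unfolding s_def using all z n by (simp add: comp_plus_right)
  also have "e = Plus T (neg (c \<bullet> z)) (Ident T (Cod T v'))"
    unfolding e_def using all z by (intro plus_comm) simp_all
  also have "Plus T (c \<bullet> z) \<dots> = Plus T (Plus T (c \<bullet> z) (neg (c \<bullet> z))) (Ident T (Cod T v'))"
    using all z by (intro plus_assoc[symmetric]) simp_all
  finally have cs: "c \<bullet> s = Ident T (Cod T c)" using all z by simp
  have sc0: "Plus T (s \<bullet> c) (neg (Ident T (Dom T c))) = Zero T (Dom T c) (Dom T c)"
  proof -
    have "c \<bullet> (s \<bullet> c) = c" using comp_reassoc[OF cs, of c] all s by simp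
    then have "c \<bullet> Plus T (s \<bullet> c) (neg (Ident T (Dom T c))) = Zero T (Dom T c) (Cod T c)"
      using all s by (simp add: comp_plus_right)
    then show ?thesis using mono[of "Plus T (s \<bullet> c) (neg (Ident T (Dom T c)))"] all s by simp
  qed
  have sc: "s \<bullet> c = Ident T (Dom T c)"
    by (rule eq_if_minus_zero) (use all s sc0 in simp_all)
  show ?thesis by (rule isoI[of c s]) (use cs sc s all in simp_all)
qed

lemma iso_triangle_change:
  assumes t: "(u, v, w) \<in> Tri T" and "candidate_triangle T (u', v', w')"
    "tri_map a b c (u, v, w) (u', v', w')" "iso_arr T a" "iso_arr T b" "iso_arr T c"
  shows "(u', v', w') \<in> Tri T"
  using tri_iso[OF t assms(2) tri_map_isoI[OF assms(3-6) tri_cand[OF t] assms(2)]] .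

lemma replace_cone:
  assumes t: "(u, v, w) \<in> Tri T" and c: "c \<in> Arr T" "c' \<in> Arr T" "Dom T c = Cod T v" "Dom T c' = Cod T c" "Cod T c' = Dom T c"
    "c' \<bullet> c = Ident T (Dom T c)" "c \<bullet> c' = Ident T (Cod T c)"
  shows "(u, c \<bullet> v, w \<bullet> c') \<in> Tri T"
proof -
  note uvw = triD[OF t]
  have i: "iso_arr T c" using c by (intro isoI[of c c']) simp_all
  show ?thesis
    by (rule iso_triangle_change[OF t, of _ _ _ "Ident T (Dom T u)" "Ident T (Cod T u)" c])
      (use uvw c i in \<open>simp_all add: candidate_iff tri_map_def comp_assoc\<close>)
qed

end

text \<open>
  Both in the homotopy category and in a Verdier quotient, the triangles are the isomorphic copies of some explicit ones.
  The axioms need to be checked on these only.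
\<close>

lemma (in shift_linear_category) exact_triangles_basis:
  assumes Tri: "Tri T = triangle_closure T \<Delta>"
    and cand: "\<forall>\<tau>\<in>\<Delta>. candidate_triangle T \<tau>"
    and zero: "\<And>u v w. (u, v, w) \<in> \<Delta> \<Longrightarrow> v \<bullet> u = Zero T (Dom T u) (Cod T v)"
    and wk: "\<And>u v w h. \<lbrakk>(u, v, w) \<in> \<Delta>; h \<in> Arr T; Cod T h = Cod T u;
        v \<bullet> h = Zero T (Dom T h) (Cod T v)\<rbrakk>
        \<Longrightarrow> \<exists>k\<in>Arr T. Dom T k = Dom T h \<and> Cod T k = Dom T u \<and> h = u \<bullet> k"
    and rot: "\<And>u v w. (u, v, w) \<in> \<Delta> \<Longrightarrow> (v, w, neg (ShArr T u)) \<in> Tri T"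
  shows "exact_triangles R T"
proof -
  have iso: "(u', v', w') \<in> Tri T" if t: "(u, v, w) \<in> Tri T" "candidate_triangle T (u', v', w')"
        "iso_triangles T (u, v, w) (u', v', w')" for u v w u' v' w'
  proof -
    obtain u0 v0 w0 where 1: "(u0, v0, w0) \<in> \<Delta>" "iso_triangles T (u0, v0, w0) (u, v, w)"
      and 2: "candidate_triangle T (u, v, w)" using t(1) unfolding Tri closure_iff by auto
    from iso_triangles_trans[OF bspec[OF cand 1(1)] 2 t(2) 1(2) t(3)] show ?thesis
      unfolding Tri closure_iff by (intro conjI t(2) exI[of _ u0] exI[of _ v0] exI[of _ w0] 1(1))
  qed
  note basis = closure_basisE[OF _ cand, folded Tri]
  show ?thesis
  proof
    show "candidate_triangle T (u, v, w)" if "(u, v, w) \<in> Tri T" for u v w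
      using that[unfolded Tri closure_iff] by (rule conjunct1)
    show "(u', v', w') \<in> Tri T" if "(u, v, w) \<in> Tri T" "candidate_triangle T (u', v', w')"
        "iso_triangles T (u, v, w) (u', v', w')" for u v w u' v' w' using that by (rule iso)
  next
    fix u' v' w' assume "(u', v', w') \<in> Tri T"
    then show "v' \<bullet> u' = Zero T (Dom T u') (Cod T v')"
    proof (rule basis)
      fix u v w a b c assume h: "(u, v, w) \<in> \<Delta>" "tri_map a b c (u, v, w) (u', v', w')" "iso_arr T a"
        "iso_arr T b" "iso_arr T c" "candidate_triangle T (u, v, w)" "candidate_triangle T (u', v', w')"
      note all = candidateD[OF h(6)] candidateD[OF h(7)] note m = tri_mapD[OF h(2)]
      have "v' \<bullet> u' \<bullet> a = c \<bullet> (v \<bullet> u)" using all m(1-9) by (simp add: comp_assoc comp_reassoc[OF m(11)] flip: m(10))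
      then have "v' \<bullet> u' \<bullet> a = Zero T (Dom T a) (Cod T (v' \<bullet> u'))" unfolding zero[OF h(1)] using all m by simp
      from iso_cancel_right[OF h(3) _ _ this]
      show ?thesis using all m by simp
    qed
  next
    fix u' v' w' h assume "(u', v', w') \<in> Tri T"
     and hh: "h \<in> Arr T" "Cod T h = Cod T u'" "v' \<bullet> h = Zero T (Dom T h) (Cod T v')"
    from this(1) show "\<exists>k\<in>Arr T. Dom T k = Dom T h \<and> Cod T k = Dom T u' \<and> h = u' \<bullet> k"
    proof (rule basis)
      fix u v w a b c assume h: "(u, v, w) \<in> \<Delta>" "tri_map a b c (u, v, w) (u', v', w')" "iso_arr T a"
        "iso_arr T b" "iso_arr T c" "candidate_triangle T (u, v, w)" "candidate_triangle T (u', v', w')"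
      note all = candidateD[OF h(6)] candidateD[OF h(7)] note m = tri_mapD[OF h(2)]
      obtain b' where b': "b' \<in> Arr T" "Dom T b' = Cod T b" "Cod T b' = Dom T b"
        "b' \<bullet> b = Ident T (Dom T b)" "b \<bullet> b' = Ident T (Cod T b)" "iso_arr T b'" using h(4) by (rule isoE)
      have "c \<bullet> (v \<bullet> (b' \<bullet> h)) = v' \<bullet> (b \<bullet> (b' \<bullet> h))"
        using all m(1-9) b'(1-5) hh(1,2) by (simp add: comp_assoc comp_reassoc[OF m(11)])
      also have "\<dots> = v' \<bullet> h" using b' hh m by (simp add: comp_cancel)
      finally have "c \<bullet> (v \<bullet> (b' \<bullet> h)) = Zero T (Dom T h) (Cod T c)" using hh m by simp
      with iso_cancel_left[OF h(5), of "v \<bullet> (b' \<bullet> h)"] have "v \<bullet> (b' \<bullet> h) = Zero T (Dom T h) (Cod T v)"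
        using all m b' hh by simp
      with wk[OF h(1), of "b' \<bullet> h"] all m b' hh obtain k where
        k: "k \<in> Arr T" "Dom T k = Dom T h" "Cod T k = Dom T u" "b' \<bullet> h = u \<bullet> k" by auto
      have "h = b \<bullet> (b' \<bullet> h)" using b' hh m by (simp add: comp_cancel)
      also have "\<dots> = u' \<bullet> (a \<bullet> k)" unfolding k(4) using k all m(1-9) by (simp add: comp_assoc comp_reassoc[OF m(10)])
      finally show ?thesis using k all m by (intro bexI[of _ "a \<bullet> k"]) simp_all
    qed
  next
    fix u' v' w' assume "(u', v', w') \<in> Tri T"
    then show "(v', w', neg (ShArr T u')) \<in> Tri T"
    proof (rule basis)
      fix u v w a b c assume h: "(u, v, w) \<in> \<Delta>" "tri_map a b c (u, v, w) (u', v', w')"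
        "iso_arr T a" "iso_arr T b" "iso_arr T c"
        "candidate_triangle T (u, v, w)" "candidate_triangle T (u', v', w')"
      note all = candidateD[OF h(6)] candidateD[OF h(7)] note m = tri_mapD[OF h(2)]
      have "ShArr T b \<bullet> ShArr T u = ShArr T u' \<bullet> ShArr T a" using all m by (simp flip: sh_comp)
      then have "iso_triangles T (v, w, neg (ShArr T u)) (v', w', neg (ShArr T u'))"
        using all m by (intro iso_trianglesI[OF h(4,5) iso_sh[OF h(3)]]) simp_all
      then show "(v', w', neg (ShArr T u')) \<in> Tri T"
        by (rule iso[OF rot[OF h(1)], rotated]) (use all in \<open>simp add: candidate_iff\<close>)
    qed
  qed
qed

lemma (in exact_triangles) tri_map_exists_basis:
  assumes Tri: "Tri T = triangle_closure T \<Delta>"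
    and cand: "\<forall>\<tau>\<in>\<Delta>. candidate_triangle T \<tau>"
    and tr3: "\<And>u v w u' v' w' a b. \<lbrakk>(u, v, w) \<in> \<Delta>; (u', v', w') \<in> \<Delta>; a \<in> Arr T; b \<in> Arr T;
      Dom T a = Dom T u; Cod T a = Dom T u'; Dom T b = Cod T u; Cod T b = Cod T u'; b \<bullet> u = u' \<bullet> a\<rbrakk>
      \<Longrightarrow> \<exists>c. tri_map a b c (u, v, w) (u', v', w')"
    and t: "(u, v, w) \<in> Tri T" and t': "(u', v', w') \<in> Tri T"
    and ab: "a \<in> Arr T" "b \<in> Arr T" "Dom T a = Dom T u" "Cod T a = Dom T u'" "Dom T b = Cod T u"
     "Cod T b = Cod T u'" "b \<bullet> u = u' \<bullet> a"
  shows "\<exists>c. tri_map a b c (u, v, w) (u', v', w')"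
proof -
  note basis = closure_basisE[OF _ cand, folded Tri]
  obtain u1 v1 w1 a1 b1 c1 where 1: "(u1, v1, w1) \<in> \<Delta>" "tri_map a1 b1 c1 (u1, v1, w1) (u, v, w)"
    "iso_arr T a1" "iso_arr T b1" "iso_arr T c1"
    "candidate_triangle T (u1, v1, w1)" "candidate_triangle T (u, v, w)" by (rule basis[OF t])
  obtain u2 v2 w2 a2 b2 c2 where 2: "(u2, v2, w2) \<in> \<Delta>" "tri_map a2 b2 c2 (u2, v2, w2) (u', v', w')"
    "iso_arr T a2" "iso_arr T b2" "iso_arr T c2"
    "candidate_triangle T (u2, v2, w2)" "candidate_triangle T (u', v', w')" by (rule basis[OF t'])
  note c1 = bspec[OF cand 1(1)] and c2 = bspec[OF cand 2(1)] and c3 = tri_cand[OF t] and c4 = tri_cand[OF t']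
  note cc = candidateD[OF c1] candidateD[OF c2] candidateD[OF c3] candidateD[OF c4]
  note m1 = tri_mapD[OF 1(2)] note m2 = tri_mapD[OF 2(2)]
  obtain a1' where a1': "a1' \<in> Arr T" "Dom T a1' = Cod T a1" "Cod T a1' = Dom T a1"
    "a1' \<bullet> a1 = Ident T (Dom T a1)" "a1 \<bullet> a1' = Ident T (Cod T a1)" using 1(3) by (rule isoE)
  obtain b1' where b1': "b1' \<in> Arr T" "Dom T b1' = Cod T b1" "Cod T b1' = Dom T b1"
    "b1' \<bullet> b1 = Ident T (Dom T b1)" "b1 \<bullet> b1' = Ident T (Cod T b1)" using 1(4) by (rule isoE)
  obtain c1' where c1': "c1' \<in> Arr T" "Dom T c1' = Cod T c1" "Cod T c1' = Dom T c1"
    "c1' \<bullet> c1 = Ident T (Dom T c1)" "c1 \<bullet> c1' = Ident T (Cod T c1)" using 1(5) by (rule isoE)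
  obtain a2' where a2': "a2' \<in> Arr T" "Dom T a2' = Cod T a2" "Cod T a2' = Dom T a2"
    "a2' \<bullet> a2 = Ident T (Dom T a2)" "a2 \<bullet> a2' = Ident T (Cod T a2)" using 2(3) by (rule isoE)
  obtain b2' where b2': "b2' \<in> Arr T" "Dom T b2' = Cod T b2" "Cod T b2' = Dom T b2"
    "b2' \<bullet> b2 = Ident T (Dom T b2)" "b2 \<bullet> b2' = Ident T (Cod T b2)" using 2(4) by (rule isoE)
  note inv1 = tri_map_inverse[OF c1 c3 1(2) a1' b1' c1']
  have sq: "b2' \<bullet> u' = u2 \<bullet> a2'"
    by (rule square_inverse[OF m2(10)]) (use cc m2(1-9) a2' b2' in simp_all)
  have "b2' \<bullet> (b \<bullet> b1) \<bullet> u1 = b2' \<bullet> (u' \<bullet> (a \<bullet> a1))"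
    using cc m1(1-9) m2(1-9) a2' b2' ab(1-6) by (simp add: comp_assoc m1(10) comp_reassoc[OF ab(7)])
  also have "\<dots> = u2 \<bullet> (a2' \<bullet> (a \<bullet> a1))"
    using cc m1(1-9) m2(1-9) a2' b2' ab(1-6) by (simp add: comp_assoc comp_reassoc[OF sq])
  finally have eq: "b2' \<bullet> (b \<bullet> b1) \<bullet> u1 = u2 \<bullet> (a2' \<bullet> (a \<bullet> a1))" .
  have "\<exists>c. tri_map (a2' \<bullet> (a \<bullet> a1)) (b2' \<bullet> (b \<bullet> b1)) c (u1, v1, w1) (u2, v2, w2)"
    by (rule tr3[OF 1(1) 2(1) _ _ _ _ _ _ eq])
      (use cc m1(1-9) m2(1-9) a2' b2' ab(1-6) in simp_all)
  then obtain c where c: "tri_map (a2' \<bullet> (a \<bullet> a1)) (b2' \<bullet> (b \<bullet> b1)) c (u1, v1, w1) (u2, v2, w2)" ..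
  note x = tri_map_comp[OF c3 c1 c4 inv1 tri_map_comp[OF c1 c2 c4 c 2(2)]]
  have "a2 \<bullet> (a2' \<bullet> (a \<bullet> a1)) \<bullet> a1' = a" "b2 \<bullet> (b2' \<bullet> (b \<bullet> b1)) \<bullet> b1' = b"
    using cc m1(1-9) m2(1-9) a2' b2' a1' b1' ab(1-6) by (simp_all add: comp_assoc comp_cancel)
  from x[unfolded this] show ?thesis ..
qed

section \<open>Annihilators in triangulated categories\<close>

text \<open>
  The rotation of triangles is only available in one direction, which is why cocones are required besides cones.  The
  octahedral axiom records just the objects of the fourth triangle; cones being unique up to isomorphism, this is enough
  for two-out-of-three arguments and for filtering a cone.  The last axiom, that \<open>r\<close> annihilates some cone of
  multiplication by \<open>r\<close>, is the extra property of categories of complexes on which the theorem rests.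
\<close>

locale triangulated = exact_triangles +
  assumes tri_map_exists: "\<lbrakk>(u, v, w) \<in> Tri T; (u', v', w') \<in> Tri T; a \<in> Arr T; b \<in> Arr T;
      Dom T a = Dom T u; Cod T a = Dom T u'; Dom T b = Cod T u; Cod T b = Cod T u'; b \<bullet> u = u' \<bullet> a\<rbrakk>
      \<Longrightarrow> \<exists>c. tri_map a b c (u, v, w) (u', v', w')"
    and cone_exists: "f \<in> Arr T \<Longrightarrow> \<exists>v w. (f, v, w) \<in> Tri T"
    and cocone_exists: "f \<in> Arr T \<Longrightarrow> \<exists>u w. (u, f, w) \<in> Tri T"
    and zero_object: "\<exists>Z\<in>Obj T. Ident T Z = Zero T Z Z \<and>
      (\<forall>E\<in>Obj T. (Zero T Z E, Ident T E, Zero T E (ShObj T Z)) \<in> Tri T)"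
    and octahedron: "\<lbrakk>f \<in> Arr T; g \<in> Arr T; Dom T g = Cod T f\<rbrakk> \<Longrightarrow>
      \<exists>v1 w1 v2 w2 v3 w3 a b c. (f, v1, w1) \<in> Tri T \<and> (g, v2, w2) \<in> Tri T \<and> (g \<bullet> f, v3, w3) \<in> Tri T \<and>
        (a, b, c) \<in> Tri T \<and> Dom T a = Cod T v1 \<and> Cod T a = Cod T v3 \<and> Cod T b = Cod T v2"
    and koszul: "\<lbrakk>X \<in> Obj T; r \<in> carrier R\<rbrakk> \<Longrightarrow>
      \<exists>v w. (Scale T r (Ident T X), v, w) \<in> Tri T \<and>
        Scale T r (Ident T (Cod T v)) = Zero T (Cod T v) (Cod T v)"
begin

text \<open>
  A filler towards the triangle \<open>0 \<rightarrow> E \<rightarrow> E\<close> is the desired factorisation.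
\<close>

lemma weak_cokernel:
  assumes t: "(u, v, w) \<in> Tri T" and h: "h \<in> Arr T" "Dom T h = Cod T u"
    "h \<bullet> u = Zero T (Dom T u) (Cod T h)"
  shows "\<exists>k\<in>Arr T. Dom T k = Cod T v \<and> Cod T k = Cod T h \<and> h = k \<bullet> v"
proof -
  note uvw = triD[OF t]
  obtain Z where Z: "Z \<in> Obj T"
    and ZE: "(Zero T Z (Cod T h), Ident T (Cod T h), Zero T (Cod T h) (ShObj T Z)) \<in> Tri T"
    using zero_object cod_obj[OF h(1)] by blast
  have "\<exists>c. tri_map (Zero T (Dom T u) Z) h c (u, v, w) (Zero T Z (Cod T h), Ident T (Cod T h), Zero T (Cod T h) (ShObj T Z))"
    by (rule tri_map_exists[OF t ZE]) (use h Z uvw in simp_all)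
  then obtain c where c: "tri_map (Zero T (Dom T u) Z) h c (u, v, w) (Zero T Z (Cod T h), Ident T (Cod T h), Zero T (Cod T h) (ShObj T Z))" ..
  from tri_mapD[OF c] show ?thesis using h Z by (intro bexI[of _ c]) simp_all
qed

lemma cones_iso:
  assumes t: "(u, v, w) \<in> Tri T" "(u', v', w') \<in> Tri T" and i: "iso_arr T a" "iso_arr T b"
    and d: "Dom T a = Dom T u" "Cod T a = Dom T u'" "Dom T b = Cod T u" "Cod T b = Cod T u'" "b \<bullet> u = u' \<bullet> a"
  shows "iso_obj T (Cod T v) (Cod T v')"
proof -
  obtain c where c: "tri_map a b c (u, v, w) (u', v', w')"
    using tri_map_exists[OF t iso_arr_arr[OF i(1)] iso_arr_arr[OF i(2)] d] ..
  from tri_mapD[OF c] five_lemma[OF t c i] show ?thesis by (intro iso_objI[of c]) simp_all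
qed

lemma cone_unique:
  assumes "(u, v, w) \<in> Tri T" "(u, v', w') \<in> Tri T"
  shows "iso_obj T (Cod T v) (Cod T v')"
  by (rule cones_iso[OF assms, of "Ident T (Dom T u)" "Ident T (Cod T u)"])
    (use triD[OF assms(1)] in simp_all)

lemma mult_null_iso:
  assumes "iso_obj T X Y" "X \<in> mult_null T r" "r \<in> carrier R"
  shows "Y \<in> mult_null T r"
proof -
  obtain f where f: "iso_arr T f" "f \<in> Arr T" "Dom T f = X" "Cod T f = Y" using assms(1) by (rule iso_objE)
  obtain g where g: "g \<in> Arr T" "Dom T g = Cod T f" "Cod T g = Dom T f" "f \<bullet> g = Ident T (Cod T f)"
    using f(1) by (rule isoE)
  have X: "X \<in> Obj T" "Scale T r (Ident T X) = Zero T X X" using assms(2) by (simp_all add: mult_null_def)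
  have "Scale T r (Ident T Y) = f \<bullet> Scale T r (Ident T X) \<bullet> g"
    using f g X(1) assms(3) by (simp add: comp_assoc)
  also have "\<dots> = Zero T Y Y" unfolding X(2) using f g X(1) iso_obj_objs[OF assms(1)] by simp
  finally show ?thesis using iso_obj_objs[OF assms(1)] by (simp add: mult_null_def)
qed

text \<open>
  Multiplication by \<open>s\<close> on the middle term \<open>E\<close> of a triangle \<open>X \<rightarrow> E \<rightarrow> Y\<close> vanishes after \<open>E \<rightarrow> Y\<close>, hence factors
  through \<open>X\<close>, which is annihilated by \<open>r\<close>.
\<close>

lemma star_mult_null:
  assumes r: "r \<in> carrier R" "s \<in> carrier R"
  shows "star T (mult_null T r) (mult_null T s) \<subseteq> mult_null T (r \<otimes> s)"
proof
  fix E assume "E \<in> star T (mult_null T r) (mult_null T s)"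
  then obtain u v w where t: "(u, v, w) \<in> Tri T" and E: "Cod T u = E" "E \<in> Obj T"
    and X: "Scale T r (Ident T (Dom T u)) = Zero T (Dom T u) (Dom T u)"
    and Y: "Scale T s (Ident T (Cod T v)) = Zero T (Cod T v) (Cod T v)"
    by (auto simp: star_def mult_null_def)
  note uvw = triD[OF t]
  have "v \<bullet> Scale T s (Ident T E) = Scale T s (Ident T (Cod T v)) \<bullet> v"
    using uvw E r by simp
  also have "\<dots> = Zero T (Dom T v) (Cod T v)" unfolding Y using uvw by simp
  finally have "\<exists>k\<in>Arr T. Dom T k = E \<and> Cod T k = Dom T u \<and> Scale T s (Ident T E) = u \<bullet> k"
    using weak_kernel[OF t, of "Scale T s (Ident T E)"] uvw E r by simp
  then obtain k where k: "k \<in> Arr T" "Dom T k = E" "Cod T k = Dom T u" "Scale T s (Ident T E) = u \<bullet> k" by blast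
  have "Scale T (r \<otimes> s) (Ident T E) = Scale T r (u \<bullet> k)"
    unfolding k(4)[symmetric] using r E by (simp add: scale_mult)
  also have "\<dots> = u \<bullet> (Scale T r (Ident T (Dom T u)) \<bullet> k)" using k(1-3) r uvw by simp
  also have "\<dots> = Zero T E E" unfolding X using k(1-3) uvw E by simp
  finally show "E \<in> mult_null T (r \<otimes> s)" using E by (simp add: mult_null_def)
qed

lemma smd_mult_null:
  assumes r: "r \<in> carrier R"
  shows "smd T (mult_null T r) \<subseteq> mult_null T r"
proof
  fix E assume "E \<in> smd T (mult_null T r)"
  then obtain F i p where F: "F \<in> Obj T" "Scale T r (Ident T F) = Zero T F F" and E: "E \<in> Obj T"
    and ip: "i \<in> Arr T" "Dom T i = E" "Cod T i = F" "p \<in> Arr T" "Dom T p = F" "Cod T p = E" "p \<bullet> i = Ident T E"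
    unfolding smd_def mult_null_def biproduct_def homs_iff Bex_def mem_Collect_eq by blast
  have "Scale T r (Ident T E) = p \<bullet> (Scale T r (Ident T F) \<bullet> i)" using ip F(1) E r by simp
  also have "\<dots> = Zero T E E" unfolding F(2) using ip F(1) E r by simp
  finally show "E \<in> mult_null T r" using E by (simp add: mult_null_def)
qed

lemma prod_carrier: "set rs \<subseteq> carrier R \<Longrightarrow> foldr (\<otimes>) rs \<one> \<in> carrier R"
  by (induction rs) auto

lemma star_list_mult_null:
  assumes "set rs \<subseteq> carrier R" "rs \<noteq> []"
  shows "star_list T (map (mult_null T) rs) \<subseteq> mult_null T (foldr (\<otimes>) rs \<one>)"
  using assms(2,1)
proof (induction rs rule: list_nonempty_induct)
  case (single r)
  then show ?case by simp
next
  case (cons r rs)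
  obtain s ss where rs: "rs = s # ss" using cons by (cases rs) auto
  have "star T (mult_null T r) (star_list T (map (mult_null T) rs))
      \<subseteq> star T (mult_null T r) (mult_null T (foldr (\<otimes>) rs \<one>))"
    using cons unfolding star_def by auto
  also have "\<dots> \<subseteq> mult_null T (r \<otimes> foldr (\<otimes>) rs \<one>)"
    using cons prod_carrier[of rs] by (intro star_mult_null) auto
  finally show ?case unfolding rs by simp
qed

text \<open>
  The octahedral axiom for \<open>X \<rightarrow> X \<rightarrow> X\<close>, first \<open>r\<close> and then the product \<open>q\<close> of the remaining elements, gives a triangle
  \<open>X//r \<rightarrow> X//rq \<rightarrow> X//q\<close>.
\<close>

lemma koszul_in_star_list:
  assumes X: "X \<in> Obj T" and "rs \<noteq> []" "set rs \<subseteq> carrier R"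
  shows "\<exists>v w. (Scale T (foldr (\<otimes>) rs \<one>) (Ident T X), v, w) \<in> Tri T \<and>
    Cod T v \<in> star_list T (map (mult_null T) rs)"
  using assms(2,3)
proof (induction rs rule: list_nonempty_induct)
  case (single r)
  then obtain v w where vw: "(Scale T r (Ident T X), v, w) \<in> Tri T"
        "Scale T r (Ident T (Cod T v)) = Zero T (Cod T v) (Cod T v)" using koszul[OF X, of r] by auto
  have "Cod T v \<in> mult_null T r" using vw triD[OF vw(1)] by (simp add: mult_null_def)
  then show ?case using vw single by auto
next
  case (cons r rs)
  define q where "q = foldr (\<otimes>) rs \<one>"
  have rq: "r \<in> carrier R" "q \<in> carrier R" using cons.prems prod_carrier[of rs] by (auto simp: q_def)
  obtain s ss where rs: "rs = s # ss" using cons by (cases rs) auto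
  obtain v w where vw: "(Scale T q (Ident T X), v, w) \<in> Tri T" "Cod T v \<in> star_list T (map (mult_null T) rs)"
    using cons unfolding q_def by auto
  obtain v' w' where vw': "(Scale T r (Ident T X), v', w') \<in> Tri T"
        "Scale T r (Ident T (Cod T v')) = Zero T (Cod T v') (Cod T v')" using koszul[OF X, of r] rq by auto
  have comp: "Scale T q (Ident T X) \<bullet> Scale T r (Ident T X) = Scale T (r \<otimes> q) (Ident T X)"
    using rq X by (simp add: scale_mult)
  have "\<exists>v1 w1 v2 w2 v3 w3 a b c. (Scale T r (Ident T X), v1, w1) \<in> Tri T \<and> (Scale T q (Ident T X), v2, w2) \<in> Tri T \<and>
       (Scale T (r \<otimes> q) (Ident T X), v3, w3) \<in> Tri T \<and>
        (a, b, c) \<in> Tri T \<and> Dom T a = Cod T v1 \<and> Cod T a = Cod T v3 \<and> Cod T b = Cod T v2"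
    using octahedron[of "Scale T r (Ident T X)" "Scale T q (Ident T X)", unfolded comp] rq X by simp
  then obtain v1 w1 v2 w2 v3 w3 a b c where o: "(Scale T r (Ident T X), v1, w1) \<in> Tri T" "(Scale T q (Ident T X), v2, w2) \<in> Tri T"
       "(Scale T (r \<otimes> q) (Ident T X), v3, w3) \<in> Tri T"
        "(a, b, c) \<in> Tri T" "Dom T a = Cod T v1" "Cod T a = Cod T v3" "Cod T b = Cod T v2" by (elim exE conjE)
  have 1: "Cod T v1 \<in> mult_null T r"
    by (rule mult_null_iso[OF cone_unique[OF vw'(1) o(1)] _ rq(1)]) (use vw'(2) triD[OF vw'(1)] in \<open>simp add: mult_null_def\<close>)
  obtain f where f: "iso_arr T f" "f \<in> Arr T" "Dom T f = Cod T v2" "Cod T f = Cod T v"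
    using cone_unique[OF o(2) vw(1)] by (rule iso_objE)
  obtain g where g: "g \<in> Arr T" "Dom T g = Cod T f" "Cod T g = Dom T f" "g \<bullet> f = Ident T (Dom T f)" "f \<bullet> g = Ident T (Cod T f)"
    using f(1) by (rule isoE)
  note abc = triD[OF o(4)] triD[OF o(1)] triD[OF o(3)]
  have "(a, f \<bullet> b, c \<bullet> g) \<in> Tri T"
    by (rule replace_cone[OF o(4)]) (use f g abc o(5-7) in simp_all)
  moreover have "Dom T a \<in> mult_null T r" "Cod T (f \<bullet> b) \<in> star_list T (map (mult_null T) rs)"
    using 1 vw(2) f abc o(5-7) by simp_all
  ultimately have "Cod T v3 \<in> star T (mult_null T r) (star_list T (map (mult_null T) rs))"
    unfolding star_def mem_Collect_eq using o(6) cod_obj[OF triD(2)[OF o(3)]] by blast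
  then show ?case using o(3) unfolding rs q_def by auto
qed

text \<open>
  The triangle on \<open>0 : X \<rightarrow> X\<close> splits: \<open>v\<close> has a retraction \<open>p\<close> and \<open>w\<close> has a section, which is corrected to a section
  \<open>i\<close> with \<open>p i = 0\<close>.  The idempotent \<open>e\<close> complementary to \<open>v p + i w\<close> vanishes on \<open>v\<close>, hence factors through \<open>w\<close>; as it
  also vanishes on \<open>i\<close>, it is zero.
\<close>

lemma cone_zero_biproduct:
  assumes t: "(Zero T X X, v, w) \<in> Tri T" and X: "X \<in> Obj T"
  shows "biproduct T (Cod T v) X (ShObj T X)"
proof -
  note uvw = triD[OF t]
  have rot: "(v, w, Zero T (ShObj T X) (ShObj T X)) \<in> Tri T" using rotate[OF t] X by simp
  have vz: "v \<in> Arr T" "w \<in> Arr T" "Dom T v = X" "Dom T w = Cod T v" "Cod T w = ShObj T X" "Cod T v \<in> Obj T"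
    using uvw X by simp_all
  have "\<exists>p\<in>Arr T. Dom T p = Cod T v \<and> Cod T p = X \<and> Ident T X = p \<bullet> v"
    using weak_cokernel[OF t, of "Ident T X"] X by simp
  then obtain p where p: "p \<in> Arr T" "Dom T p = Cod T v" "Cod T p = X" "p \<bullet> v = Ident T X" by metis
  have "\<exists>j\<in>Arr T. Dom T j = ShObj T X \<and> Cod T j = Cod T v \<and> Ident T (ShObj T X) = w \<bullet> j"
    using weak_kernel[OF rotate[OF rot], of "Ident T (ShObj T X)"] X uvw by simp
  then obtain j where j: "j \<in> Arr T" "Dom T j = ShObj T X" "Cod T j = Cod T v" "w \<bullet> j = Ident T (ShObj T X)" by metis
  have wv: "w \<bullet> v = Zero T X (ShObj T X)" using tri_zero[OF rot] vz by simp
  define i where "i = Plus T j (neg (v \<bullet> (p \<bullet> j)))"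
  have i: "i \<in> Arr T" "Dom T i = ShObj T X" "Cod T i = Cod T v" unfolding i_def using vz p j by simp_all
  have pi: "p \<bullet> i = Zero T (ShObj T X) X"
    unfolding i_def using vz p j by (simp add: comp_plus_right comp_cancel)
  have wi: "w \<bullet> i = Ident T (ShObj T X)"
    unfolding i_def using vz p(1-3) j X by (simp add: comp_plus_right comp_reassoc[OF wv])
  define s where "s = Plus T (v \<bullet> p) (i \<bullet> w)"
  have s: "s \<in> Arr T" "Dom T s = Cod T v" "Cod T s = Cod T v" unfolding s_def using vz p i by simp_all
  have sv: "s \<bullet> v = v" unfolding s_def using vz p i wv X by (simp add: comp_plus_left comp_assoc)
  have si: "s \<bullet> i = i" unfolding s_def using vz p i wi pi X by (simp add: comp_plus_left comp_assoc)
  define e where "e = Plus T (Ident T (Cod T v)) (neg s)"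
  have e: "e \<in> Arr T" "Dom T e = Cod T v" "Cod T e = Cod T v" unfolding e_def using s vz by simp_all
  have ev: "e \<bullet> v = Zero T X (Cod T v)" unfolding e_def using vz s sv X by (simp add: comp_plus_left)
  have ei: "e \<bullet> i = Zero T (ShObj T X) (Cod T v)" unfolding e_def using vz s i si X by (simp add: comp_plus_left)
  have "\<exists>k\<in>Arr T. Dom T k = ShObj T X \<and> Cod T k = Cod T v \<and> e = k \<bullet> w"
    using weak_cokernel[OF rot, of e] e ev vz by simp
  then obtain k where k: "k \<in> Arr T" "Dom T k = ShObj T X" "Cod T k = Cod T v" and ek: "e = k \<bullet> w" by blast
  have "k = k \<bullet> (w \<bullet> i)" unfolding wi using k by simp
  also have "\<dots> = Zero T (ShObj T X) (Cod T v)" using ei[unfolded ek] k vz i by (simp add: comp_assoc)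
  finally have e0: "e = Zero T (Cod T v) (Cod T v)" using ek vz by simp
  have "Ident T (Cod T v) = s"
    by (rule eq_if_minus_zero) (use s vz e0[unfolded e_def] in simp_all)
  then have "Plus T (v \<bullet> p) (i \<bullet> w) = Ident T (Cod T v)" by (simp add: s_def)
  then show ?thesis unfolding biproduct_def
    by (intro bexI[of _ v] bexI[of _ p] bexI[of _ i] bexI[of _ w])
      (use vz p i pi wi wv X in \<open>simp_all add: homs_iff\<close>)
qed

theorem mult_null_prod:
  assumes "set rs \<subseteq> carrier R" "rs \<noteq> []"
  shows "mult_null T (foldr (\<otimes>) rs \<one>) = smd T (star_list T (map (mult_null T) rs))"
proof
  have "smd T (star_list T (map (mult_null T) rs)) \<subseteq> smd T (mult_null T (foldr (\<otimes>) rs \<one>))"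
    using star_list_mult_null[OF assms] unfolding smd_def by blast
  also have "\<dots> \<subseteq> mult_null T (foldr (\<otimes>) rs \<one>)" by (rule smd_mult_null[OF prod_carrier[OF assms(1)]])
  finally show "smd T (star_list T (map (mult_null T) rs)) \<subseteq> mult_null T (foldr (\<otimes>) rs \<one>)" .
  show "mult_null T (foldr (\<otimes>) rs \<one>) \<subseteq> smd T (star_list T (map (mult_null T) rs))"
  proof
    fix X assume "X \<in> mult_null T (foldr (\<otimes>) rs \<one>)"
    then have X: "X \<in> Obj T" "Scale T (foldr (\<otimes>) rs \<one>) (Ident T X) = Zero T X X" by (simp_all add: mult_null_def)
    from koszul_in_star_list[OF X(1) assms(2,1), unfolded X(2)]
    obtain v w where vw: "(Zero T X X, v, w) \<in> Tri T" "Cod T v \<in> star_list T (map (mult_null T) rs)" by blast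
    show "X \<in> smd T (star_list T (map (mult_null T) rs))"
      unfolding smd_def using X(1) vw(2) cone_zero_biproduct[OF vw(1) X(1)] sh_obj[OF X(1)] by blast
  qed
qed

end

section \<open>Calculus of fractions\<close>

lemma Union_constant:
  "\<lbrakk>A \<noteq> {}; \<And>C. C \<in> A \<Longrightarrow> C = B\<rbrakk> \<Longrightarrow> \<Union> A = B"
  by blast

text \<open>
  Closure under cones and the inverse shift is closure in all positions of a triangle, because rotation turns each of its
  objects into a cone, up to a shift.
\<close>

locale triangulated_subcategory = triangulated +
  fixes S :: "'c set"
  assumes S_obj: "S \<subseteq> Obj T"
    and S_iso: "\<lbrakk>X \<in> S; iso_obj T X Y\<rbrakk> \<Longrightarrow> Y \<in> S"
    and S_zero: "\<exists>Z\<in>S. Ident T Z = Zero T Z Z"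
    and S_cone: "\<lbrakk>(u, v, w) \<in> Tri T; Dom T u \<in> S; Cod T u \<in> S\<rbrakk> \<Longrightarrow> Cod T v \<in> S"
    and S_unshift: "\<lbrakk>X \<in> Obj T; ShObj T X \<in> S\<rbrakk> \<Longrightarrow> X \<in> S"
begin

abbreviation "D \<equiv> denoms T S"

lemma zero_in_S: "X \<in> Obj T \<Longrightarrow> Ident T X = Zero T X X \<Longrightarrow> X \<in> S"
  using S_zero S_obj zero_objs_iso S_iso by blast

lemma S_shift: assumes "X \<in> S" shows "ShObj T X \<in> S"
proof -
  have X: "X \<in> Obj T" using assms S_obj by blast
  obtain Z where Z: "Z \<in> Obj T" "Ident T Z = Zero T Z Z" and "(Zero T Z X, Ident T X, Zero T X (ShObj T Z)) \<in> Tri T"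
    using zero_object X by blast
  from rotate[OF rotate[OF this(3)]] have "(Zero T X (ShObj T Z), Zero T (ShObj T Z) (ShObj T X), neg (ShArr T (Ident T X))) \<in> Tri T"
    using X Z(1) by simp
  moreover have "ShObj T Z \<in> S"
    using sh_ident[OF Z(1), symmetric] Z by (intro zero_in_S) simp_all
  ultimately show ?thesis using S_cone assms X Z(1) by fastforce
qed

lemma S_cone_dom: "\<lbrakk>(u, v, w) \<in> Tri T; Cod T u \<in> S; Cod T v \<in> S\<rbrakk> \<Longrightarrow> Dom T u \<in> S"
  using S_cone[OF rotate] S_unshift triD by (metis dom_obj)

lemma S_cone_cod: "\<lbrakk>(u, v, w) \<in> Tri T; Dom T u \<in> S; Cod T v \<in> S\<rbrakk> \<Longrightarrow> Cod T u \<in> S"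
  using S_cone_dom[OF rotate] triD S_shift by metis

lemma denomsI: "\<lbrakk>(s, v, w) \<in> Tri T; Cod T v \<in> S\<rbrakk> \<Longrightarrow> s \<in> D"
  unfolding denoms_def by blast

lemma denomsE:
  assumes "s \<in> D" obtains v w where "(s, v, w) \<in> Tri T" "Cod T v \<in> S"
  using assms unfolding denoms_def by blast

lemma denoms_arr: "s \<in> D \<Longrightarrow> s \<in> Arr T"
  by (elim denomsE) (rule triD)

lemma denoms_cone: "\<lbrakk>s \<in> D; (s, v, w) \<in> Tri T\<rbrakk> \<Longrightarrow> Cod T v \<in> S"
  by (elim denomsE) (rule S_iso[OF _ cone_unique])

lemma denoms_ident: assumes "X \<in> Obj T" shows "Ident T X \<in> D"
proof -
  obtain Z where Z: "Z \<in> Obj T" "Ident T Z = Zero T Z Z" and "(Zero T Z X, Ident T X, Zero T X (ShObj T Z)) \<in> Tri T"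
    using zero_object assms by blast
  from rotate[OF this(3)] have t: "(Ident T X, Zero T X (ShObj T Z), neg (ShArr T (Zero T Z X))) \<in> Tri T" .
  have "ShObj T Z \<in> S"
    using sh_ident[OF Z(1), symmetric] Z by (intro zero_in_S) simp_all
  then show ?thesis using assms Z by (intro denomsI[OF t]) simp
qed

text \<open>
  The cones of \<open>f\<close>, \<open>g f\<close> and \<open>g\<close> form a triangle, so any two of them lying in \<open>S\<close> force the third to do so.
\<close>

lemma denoms_two_of_three:
  assumes "f \<in> Arr T" "g \<in> Arr T" "Dom T g = Cod T f"
  shows denoms_comp: "\<lbrakk>f \<in> D; g \<in> D\<rbrakk> \<Longrightarrow> g \<bullet> f \<in> D"
    and denoms_cancel: "\<lbrakk>g \<in> D; g \<bullet> f \<in> D\<rbrakk> \<Longrightarrow> f \<in> D"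
proof -
  obtain v1 w1 v2 w2 v3 w3 a b c where o: "(f, v1, w1) \<in> Tri T" "(g, v2, w2) \<in> Tri T" "(g \<bullet> f, v3, w3) \<in> Tri T"
        "(a, b, c) \<in> Tri T" "Dom T a = Cod T v1" "Cod T a = Cod T v3" "Cod T b = Cod T v2"
    using octahedron[OF assms] by (elim exE conjE)
  show "g \<bullet> f \<in> D" if fg: "f \<in> D" "g \<in> D"
    by (rule denomsI[OF o(3)]) (use S_cone_cod[OF o(4)] denoms_cone[OF fg(1) o(1)] denoms_cone[OF fg(2) o(2)] o(5-7) in simp)
  show "f \<in> D" if fg: "g \<in> D" "g \<bullet> f \<in> D"
    by (rule denomsI[OF o(1)]) (use S_cone_dom[OF o(4)] denoms_cone[OF fg(1) o(2)] denoms_cone[OF fg(2) o(3)] o(5-7) in simp)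
qed

lemma denoms_sh: assumes "s \<in> D" shows "ShArr T s \<in> D"
proof -
  obtain v w where t: "(s, v, w) \<in> Tri T" "Cod T v \<in> S" using assms by (rule denomsE)
  note svw = triD[OF t(1)]
  have "(neg (ShArr T s), neg (ShArr T v), neg (ShArr T w)) \<in> Tri T" by (rule rotate[OF rotate[OF rotate[OF t(1)]]])
  \<comment> \<open>three rotations shift a triangle and negate its arrows; \<open>- 1\<close> on the first object removes the sign of \<open>s\<close>\<close>
  then have "(ShArr T s, neg (ShArr T v), ShArr T w) \<in> Tri T"
    by (rule iso_triangle_change[of _ _ _ _ _ _ "neg (Ident T (ShObj T (Dom T s)))" "Ident T (ShObj T (Cod T s))" "Ident T (ShObj T (Cod T v))"])
      (use svw in \<open>simp_all add: candidate_iff tri_map_def\<close>)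
  then show ?thesis by (rule denomsI) (use svw S_shift[OF t(2)] in simp)
qed

text \<open>
  With \<open>v\<close> the cone of \<open>s\<close>, the cocone \<open>t\<close> of \<open>v f\<close> has the same cone as \<open>s\<close>, and \<open>f t\<close> factors through \<open>s\<close> since \<open>v f t = 0\<close>.
\<close>

lemma Ore:
  assumes s: "s \<in> D" and f: "f \<in> Arr T" "Cod T f = Cod T s"
  obtains t g where "t \<in> D" "t \<in> Arr T" "g \<in> Arr T" "Cod T t = Dom T f" "Dom T g = Dom T t" "Cod T g = Dom T s" "f \<bullet> t = s \<bullet> g"
proof -
  obtain v w where t: "(s, v, w) \<in> Tri T" "Cod T v \<in> S" using s by (rule denomsE)
  note svw = triD[OF t(1)]
  obtain t w' where t': "(t, v \<bullet> f, w') \<in> Tri T" using cocone_exists[of "v \<bullet> f"] svw f by auto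
  note tt = triD[OF t']
  have tD: "t \<in> D" by (rule denomsI[OF t']) (use t(2) svw f in simp)
  have tc: "Cod T t = Dom T f" using tt(4) svw f by simp
  have "v \<bullet> (f \<bullet> t) = v \<bullet> f \<bullet> t" using svw f tt(1) tc by (simp add: comp_assoc)
  then have "v \<bullet> (f \<bullet> t) = Zero T (Dom T t) (Cod T v)" unfolding tri_zero[OF t'] using svw f tc by simp
  then have "\<exists>g\<in>Arr T. Dom T g = Dom T t \<and> Cod T g = Dom T s \<and> f \<bullet> t = s \<bullet> g"
    using weak_kernel[OF t(1), of "f \<bullet> t"] svw f tt(1) tc by simp
  then show thesis using that tD tt(1) tc by blast
qed

text \<open>
  If \<open>s f = 0\<close>, then \<open>f\<close> factors through the cocone of \<open>s\<close>, an object of \<open>S\<close>; the cocone of that factor is the required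
  denominator.
\<close>

lemma denoms_kills:
  assumes s: "s \<in> D" and f: "f \<in> Arr T" "Cod T f = Dom T s" "s \<bullet> f = Zero T (Dom T f) (Cod T s)"
  shows "\<exists>t\<in>D. Cod T t = Dom T f \<and> f \<bullet> t = Zero T (Dom T t) (Cod T f)"
proof -
  have sa: "s \<in> Arr T" by (rule denoms_arr[OF s])
  obtain a w where t: "(a, s, w) \<in> Tri T" using cocone_exists[OF sa] by blast
  note asw = triD[OF t]
  have "Cod T w \<in> S" by (rule denoms_cone[OF s rotate[OF t]])
  then have B: "Dom T a \<in> S" using asw S_unshift[of "Dom T a"] by simp
  have "\<exists>k\<in>Arr T. Dom T k = Dom T f \<and> Cod T k = Dom T a \<and> f = a \<bullet> k"
    using weak_kernel[OF t, of f] asw f by simp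
  then obtain k where k: "k \<in> Arr T" "Dom T k = Dom T f" "Cod T k = Dom T a" and fk: "f = a \<bullet> k" by blast
  obtain t w' where t': "(t, k, w') \<in> Tri T" using cocone_exists[OF k(1)] by blast
  note tt = triD[OF t']
  have tD: "t \<in> D" by (rule denomsI[OF t']) (use B k in simp)
  have "f \<bullet> t = a \<bullet> (k \<bullet> t)" unfolding fk using asw k tt by (simp add: comp_assoc)
  also have "\<dots> = Zero T (Dom T t) (Cod T f)" unfolding tri_zero[OF t'] using asw k(1,3) tt f(2) by simp
  finally show ?thesis using tD tt(4) k(2) by (intro bexI[of _ t]) simp_all
qed

lemma denoms_equalizes:
  assumes s: "s \<in> D" and x: "x \<in> Arr T" "y \<in> Arr T" "Dom T x = Dom T y" "Cod T x = Dom T s" "Cod T y = Dom T s" "s \<bullet> x = s \<bullet> y"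
  obtains t where "t \<in> D" "t \<in> Arr T" "Cod T t = Dom T x" "x \<bullet> t = y \<bullet> t"
proof -
  have sa: "s \<in> Arr T" by (rule denoms_arr[OF s])
  have "\<exists>t\<in>D. Cod T t = Dom T x \<and> Plus T x (neg y) \<bullet> t = Zero T (Dom T t) (Cod T x)"
    using denoms_kills[OF s, of "Plus T x (neg y)"] x sa by (simp add: comp_plus_right)
  then obtain t where t: "t \<in> D" "Cod T t = Dom T x" "Plus T x (neg y) \<bullet> t = Zero T (Dom T t) (Cod T x)" by blast
  have ta: "t \<in> Arr T" by (rule denoms_arr[OF t(1)])
  have z: "Plus T (x \<bullet> t) (neg (y \<bullet> t)) = Zero T (Dom T t) (Cod T x)"
    using t(2,3) ta x by (simp add: comp_plus_left)
  have "x \<bullet> t = y \<bullet> t"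
    by (rule eq_if_minus_zero) (use x t(2) ta z in simp_all)
  then show thesis using that[OF t(1) ta t(2)] by blast
qed

lemma roofs_iff: "(s, f) \<in> roofs T S \<longleftrightarrow> s \<in> D \<and> s \<in> Arr T \<and> f \<in> Arr T \<and> Dom T s = Dom T f"
  by (auto simp: roofs_def dest: denoms_arr)

text \<open>
  Unlike in the defining relation of fractions, both legs of the comparison are denominators themselves.  The
  two-out-of-three property makes this equivalent and keeps all further refinements within the denominators.
\<close>

definition roof_eq where
  "roof_eq s f t g \<longleftrightarrow> Cod T t = Cod T s \<and> Cod T g = Cod T f \<and>
     (\<exists>p q. p \<in> D \<and> q \<in> D \<and> p \<in> Arr T \<and> q \<in> Arr T \<and> Cod T p = Dom T s \<and> Cod T q = Dom T t \<and>
        s \<bullet> p = t \<bullet> q \<and> f \<bullet> p = g \<bullet> q)"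

lemma roof_class_iff:
  assumes "(s, f) \<in> roofs T S"
  shows "(t, g) \<in> roof_class T S s f \<longleftrightarrow> (t, g) \<in> roofs T S \<and> roof_eq s f t g"
proof
  assume "(t, g) \<in> roof_class T S s f"
  then obtain p q where tg: "(t, g) \<in> roofs T S" "Cod T t = Cod T s" "Cod T g = Cod T f"
    and pq: "p \<in> Arr T" "q \<in> Arr T" "Cod T p = Dom T s" "Cod T q = Dom T t" "s \<bullet> p = t \<bullet> q" "f \<bullet> p = g \<bullet> q"
     "s \<bullet> p \<in> D"
    unfolding roof_class_def homs_iff Bex_def mem_Collect_eq prod.case by blast
  have "p \<in> D" using assms pq by (intro denoms_cancel[of p s]) (simp_all add: roofs_iff)
  moreover have "q \<in> D" using tg pq by (intro denoms_cancel[of q t]) (simp_all add: roofs_iff)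
  ultimately show "(t, g) \<in> roofs T S \<and> roof_eq s f t g" unfolding roof_eq_def using tg pq by blast
next
  assume a: "(t, g) \<in> roofs T S \<and> roof_eq s f t g"
  then obtain p q where tg: "(t, g) \<in> roofs T S" "Cod T t = Cod T s" "Cod T g = Cod T f"
    and pq: "p \<in> D" "p \<in> Arr T" "q \<in> Arr T" "Cod T p = Dom T s" "Cod T q = Dom T t" "s \<bullet> p = t \<bullet> q" "f \<bullet> p = g \<bullet> q"
    unfolding roof_eq_def by blast
  have "s \<bullet> p \<in> D" using assms pq by (intro denoms_comp) (simp_all add: roofs_iff)
  moreover have "Dom T p = Dom T q"
  proof -
    have "Dom T (s \<bullet> p) = Dom T p" "Dom T (t \<bullet> q) = Dom T q" using assms pq(1-5) tg by (simp_all add: roofs_iff)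
    then show ?thesis using pq(6) by simp
  qed
  ultimately have "\<exists>W. \<exists>p \<in> homs T W (Dom T s). \<exists>q \<in> homs T W (Dom T t).
           s \<bullet> p = t \<bullet> q \<and> s \<bullet> p \<in> denoms T S \<and> f \<bullet> p = g \<bullet> q"
    using pq by (intro exI[of _ "Dom T p"] bexI[of _ p] bexI[of _ q]) (simp_all add: homs_iff)
  then show "(t, g) \<in> roof_class T S s f" using tg unfolding roof_class_def mem_Collect_eq prod.case by blast
qed

lemma roof_eq_sym: "roof_eq s f t g \<Longrightarrow> roof_eq t g s f"
  unfolding roof_eq_def by metis

lemma roof_eq_refl: "(s, f) \<in> roofs T S \<Longrightarrow> roof_eq s f s f"
  unfolding roof_eq_def roofs_iff
  by (intro conjI refl exI[of _ "Ident T (Dom T s)"]) (simp_all add: denoms_ident)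

lemma roof_eq_trans:
  assumes r: "(s, f) \<in> roofs T S" "(t, g) \<in> roofs T S" "(r, h) \<in> roofs T S"
    and 1: "roof_eq s f t g" and 2: "roof_eq t g r h"
  shows "roof_eq s f r h"
proof -
  obtain p q where pq: "p \<in> D" "q \<in> D" "p \<in> Arr T" "q \<in> Arr T" "Cod T p = Dom T s" "Cod T q = Dom T t"
    and e: "s \<bullet> p = t \<bullet> q" "f \<bullet> p = g \<bullet> q" using 1 unfolding roof_eq_def by blast
  obtain p' q' where pq': "p' \<in> D" "q' \<in> D" "p' \<in> Arr T" "q' \<in> Arr T" "Cod T p' = Dom T t" "Cod T q' = Dom T r"
    and e': "t \<bullet> p' = r \<bullet> q'" "g \<bullet> p' = h \<bullet> q'" using 2 unfolding roof_eq_def by blast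
  obtain a b where ab: "a \<in> D" "a \<in> Arr T" "b \<in> Arr T" "Cod T a = Dom T q" "Dom T b = Dom T a" "Cod T b = Dom T p'"
    and e'': "q \<bullet> a = p' \<bullet> b"
    using Ore[OF pq'(1) pq(4)] pq(6) pq'(5) by metis
  have b: "b \<in> D" by (rule denoms_cancel[of b p']) (use ab pq pq' denoms_comp[of a q] in \<open>simp_all flip: e''\<close>)
  note rr = r[unfolded roofs_iff]
  have d: "Dom T p = Dom T q" "Dom T p' = Dom T q'"
    using arg_cong[OF e(1), of "Dom T"] arg_cong[OF e'(1), of "Dom T"] pq pq' rr by simp_all
  note all = rr pq pq' ab b d
  have "s \<bullet> (p \<bullet> a) = t \<bullet> (q \<bullet> a)" using all by (simp add: comp_reassoc[OF e(1)] comp_assoc)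
  also have "\<dots> = r \<bullet> (q' \<bullet> b)" unfolding e'' using all by (simp add: comp_reassoc[OF e'(1)] comp_assoc)
  finally have 3: "s \<bullet> (p \<bullet> a) = r \<bullet> (q' \<bullet> b)" .
  have "f \<bullet> (p \<bullet> a) = g \<bullet> (q \<bullet> a)" using all by (simp add: comp_reassoc[OF e(2)] comp_assoc)
  also have "\<dots> = h \<bullet> (q' \<bullet> b)" unfolding e'' using all by (simp add: comp_reassoc[OF e'(2)] comp_assoc)
  finally have 4: "f \<bullet> (p \<bullet> a) = h \<bullet> (q' \<bullet> b)" .
  show ?thesis unfolding roof_eq_def
    by (intro conjI exI[of _ "p \<bullet> a"] exI[of _ "q' \<bullet> b"] 3 4)
      (use all 1 2 in \<open>simp_all add: denoms_comp roof_eq_def\<close>)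
qed

abbreviation "fr s f \<equiv> fraction T S s f"

lemma roof_class_eq_iff:
  assumes "(s, f) \<in> roofs T S" "(t, g) \<in> roofs T S"
  shows "roof_class T S s f = roof_class T S t g \<longleftrightarrow> roof_eq s f t g"
proof
  assume "roof_class T S s f = roof_class T S t g"
  then have "(t, g) \<in> roof_class T S s f" using roof_class_iff[OF assms(2)] roof_eq_refl assms(2) by simp
  then show "roof_eq s f t g" using roof_class_iff[OF assms(1)] by simp
next
  assume e: "roof_eq s f t g"
  have "(r, h) \<in> roof_class T S s f \<longleftrightarrow> (r, h) \<in> roof_class T S t g" for r h
    using roof_class_iff[OF assms(1)] roof_class_iff[OF assms(2)] e
      roof_eq_trans[OF assms, of r h] roof_eq_trans[OF assms(2,1), of r h] roof_eq_sym[OF e] by blast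
  then show "roof_class T S s f = roof_class T S t g" by auto
qed

lemma fr_eq_iff:
  assumes "(s, f) \<in> roofs T S" "(t, g) \<in> roofs T S"
  shows "fr s f = fr t g \<longleftrightarrow> roof_eq s f t g"
  unfolding fraction_def using roof_class_eq_iff[OF assms] by (auto simp: roof_eq_def)

lemma fr_reduce:
  assumes "(s, f) \<in> roofs T S" "p \<in> D" "Cod T p = Dom T s"
  shows "(s \<bullet> p, f \<bullet> p) \<in> roofs T S" "fr (s \<bullet> p) (f \<bullet> p) = fr s f"
proof -
  have pa: "p \<in> Arr T" by (rule denoms_arr[OF assms(2)])
  show r: "(s \<bullet> p, f \<bullet> p) \<in> roofs T S" using assms pa by (simp add: roofs_iff denoms_comp)
  have "roof_eq (s \<bullet> p) (f \<bullet> p) s f"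
    unfolding roof_eq_def using assms pa
    by (intro conjI exI[of _ "Ident T (Dom T p)"] exI[of _ p]) (simp_all add: roofs_iff denoms_ident)
  then show "fr (s \<bullet> p) (f \<bullet> p) = fr s f" by (simp add: fr_eq_iff[OF r assms(1)])
qed

text \<open>
  Two completions of the same pair of roofs are compared by the Ore condition, up to an arrow killed by the denominator
  \<open>t\<close>.
\<close>

lemma completions_agree:
  assumes r: "(s, f) \<in> roofs T S" "(t, g) \<in> roofs T S" "Cod T f = Cod T t"
    and 1: "a \<in> D" "x \<in> Arr T" "Cod T a = Dom T s" "Cod T x = Dom T t" "Dom T x = Dom T a" "f \<bullet> a = t \<bullet> x"
    and 2: "b \<in> D" "y \<in> Arr T" "Cod T b = Dom T s" "Cod T y = Dom T t" "Dom T y = Dom T b" "f \<bullet> b = t \<bullet> y"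
  shows "roof_eq (s \<bullet> a) (g \<bullet> x) (s \<bullet> b) (g \<bullet> y)"
proof -
  note rr = r[unfolded roofs_iff] note ar = denoms_arr[OF 1(1)] denoms_arr[OF 2(1)]
  obtain c d where cd: "c \<in> D" "c \<in> Arr T" "d \<in> Arr T" "Cod T c = Dom T a" "Dom T d = Dom T c" "Cod T d = Dom T b"
    and e: "a \<bullet> c = b \<bullet> d"
    using Ore[OF 2(1) ar(1)] 1(3) 2(3) by metis
  have d: "d \<in> D" by (rule denoms_cancel[of d b]) (use cd ar 1(1) 2(1) denoms_comp[of c a] in \<open>simp_all flip: e\<close>)
  have "t \<bullet> (x \<bullet> c) = f \<bullet> (a \<bullet> c)" using rr ar 1 2 cd by (simp add: comp_reassoc[OF 1(6)] comp_assoc)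
  also have "\<dots> = t \<bullet> (y \<bullet> d)" unfolding e using rr ar 1 2 cd by (simp add: comp_reassoc[OF 2(6)] comp_assoc)
  finally have "t \<bullet> (x \<bullet> c) = t \<bullet> (y \<bullet> d)" .
  then obtain k where k: "k \<in> D" "k \<in> Arr T" "Cod T k = Dom T c" and ek: "x \<bullet> c \<bullet> k = y \<bullet> d \<bullet> k"
    using denoms_equalizes[of t "x \<bullet> c" "y \<bullet> d" thesis] rr ar 1(1-5) 2(1-5) cd by simp
  note all = rr ar 1(1-5) 2(1-5) cd d k
  have 3: "s \<bullet> a \<bullet> (c \<bullet> k) = s \<bullet> b \<bullet> (d \<bullet> k)" using all by (simp add: comp_assoc comp_reassoc[OF e])
  have 4: "g \<bullet> x \<bullet> (c \<bullet> k) = g \<bullet> y \<bullet> (d \<bullet> k)"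
  proof -
    have "g \<bullet> x \<bullet> (c \<bullet> k) = g \<bullet> (x \<bullet> c \<bullet> k)" using all by (simp add: comp_assoc)
    also have "\<dots> = g \<bullet> y \<bullet> (d \<bullet> k)" unfolding ek using all by (simp add: comp_assoc)
    finally show ?thesis .
  qed
  show ?thesis unfolding roof_eq_def
    by (intro conjI exI[of _ "c \<bullet> k"] exI[of _ "d \<bullet> k"] 3 4) (use all in \<open>simp_all add: denoms_comp\<close>)
qed

text \<open>
  Refining both roofs along their comparisons turns a single completion of the refinements into a completion for either
  pair of representatives.
\<close>

lemma composite_independent:
  assumes r: "(s, f) \<in> roofs T S" "(t, g) \<in> roofs T S" "(s', f') \<in> roofs T S" "(t', g') \<in> roofs T S"
    and c: "Cod T f = Cod T t"
    and e: "roof_eq s f s' f'" "roof_eq t g t' g'"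
    and 1: "a \<in> D" "x \<in> Arr T" "Cod T a = Dom T s" "Cod T x = Dom T t" "Dom T x = Dom T a" "f \<bullet> a = t \<bullet> x"
    and 2: "b \<in> D" "y \<in> Arr T" "Cod T b = Dom T s'" "Cod T y = Dom T t'" "Dom T y = Dom T b" "f' \<bullet> b = t' \<bullet> y"
  shows "roof_eq (s \<bullet> a) (g \<bullet> x) (s' \<bullet> b) (g' \<bullet> y)"
proof -
  note rr = r[unfolded roofs_iff] note ar = denoms_arr[OF 1(1)] denoms_arr[OF 2(1)]
  obtain p q where pq: "p \<in> D" "q \<in> D" "p \<in> Arr T" "q \<in> Arr T" "Cod T p = Dom T s" "Cod T q = Dom T s'"
    and ep: "s \<bullet> p = s' \<bullet> q" "f \<bullet> p = f' \<bullet> q" and cf: "Cod T s' = Cod T s" "Cod T f' = Cod T f"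
    using e(1) unfolding roof_eq_def by blast
  obtain m n where mn: "m \<in> D" "n \<in> D" "m \<in> Arr T" "n \<in> Arr T" "Cod T m = Dom T t" "Cod T n = Dom T t'"
    and en: "t \<bullet> m = t' \<bullet> n" "g \<bullet> m = g' \<bullet> n" and cg: "Cod T t' = Cod T t" "Cod T g' = Cod T g"
    using e(2) unfolding roof_eq_def by blast
  have d: "Dom T p = Dom T q" "Dom T m = Dom T n"
    using arg_cong[OF ep(1), of "Dom T"] arg_cong[OF en(1), of "Dom T"] pq mn rr by simp_all
  have tm: "t \<bullet> m \<in> D" using rr mn by (simp add: denoms_comp)
  obtain h z where hz: "h \<in> D" "h \<in> Arr T" "z \<in> Arr T" "Cod T h = Dom T p" "Dom T z = Dom T h" "Cod T z = Dom T m"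
    and eh: "f \<bullet> p \<bullet> h = t \<bullet> m \<bullet> z"
    using Ore[OF tm, of "f \<bullet> p" thesis] rr pq mn c by simp
  note all = rr ar 1(1-5) 2(1-5) pq mn c cf cg d hz
  have 3: "f \<bullet> (p \<bullet> h) = t \<bullet> (m \<bullet> z)" using eh all by (simp add: comp_assoc)
  have 4: "f' \<bullet> (q \<bullet> h) = t' \<bullet> (n \<bullet> z)"
    using eh[unfolded ep en] all by (simp add: comp_assoc)
  have "roof_eq (s \<bullet> a) (g \<bullet> x) (s \<bullet> (p \<bullet> h)) (g \<bullet> (m \<bullet> z))"
    by (rule completions_agree[OF r(1,2) c 1 _ _ _ _ _ 3]) (use all in \<open>simp_all add: denoms_comp\<close>)
  moreover have "s \<bullet> (p \<bullet> h) = s' \<bullet> (q \<bullet> h)" using all by (simp add: comp_reassoc[OF ep(1)] comp_assoc)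
  moreover have "g \<bullet> (m \<bullet> z) = g' \<bullet> (n \<bullet> z)" using all by (simp add: comp_reassoc[OF en(2)] comp_assoc)
  moreover have "roof_eq (s' \<bullet> (q \<bullet> h)) (g' \<bullet> (n \<bullet> z)) (s' \<bullet> b) (g' \<bullet> y)"
    by (rule completions_agree[OF r(3,4) _ _ _ _ _ _ 4 2]) (use all in \<open>simp_all add: denoms_comp\<close>)
  ultimately show ?thesis
    by (intro roof_eq_trans[of "s \<bullet> a" "g \<bullet> x" "s' \<bullet> (q \<bullet> h)" "g' \<bullet> (n \<bullet> z)" "s' \<bullet> b" "g' \<bullet> y"])
      (use all in \<open>simp_all add: roofs_iff denoms_comp\<close>)
qed

section \<open>The Verdier quotient as a linear category\<close>

abbreviation "V \<equiv> verdier_quotient T S"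

lemma V_obj [simp]: "Obj V = Obj T" and V_sh_obj [simp]: "ShObj V = ShObj T"
  by (simp_all add: verdier_quotient_def verdier_category_def)

lemma V_arr_iff: "a \<in> Arr V \<longleftrightarrow> (\<exists>s f. (s, f) \<in> roofs T S \<and> a = fr s f)"
  by (auto simp: verdier_quotient_def verdier_category_def)

lemma V_arr [simp]: "(s, f) \<in> roofs T S \<Longrightarrow> fr s f \<in> Arr V"
  by (auto simp: V_arr_iff)

lemma V_dom [simp]: "Dom V (fr s f) = Cod T s" and V_cod [simp]: "Cod V (fr s f) = Cod T f"
  by (simp_all add: verdier_quotient_def verdier_category_def fraction_def)

lemma V_ident: "Ident V X = fr (Ident T X) (Ident T X)"
  and V_zero: "Zero V X Y = fr (Ident T X) (Zero T X Y)"
  by (simp_all add: verdier_quotient_def verdier_category_def)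

lemma V_comp:
  assumes r: "(s, f) \<in> roofs T S" "(t, g) \<in> roofs T S" "Cod T f = Cod T t"
    and 1: "a \<in> D" "x \<in> Arr T" "Cod T a = Dom T s" "Cod T x = Dom T t" "Dom T x = Dom T a" "f \<bullet> a = t \<bullet> x"
  shows "fr t g \<cdot>\<^bsub>V\<^esub> fr s f = fr (s \<bullet> a) (g \<bullet> x)" "(s \<bullet> a, g \<bullet> x) \<in> roofs T S"
proof -
  have aa: "a \<in> Arr T" by (rule denoms_arr[OF 1(1)])
  note rr = r[unfolded roofs_iff]
  show r': "(s \<bullet> a, g \<bullet> x) \<in> roofs T S" using rr aa 1(1-5) by (simp add: roofs_iff denoms_comp)
  have "\<Union>{roof_class T S (s' \<bullet> t') (g' \<bullet> f') |s' f1 t1 g' t' f'.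
              (s', f1) \<in> roof_class T S s f \<and> (t1, g') \<in> roof_class T S t g \<and> t' \<in> D \<and> f' \<in> Arr T \<and>
              Dom T f' = Dom T t' \<and> Cod T t' = Dom T s' \<and> Cod T f' = Dom T t1 \<and>
              f1 \<bullet> t' = t1 \<bullet> f'} = roof_class T S (s \<bullet> a) (g \<bullet> x)" (is "\<Union>?A = ?B")
  proof (rule Union_constant)
    have "?B \<in> ?A" using roof_class_iff[OF r(1)] roof_class_iff[OF r(2)] roof_eq_refl[OF r(1)] roof_eq_refl[OF r(2)] r 1 by blast
    then show "?A \<noteq> {}" by blast
  next
    fix C assume "C \<in> ?A"
    then obtain s' f1 t1 g' t' f' where C: "C = roof_class T S (s' \<bullet> t') (g' \<bullet> f')"
      and h: "(s', f1) \<in> roofs T S" "roof_eq s f s' f1" "(t1, g') \<in> roofs T S" "roof_eq t g t1 g'"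
       "t' \<in> D" "f' \<in> Arr T" "Dom T f' = Dom T t'" "Cod T t' = Dom T s'" "Cod T f' = Dom T t1" "f1 \<bullet> t' = t1 \<bullet> f'"
      unfolding roof_class_iff[OF r(1)] roof_class_iff[OF r(2)] by blast
    have e: "roof_eq (s \<bullet> a) (g \<bullet> x) (s' \<bullet> t') (g' \<bullet> f')"
      by (rule composite_independent[OF r(1,2) h(1,3) r(3) h(2,4) 1 h(5,6,8,9,7,10)])
    have "(s' \<bullet> t', g' \<bullet> f') \<in> roofs T S"
      using h denoms_arr[OF h(5)] by (simp add: roofs_iff denoms_comp)
    then show "C = ?B" unfolding C using roof_class_eq_iff[OF _ r'] roof_eq_sym[OF e] by simp
  qed
  then show "fr t g \<cdot>\<^bsub>V\<^esub> fr s f = fr (s \<bullet> a) (g \<bullet> x)"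
    using rr aa 1(1-5) by (simp add: verdier_quotient_def verdier_category_def fraction_def)
qed

lemma V_plus:
  assumes r: "(s, f) \<in> roofs T S" "(s, g) \<in> roofs T S" "Cod T f = Cod T g"
  shows "Plus V (fr s f) (fr s g) = fr s (Plus T f g)" "(s, Plus T f g) \<in> roofs T S"
proof -
  note rr = r[unfolded roofs_iff]
  show r': "(s, Plus T f g) \<in> roofs T S" using rr by (simp add: roofs_iff)
  have "\<Union>{roof_class T S s' (Plus T f' g') |s' f' g'. (s', f') \<in> roof_class T S s f \<and> (s', g') \<in> roof_class T S s g}
    = roof_class T S s (Plus T f g)" (is "\<Union>?A = ?B")
  proof (rule Union_constant)
    have "?B \<in> ?A" using roof_class_iff[OF r(1)] roof_class_iff[OF r(2)] roof_eq_refl[OF r(1)] roof_eq_refl[OF r(2)] r by blast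
    then show "?A \<noteq> {}" by blast
  next
    fix C assume "C \<in> ?A"
    then obtain s' f' g' where C: "C = roof_class T S s' (Plus T f' g')"
      and h: "(s', f') \<in> roofs T S" "roof_eq s f s' f'" "(s', g') \<in> roofs T S" "roof_eq s g s' g'"
      unfolding roof_class_iff[OF r(1)] roof_class_iff[OF r(2)] by blast
    obtain q p where pq: "p \<in> D" "q \<in> D" "p \<in> Arr T" "q \<in> Arr T" "Cod T p = Dom T s'" "Cod T q = Dom T s"
      and e: "s \<bullet> q = s' \<bullet> p" "f \<bullet> q = f' \<bullet> p" and cs: "Cod T s' = Cod T s" "Cod T f' = Cod T f"
      using h(2) unfolding roof_eq_def by blast
    obtain n m where mn: "m \<in> D" "n \<in> D" "m \<in> Arr T" "n \<in> Arr T" "Cod T m = Dom T s'" "Cod T n = Dom T s"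
      and e': "s \<bullet> n = s' \<bullet> m" "g \<bullet> n = g' \<bullet> m" and cg: "Cod T g' = Cod T g"
      using h(4) unfolding roof_eq_def by blast
    note hh = h(1,3)[unfolded roofs_iff]
    obtain a b where ab: "a \<in> D" "a \<in> Arr T" "b \<in> Arr T" "Cod T a = Dom T p" "Dom T b = Dom T a" "Cod T b = Dom T m"
      and e'': "p \<bullet> a = m \<bullet> b"
      using Ore[OF mn(1) pq(3)] pq(5) mn(5) by metis
    have d: "Dom T p = Dom T q" "Dom T m = Dom T n"
      using arg_cong[OF e(1), of "Dom T"] arg_cong[OF e'(1), of "Dom T"] pq mn rr hh by simp_all
    note all = rr hh pq mn cs cg d ab
    have "s \<bullet> (q \<bullet> a) = s' \<bullet> (p \<bullet> a)" using all by (simp add: comp_reassoc[OF e(1)] comp_assoc)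
    also have "\<dots> = s \<bullet> (n \<bullet> b)" unfolding e'' using all by (simp add: comp_reassoc[OF e'(1)] comp_assoc)
    finally have "s \<bullet> (q \<bullet> a) = s \<bullet> (n \<bullet> b)" .
    then obtain k where k: "k \<in> D" "k \<in> Arr T" "Cod T k = Dom T a" and ek: "q \<bullet> a \<bullet> k = n \<bullet> b \<bullet> k"
      using denoms_equalizes[of s "q \<bullet> a" "n \<bullet> b" thesis] all by simp
    define P where "P = p \<bullet> (a \<bullet> k)"
    define Q where "Q = q \<bullet> (a \<bullet> k)"
    have PQ: "P \<in> D" "Q \<in> D" "P \<in> Arr T" "Q \<in> Arr T" "Cod T P = Dom T s'" "Cod T Q = Dom T s" "Dom T P = Dom T Q"
      unfolding P_def Q_def using all k by (simp_all add: denoms_comp)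
    have 1: "s \<bullet> Q = s' \<bullet> P" "f \<bullet> Q = f' \<bullet> P" unfolding P_def Q_def
      using all k by (simp_all add: comp_reassoc[OF e(1)] comp_reassoc[OF e(2)] comp_assoc)
    have Q': "Q = n \<bullet> (b \<bullet> k)" unfolding Q_def using ek all k by (simp add: comp_assoc)
    have P': "P = m \<bullet> (b \<bullet> k)" unfolding P_def using all k by (simp add: comp_reassoc[OF e''] comp_assoc)
    have 2: "g \<bullet> Q = g' \<bullet> P" unfolding Q' P' using all k by (simp add: comp_reassoc[OF e'(2)] comp_assoc)
    have "roof_eq s (Plus T f g) s' (Plus T f' g')" unfolding roof_eq_def
      by (intro conjI exI[of _ P] exI[of _ Q]) (use all PQ 1 2 r(3) in \<open>simp_all add: comp_plus_left\<close>)
    moreover have "(s', Plus T f' g') \<in> roofs T S" using hh cs cg r(3) by (simp add: roofs_iff)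
    ultimately show "C = ?B" unfolding C using roof_class_eq_iff[OF r'] by metis
  qed
  then show "Plus V (fr s f) (fr s g) = fr s (Plus T f g)"
    using rr r(3) by (simp add: verdier_quotient_def verdier_category_def fraction_def)
qed

lemma V_scale:
  assumes r: "(s, f) \<in> roofs T S" and c: "c \<in> carrier R"
  shows "Scale V c (fr s f) = fr s (Scale T c f)" "(s, Scale T c f) \<in> roofs T S"
proof -
  note rr = r[unfolded roofs_iff]
  show r': "(s, Scale T c f) \<in> roofs T S" using rr c by (simp add: roofs_iff)
  have "\<Union>{roof_class T S s' (Scale T c f') |s' f'. (s', f') \<in> roof_class T S s f}
    = roof_class T S s (Scale T c f)" (is "\<Union>?A = ?B")
  proof (rule Union_constant)
    have "?B \<in> ?A" using roof_class_iff[OF r] roof_eq_refl[OF r] r by blast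
    then show "?A \<noteq> {}" by blast
  next
    fix C assume "C \<in> ?A"
    then obtain s' f' where C: "C = roof_class T S s' (Scale T c f')"
      and h: "(s', f') \<in> roofs T S" "roof_eq s f s' f'" unfolding roof_class_iff[OF r] by blast
    note hh = h(1)[unfolded roofs_iff]
    obtain p q where pq: "p \<in> D" "q \<in> D" "p \<in> Arr T" "q \<in> Arr T" "Cod T p = Dom T s" "Cod T q = Dom T s'"
      and e: "s \<bullet> p = s' \<bullet> q" "f \<bullet> p = f' \<bullet> q" and cs: "Cod T s' = Cod T s" "Cod T f' = Cod T f"
      using h(2) unfolding roof_eq_def by blast
    have "roof_eq s (Scale T c f) s' (Scale T c f')" unfolding roof_eq_def
      by (intro conjI exI[of _ p] exI[of _ q]) (use rr hh pq e cs c in simp_all)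
    moreover have "(s', Scale T c f') \<in> roofs T S" using hh c by (simp add: roofs_iff)
    ultimately show "C = ?B" unfolding C using roof_class_eq_iff[OF r'] by metis
  qed
  then show "Scale V c (fr s f) = fr s (Scale T c f)"
    using rr c by (simp add: verdier_quotient_def verdier_category_def fraction_def)
qed

lemma V_sh:
  assumes r: "(s, f) \<in> roofs T S"
  shows "ShArr V (fr s f) = fr (ShArr T s) (ShArr T f)" "(ShArr T s, ShArr T f) \<in> roofs T S"
proof -
  note rr = r[unfolded roofs_iff]
  show r': "(ShArr T s, ShArr T f) \<in> roofs T S" using rr by (simp add: roofs_iff denoms_sh)
  have "\<Union>{roof_class T S (ShArr T s') (ShArr T f') |s' f'. (s', f') \<in> roof_class T S s f}
    = roof_class T S (ShArr T s) (ShArr T f)" (is "\<Union>?A = ?B")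
  proof (rule Union_constant)
    have "?B \<in> ?A" using roof_class_iff[OF r] roof_eq_refl[OF r] r by blast
    then show "?A \<noteq> {}" by blast
  next
    fix C assume "C \<in> ?A"
    then obtain s' f' where C: "C = roof_class T S (ShArr T s') (ShArr T f')"
      and h: "(s', f') \<in> roofs T S" "roof_eq s f s' f'" unfolding roof_class_iff[OF r] by blast
    note hh = h(1)[unfolded roofs_iff]
    obtain p q where pq: "p \<in> D" "q \<in> D" "p \<in> Arr T" "q \<in> Arr T" "Cod T p = Dom T s" "Cod T q = Dom T s'"
      and e: "s \<bullet> p = s' \<bullet> q" "f \<bullet> p = f' \<bullet> q" and cs: "Cod T s' = Cod T s" "Cod T f' = Cod T f"
      using h(2) unfolding roof_eq_def by blast
    have "ShArr T s \<bullet> ShArr T p = ShArr T s' \<bullet> ShArr T q" "ShArr T f \<bullet> ShArr T p = ShArr T f' \<bullet> ShArr T q"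
      using rr hh pq e by (simp_all flip: sh_comp)
    then have "roof_eq (ShArr T s) (ShArr T f) (ShArr T s') (ShArr T f')" unfolding roof_eq_def
      by (intro conjI exI[of _ "ShArr T p"] exI[of _ "ShArr T q"]) (use rr hh pq cs in \<open>simp_all add: denoms_sh\<close>)
    moreover have "(ShArr T s', ShArr T f') \<in> roofs T S" using hh by (simp add: roofs_iff denoms_sh)
    ultimately show "C = ?B" unfolding C using roof_class_eq_iff[OF r'] by metis
  qed
  then show "ShArr V (fr s f) = fr (ShArr T s) (ShArr T f)"
    using rr by (simp add: verdier_quotient_def verdier_category_def fraction_def)
qed

lemma V_arrE:
  assumes "a \<in> Arr V"
  obtains s f where "(s, f) \<in> roofs T S" "a = fr s f"
  using assms by (auto simp: V_arr_iff)

lemma roof_fixed_denominator: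
  assumes "(s, f) \<in> roofs T S" "(t, g) \<in> roofs T S" "Cod T s = Cod T t"
  obtains p q where "p \<in> D" "q \<in> D" "p \<in> Arr T" "q \<in> Arr T" "Cod T p = Dom T s" "Cod T q = Dom T t" "Dom T p = Dom T q" "s \<bullet> p = t \<bullet> q"
proof -
  note r = assms(1,2)[unfolded roofs_iff]
  obtain p q where pq: "p \<in> D" "p \<in> Arr T" "q \<in> Arr T" "Cod T p = Dom T s" "Dom T q = Dom T p" "Cod T q = Dom T t"
    and e: "s \<bullet> p = t \<bullet> q" using Ore[of t s] r assms(3) by metis
  have "q \<in> D" by (rule denoms_cancel[of q t]) (use pq r denoms_comp[of p s] in \<open>simp_all flip: e\<close>)
  then show thesis using that[of p q] pq e by metis
qed

text \<open>
  Identities among parallel fractions reduce to identities in \<open>T\<close> by bringing the fractions to a common denominator.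
\<close>

lemma common_denominator:
  assumes "a \<in> Arr V" "b \<in> Arr V" "Dom V a = Dom V b"
  obtains s f g where "(s, f) \<in> roofs T S" "(s, g) \<in> roofs T S" "a = fr s f" "b = fr s g"
proof -
  obtain s f where a: "(s, f) \<in> roofs T S" "a = fr s f" using assms(1) by (rule V_arrE)
  obtain t g where b: "(t, g) \<in> roofs T S" "b = fr t g" using assms(2) by (rule V_arrE)
  have "Cod T s = Cod T t" using assms(3) a b by simp
  then obtain p q where pq: "p \<in> D" "q \<in> D" "Cod T p = Dom T s" "Cod T q = Dom T t" and e: "s \<bullet> p = t \<bullet> q"
    using roof_fixed_denominator[OF a(1) b(1)] by metis
  show thesis using that[of "s \<bullet> p" "f \<bullet> p" "g \<bullet> q"] fr_reduce[OF a(1) pq(1,3)] fr_reduce[OF b(1) pq(2,4)] a(2) b(2) e by simp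
qed

lemma common_denominator3:
  assumes "a \<in> Arr V" "b \<in> Arr V" "c \<in> Arr V" "Dom V a = Dom V b" "Dom V b = Dom V c"
  obtains s f g h where "(s, f) \<in> roofs T S" "(s, g) \<in> roofs T S" "(s, h) \<in> roofs T S" "a = fr s f" "b = fr s g" "c = fr s h"
proof -
  obtain s f g where a: "(s, f) \<in> roofs T S" "(s, g) \<in> roofs T S" "a = fr s f" "b = fr s g"
    using assms(1,2,4) by (rule common_denominator)
  obtain t h where b: "(t, h) \<in> roofs T S" "c = fr t h" using assms(3) by (rule V_arrE)
  have "Cod T s = Cod T t" using assms(4,5) a b by simp
  then obtain p q where pq: "p \<in> D" "q \<in> D" "Cod T p = Dom T s" "Cod T q = Dom T t" and e: "s \<bullet> p = t \<bullet> q"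
    using roof_fixed_denominator[OF a(1) b(1)] by metis
  show thesis using that[of "s \<bullet> p" "f \<bullet> p" "g \<bullet> p" "h \<bullet> q"] fr_reduce[OF a(1) pq(1,3)] fr_reduce[OF a(2) pq(1,3)]
    fr_reduce[OF b(1) pq(2,4)] a(3,4) b(2) e by simp
qed

lemma completion:
  assumes "(s, f) \<in> roofs T S" "(t, g) \<in> roofs T S" "Cod T f = Cod T t"
  obtains a x where "a \<in> D" "a \<in> Arr T" "x \<in> Arr T" "Cod T a = Dom T s" "Cod T x = Dom T t" "Dom T x = Dom T a" "f \<bullet> a = t \<bullet> x"
  using Ore[of t f] assms[unfolded roofs_iff] by metis

lemma roof_ident [simp]: "f \<in> Arr T \<Longrightarrow> (Ident T (Dom T f), f) \<in> roofs T S"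
  by (simp add: roofs_iff denoms_ident)

lemma V_comp_ex:
  assumes "a \<in> Arr V" "b \<in> Arr V" "Dom V b = Cod V a"
  obtains s f t g x where "(s, f) \<in> roofs T S" "(t, g) \<in> roofs T S" "a = fr s f" "b = fr t g" "x \<in> Arr T"
    "Dom T x = Dom T s" "Cod T x = Dom T t" "f = t \<bullet> x" "b \<cdot>\<^bsub>V\<^esub> a = fr s (g \<bullet> x)" "(s, g \<bullet> x) \<in> roofs T S"
proof -
  obtain s f where a: "(s, f) \<in> roofs T S" "a = fr s f" using assms(1) by (rule V_arrE)
  obtain t g where b: "(t, g) \<in> roofs T S" "b = fr t g" using assms(2) by (rule V_arrE)
  have c: "Cod T f = Cod T t" using assms(3) a b by simp
  obtain p x where p: "p \<in> D" "p \<in> Arr T" "x \<in> Arr T" "Cod T p = Dom T s" "Cod T x = Dom T t" "Dom T x = Dom T p" "f \<bullet> p = t \<bullet> x"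
    using completion[OF a(1) b(1) c] by metis
  note v = V_comp[OF a(1) b(1) c p(1,3,4,5,6,7)]
  note r = a(1)[unfolded roofs_iff]
  show thesis
    by (rule that[of "s \<bullet> p" "f \<bullet> p" t g x]) (use fr_reduce[OF a(1) p(1,4)] a b p r v in simp_all)
qed

lemma V_comp_factored:
  assumes "(s, t \<bullet> x) \<in> roofs T S" "(t, g) \<in> roofs T S" "x \<in> Arr T" "Cod T x = Dom T t" "Dom T s = Dom T x"
  shows "fr t g \<cdot>\<^bsub>V\<^esub> fr s (t \<bullet> x) = fr s (g \<bullet> x)" "(s, g \<bullet> x) \<in> roofs T S"
proof -
  note rr = assms(1,2)[unfolded roofs_iff]
  have s: "s \<bullet> Ident T (Dom T s) = s" using rr by simp
  have "fr t g \<cdot>\<^bsub>V\<^esub> fr s (t \<bullet> x) = fr (s \<bullet> Ident T (Dom T s)) (g \<bullet> x) \<and> (s \<bullet> Ident T (Dom T s), g \<bullet> x) \<in> roofs T S"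
    by (intro conjI V_comp[OF assms(1,2)])
      (use assms(3-5) rr in \<open>simp_all add: denoms_ident\<close>)
  then show "fr t g \<cdot>\<^bsub>V\<^esub> fr s (t \<bullet> x) = fr s (g \<bullet> x)" "(s, g \<bullet> x) \<in> roofs T S" unfolding s by blast+
qed

lemma verdier_quotient_shift_linear: "shift_linear_category R V"
proof (unfold_locales)
  fix a assume a: "a \<in> Arr V"
  obtain s f where r: "(s, f) \<in> roofs T S" "a = fr s f" using a by (rule V_arrE)
  note rr = r(1)[unfolded roofs_iff]
  show "Dom V a \<in> Obj V" "Cod V a \<in> Obj V" unfolding r(2) using rr by simp_all
  have idl: "fr (Ident T (Cod T f)) (Ident T (Cod T f)) \<cdot>\<^bsub>V\<^esub> fr s (Ident T (Cod T f) \<bullet> f) = fr s (Ident T (Cod T f) \<bullet> f)"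
    by (rule V_comp_factored(1)) (use rr in \<open>simp_all add: roofs_iff denoms_ident\<close>)
  have idr: "fr s f \<cdot>\<^bsub>V\<^esub> fr (Ident T (Cod T s)) (Ident T (Cod T s)) = fr (Ident T (Cod T s) \<bullet> s) (f \<bullet> Ident T (Dom T s))"
    by (rule V_comp(1)) (use rr in \<open>simp_all add: roofs_iff denoms_ident\<close>)
  show "Ident V Y \<cdot>\<^bsub>V\<^esub> a = a" if "Cod V a = Y" for Y
  proof -
    have Y: "Y = Cod T f" using that r by simp
    show ?thesis unfolding r(2) V_ident Y using idl rr by simp
  qed
  show "a \<cdot>\<^bsub>V\<^esub> Ident V X = a" if "Dom V a = X" for X
  proof -
    have X: "X = Cod T s" using that r by simp
    show ?thesis unfolding r(2) V_ident X using idr rr by simp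
  qed
  show "Scale V \<zero> a = Zero V (Dom V a) (Cod V a)"
    using fr_reduce(2)[of "Ident T (Cod T s)" "Zero T (Cod T s) (Cod T f)" s] rr
    unfolding r(2) V_zero V_scale[OF r(1) zero_closed] by (simp add: roofs_iff denoms_ident)
  show "Scale V \<one> a = a" unfolding r(2) V_scale[OF r(1) one_closed] using rr by simp
  show "Scale V c a \<in> Arr V" "Dom V (Scale V c a) = Dom V a" "Cod V (Scale V c a) = Cod V a" if "c \<in> carrier R" for c
    unfolding r(2) V_scale[OF r(1) that] using rr that V_scale(2)[OF r(1) that] by simp_all
  show "Scale V (c \<otimes> d) a = Scale V c (Scale V d a)" if "c \<in> carrier R" "d \<in> carrier R" for c d
    unfolding r(2) V_scale[OF r(1) that(2)] V_scale[OF V_scale(2)[OF r(1) that(2)] that(1)]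
      V_scale[OF r(1) m_closed[OF that]] using rr that by (simp add: scale_mult)
  show "Scale V (c \<oplus> d) a = Plus V (Scale V c a) (Scale V d a)" if "c \<in> carrier R" "d \<in> carrier R" for c d
    unfolding r(2) V_scale[OF r(1) that(2)] V_scale[OF r(1) that(1)]
      V_scale[OF r(1) a_closed[OF that]] using rr that V_scale(2)[OF r(1) that(2)] V_scale(2)[OF r(1) that(1)]
      by (simp add: scale_add V_plus)
  show "ShArr V a \<in> Arr V" "Dom V (ShArr V a) = ShObj V (Dom V a)" "Cod V (ShArr V a) = ShObj V (Cod V a)"
    unfolding r(2) V_sh[OF r(1)] using rr V_sh(2)[OF r(1)] by simp_all
  show "ShArr V (Scale V c a) = Scale V c (ShArr V a)" if "c \<in> carrier R" for c
    unfolding r(2) V_sh[OF r(1)] V_scale[OF r(1) that] V_sh[OF V_scale(2)[OF r(1) that]]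
      V_scale[OF V_sh(2)[OF r(1)] that] using rr that by simp
  show "Plus V a (Zero V X Y) = a" if "Dom V a = X" "Cod V a = Y" for X Y
  proof -
    have XY: "X = Cod T s" "Y = Cod T f" using that r by simp_all
    have z: "Zero V X Y = fr s (Zero T (Dom T s) Y)" "(s, Zero T (Dom T s) Y) \<in> roofs T S"
      using fr_reduce[of "Ident T (Cod T s)" "Zero T (Cod T s) (Cod T f)" s] rr
      unfolding V_zero XY by (simp_all add: roofs_iff denoms_ident)
    show ?thesis unfolding z(1) r(2) using V_plus(1)[OF r(1) z(2)] rr XY by simp
  qed
next
  fix X assume X: "X \<in> Obj V"
  then show "Ident V X \<in> Arr V" "Dom V (Ident V X) = X" "Cod V (Ident V X) = X"
    unfolding V_ident by (simp_all add: roofs_iff denoms_ident)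
  show "ShObj V X \<in> Obj V" using X by simp
  show "ShArr V (Ident V X) = Ident V (ShObj V X)"
    unfolding V_ident using X by (subst V_sh) (simp_all add: roofs_iff denoms_ident)
  fix Y assume Y: "Y \<in> Obj V"
  show "Zero V X Y \<in> Arr V" "Dom V (Zero V X Y) = X" "Cod V (Zero V X Y) = Y"
    unfolding V_zero using X Y by (simp_all add: roofs_iff denoms_ident)
next
  fix a b assume ab: "a \<in> Arr V" "b \<in> Arr V" and c: "Dom V b = Cod V a"
  obtain s f t g x where h: "(s, f) \<in> roofs T S" "(t, g) \<in> roofs T S" "a = fr s f" "b = fr t g" "x \<in> Arr T"
    "Dom T x = Dom T s" "Cod T x = Dom T t" and f: "f = t \<bullet> x" and ba: "b \<cdot>\<^bsub>V\<^esub> a = fr s (g \<bullet> x)" "(s, g \<bullet> x) \<in> roofs T S"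
    using ab c by (rule V_comp_ex)
  note rr = h(1,2)[unfolded roofs_iff]
  show "b \<cdot>\<^bsub>V\<^esub> a \<in> Arr V" "Dom V (b \<cdot>\<^bsub>V\<^esub> a) = Dom V a" "Cod V (b \<cdot>\<^bsub>V\<^esub> a) = Cod V b"
    unfolding ba using ba h rr by simp_all
  show "Scale V r b \<cdot>\<^bsub>V\<^esub> a = Scale V r (b \<cdot>\<^bsub>V\<^esub> a)" if r: "r \<in> carrier R" for r
    unfolding ba V_scale[OF ba(2) r] using h(5-7) rr V_scale[OF h(2) r]
      V_comp_factored[OF h(1)[unfolded f] V_scale(2)[OF h(2) r] h(5,7)] r
    by (simp add: h(3,4) f)
  show "b \<cdot>\<^bsub>V\<^esub> Scale V r a = Scale V r (b \<cdot>\<^bsub>V\<^esub> a)" if r: "r \<in> carrier R" for r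
  proof -
    have e: "Scale T r (t \<bullet> x) = t \<bullet> Scale T r x" using r h(5-7) rr by simp
    show ?thesis
    unfolding ba V_scale[OF ba(2) r] unfolding h(3,4) f unfolding V_scale[OF h(1)[unfolded f] r] e
    using h(5-7) rr V_comp_factored[of s t "Scale T r x" g] V_scale(2)[OF h(1) r] r h(2)
    by (simp add: f)
  qed
  have e: "ShArr T (t \<bullet> x) = ShArr T t \<bullet> ShArr T x" "ShArr T (g \<bullet> x) = ShArr T g \<bullet> ShArr T x"
    using rr h(5-7) by (simp_all add: sh_comp)
  note sf = V_sh[OF h(1)[unfolded f], unfolded e] and sg = V_sh[OF h(2)]
  show "ShArr V (b \<cdot>\<^bsub>V\<^esub> a) = ShArr V b \<cdot>\<^bsub>V\<^esub> ShArr V a"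
    unfolding ba V_sh(1)[OF ba(2)] unfolding h(3,4) f unfolding sf(1) sg(1) e
    by (rule V_comp_factored(1)[symmetric, OF sf(2) sg(2)]) (use rr h(5-7) in simp_all)
next
  fix a b c assume abc: "a \<in> Arr V" "b \<in> Arr V" "c \<in> Arr V" "Dom V b = Cod V a" "Dom V c = Cod V b"
  obtain t g r k y where h: "(t, g) \<in> roofs T S" "(r, k) \<in> roofs T S" "b = fr t g" "c = fr r k" "y \<in> Arr T"
    "Dom T y = Dom T t" "Cod T y = Dom T r" and g: "g = r \<bullet> y" and cb: "c \<cdot>\<^bsub>V\<^esub> b = fr t (k \<bullet> y)" "(t, k \<bullet> y) \<in> roofs T S"
    using abc(2,3,5) by (rule V_comp_ex)
  obtain s f where a: "(s, f) \<in> roofs T S" "a = fr s f" using abc(1) by (rule V_arrE)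
  note rr = a(1)[unfolded roofs_iff] h(1,2)[unfolded roofs_iff]
  have cf: "Cod T f = Cod T t" using abc(4) a h by simp
  obtain p x where p: "p \<in> D" "p \<in> Arr T" "x \<in> Arr T" "Cod T p = Dom T s" "Cod T x = Dom T t" "Dom T x = Dom T p" "f \<bullet> p = t \<bullet> x"
    using completion[OF a(1) h(1) cf] by metis
  note ba = V_comp[OF a(1) h(1) cf p(1,3,4,5,6,7)]
  note cb_a = V_comp[OF a(1) cb(2) cf p(1,3,4,5,6,7)]
  have e: "g \<bullet> x = r \<bullet> (y \<bullet> x)" unfolding g using rr p h(5-7) by (simp add: comp_assoc)
  have "c \<cdot>\<^bsub>V\<^esub> (b \<cdot>\<^bsub>V\<^esub> a) = fr (s \<bullet> p) (k \<bullet> (y \<bullet> x))"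
    unfolding a(2) h(3) ba e unfolding h(4)
    by (rule V_comp_factored(1)[OF ba(2)[unfolded e] h(2)]) (use rr p h(5-7) in simp_all)
  then show "c \<cdot>\<^bsub>V\<^esub> b \<cdot>\<^bsub>V\<^esub> a = c \<cdot>\<^bsub>V\<^esub> (b \<cdot>\<^bsub>V\<^esub> a)"
    unfolding cb unfolding a(2) cb_a using rr p h(5-7) by (simp add: comp_assoc)
next
  fix a b assume ab: "a \<in> Arr V" "b \<in> Arr V" "Dom V a = Dom V b" "Cod V a = Cod V b"
  obtain s f g where h: "(s, f) \<in> roofs T S" "(s, g) \<in> roofs T S" "a = fr s f" "b = fr s g"
    using ab(1-3) by (rule common_denominator)
  note rr = h(1,2)[unfolded roofs_iff]
  have fg: "Cod T f = Cod T g" using ab(4) h by simp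
  note v = V_plus[OF h(1,2) fg] and v' = V_plus[OF h(2,1) fg[symmetric]]
  show "Plus V a b \<in> Arr V" "Dom V (Plus V a b) = Dom V a" "Cod V (Plus V a b) = Cod V a"
    unfolding h(3,4) v using v(2) rr fg by simp_all
  show "Plus V a b = Plus V b a"
    unfolding h(3,4) v v' using rr fg by (simp add: plus_comm)
next
  fix a b c assume abc: "a \<in> Arr V" "b \<in> Arr V" "c \<in> Arr V" "Dom V a = Dom V b" "Cod V a = Cod V b"
    "Dom V b = Dom V c" "Cod V b = Cod V c"
  obtain s f g k where h: "(s, f) \<in> roofs T S" "(s, g) \<in> roofs T S" "(s, k) \<in> roofs T S" "a = fr s f" "b = fr s g" "c = fr s k"
    using abc(1,2,3,4,6) by (rule common_denominator3)
  note rr = h(1-3)[unfolded roofs_iff]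
  have fg: "Cod T f = Cod T g" "Cod T g = Cod T k" using abc(5,7) h by simp_all
  show "Plus V (Plus V a b) c = Plus V a (Plus V b c)"
    unfolding h(4-6) using h(1-3) fg rr by (simp add: V_plus plus_assoc)
next
  fix a b c assume abc: "a \<in> Arr V" "b \<in> Arr V" "c \<in> Arr V" "Dom V a = Cod V c" "Dom V b = Cod V c" "Cod V a = Cod V b"
  have dab: "Dom V a = Dom V b" using abc by simp
  obtain t f g where h: "(t, f) \<in> roofs T S" "(t, g) \<in> roofs T S" "a = fr t f" "b = fr t g"
    using abc(1,2) dab by (rule common_denominator)
  obtain s k where c: "(s, k) \<in> roofs T S" "c = fr s k" using abc(3) by (rule V_arrE)
  note rr = h(1,2)[unfolded roofs_iff] c(1)[unfolded roofs_iff]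
  have fg: "Cod T f = Cod T g" "Cod T k = Cod T t" using abc h c by simp_all
  obtain p x where p: "p \<in> D" "p \<in> Arr T" "x \<in> Arr T" "Cod T p = Dom T s" "Cod T x = Dom T t" "Dom T x = Dom T p" "k \<bullet> p = t \<bullet> x"
    using completion[OF c(1) h(1) fg(2)] by metis
  note 1 = V_comp[OF c(1) h(1) fg(2) p(1,3,4,5,6,7)] and 2 = V_comp[OF c(1) h(2) fg(2) p(1,3,4,5,6,7)]
    and 3 = V_comp[OF c(1) V_plus(2)[OF h(1,2) fg(1)] fg(2) p(1,3,4,5,6,7)]
  show "Plus V a b \<cdot>\<^bsub>V\<^esub> c = Plus V (a \<cdot>\<^bsub>V\<^esub> c) (b \<cdot>\<^bsub>V\<^esub> c)"
    unfolding h(3,4) c(2) V_plus(1)[OF h(1,2) fg(1)] 1(1) 2(1) 3(1)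
    using V_plus[OF 1(2) 2(2)] fg rr p by (simp add: comp_plus_left)
next
  fix a b c assume abc: "a \<in> Arr V" "b \<in> Arr V" "c \<in> Arr V" "Dom V c = Cod V a" "Dom V c = Cod V b" "Dom V a = Dom V b"
  obtain s f g where h: "(s, f) \<in> roofs T S" "(s, g) \<in> roofs T S" "a = fr s f" "b = fr s g"
    using abc(1,2,6) by (rule common_denominator)
  obtain t k where c: "(t, k) \<in> roofs T S" "c = fr t k" using abc(3) by (rule V_arrE)
  note rr = h(1,2)[unfolded roofs_iff] c(1)[unfolded roofs_iff]
  have fg: "Cod T f = Cod T t" "Cod T g = Cod T t" using abc h c by simp_all
  obtain p x where p: "p \<in> D" "p \<in> Arr T" "x \<in> Arr T" "Cod T p = Dom T s" "Cod T x = Dom T t" "Dom T x = Dom T p" "f \<bullet> p = t \<bullet> x"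
    using completion[OF h(1) c(1) fg(1)] by metis
  obtain q y where q: "q \<in> D" "q \<in> Arr T" "y \<in> Arr T" "Cod T q = Dom T p" "Cod T y = Dom T t" "Dom T y = Dom T q" "g \<bullet> p \<bullet> q = t \<bullet> y"
    using Ore[of t "g \<bullet> p" thesis] rr fg p by simp
  have pq: "p \<bullet> q \<in> D" "Cod T (p \<bullet> q) = Dom T s" using p q by (simp_all add: denoms_comp)
  have e: "f \<bullet> (p \<bullet> q) = t \<bullet> (x \<bullet> q)" "g \<bullet> (p \<bullet> q) = t \<bullet> y"
    using rr fg p(1-6) q by (simp_all add: comp_reassoc[OF p(7)] comp_assoc)
  have sum: "Plus T f g \<bullet> (p \<bullet> q) = t \<bullet> Plus T (x \<bullet> q) y"
    using rr fg p(1-6) q by (simp add: comp_plus_left comp_plus_right e)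
  note 1 = V_comp[OF h(1) c(1) fg(1) pq(1) _ pq(2) _ _ e(1)]
    and 2 = V_comp[OF h(2) c(1) fg(2) pq(1) q(3) pq(2) _ _ e(2)]
    and 3 = V_comp[OF V_plus(2)[OF h(1,2)] c(1) _ pq(1) _ pq(2) _ _ sum]
  show "c \<cdot>\<^bsub>V\<^esub> Plus V a b = Plus V (c \<cdot>\<^bsub>V\<^esub> a) (c \<cdot>\<^bsub>V\<^esub> b)"
    unfolding h(3,4) c(2) using 1 2 3 V_plus[OF h(1,2)] V_plus[OF 1(2) 2(2)] fg rr p q by (simp add: comp_plus_right)
qed

section \<open>Triangles in the Verdier quotient\<close>

interpretation V: shift_linear_category R V by (rule verdier_quotient_shift_linear)

abbreviation Q where "Q \<equiv> quotient_arr T S"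

lemma Q_eq: "f \<in> Arr T \<Longrightarrow> Dom T f = X \<Longrightarrow> Q f = fr (Ident T X) f"
  by (auto simp: quotient_arr_def)

lemma Q_arr [simp]: "f \<in> Arr T \<Longrightarrow> Q f \<in> Arr V"
  and Q_dom [simp]: "f \<in> Arr T \<Longrightarrow> Dom V (Q f) = Dom T f"
  and Q_cod [simp]: "f \<in> Arr T \<Longrightarrow> Cod V (Q f) = Cod T f"
  by (simp_all add: quotient_arr_def)

lemma Q_ident [simp]: "X \<in> Obj T \<Longrightarrow> Q (Ident T X) = Ident V X"
  by (simp add: quotient_arr_def V_ident)

lemma Q_zero [simp]: "X \<in> Obj T \<Longrightarrow> Y \<in> Obj T \<Longrightarrow> Q (Zero T X Y) = Zero V X Y"
  by (simp add: quotient_arr_def V_zero)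

lemma Q_comp_fr:
  assumes "(s, f) \<in> roofs T S" "g \<in> Arr T" "Dom T g = Cod T f"
  shows "Q g \<cdot>\<^bsub>V\<^esub> fr s f = fr s (g \<bullet> f)"
proof -
  note rr = assms(1)[unfolded roofs_iff]
  have "fr (Ident T (Cod T f)) g \<cdot>\<^bsub>V\<^esub> fr s (Ident T (Cod T f) \<bullet> f) = fr s (g \<bullet> f)"
    by (rule V_comp_factored(1)) (use rr assms(2,3) in \<open>simp_all add: roofs_iff denoms_ident\<close>)
  then show ?thesis using rr assms(2,3) by (simp add: Q_eq)
qed

lemma Q_comp: "\<lbrakk>f \<in> Arr T; g \<in> Arr T; Dom T g = Cod T f\<rbrakk> \<Longrightarrow> Q (g \<bullet> f) = Q g \<cdot>\<^bsub>V\<^esub> Q f"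
  using Q_comp_fr[of "Ident T (Dom T f)" f g] by (simp add: Q_eq)

lemma fr_comp_Q:
  assumes "(t, g) \<in> roofs T S" "x \<in> Arr T" "Cod T x = Dom T t"
  shows "fr t g \<cdot>\<^bsub>V\<^esub> Q (t \<bullet> x) = Q (g \<bullet> x)"
proof -
  note rr = assms(1)[unfolded roofs_iff]
  have "fr t g \<cdot>\<^bsub>V\<^esub> fr (Ident T (Dom T x)) (t \<bullet> x) = fr (Ident T (Dom T x)) (g \<bullet> x)"
    by (rule V_comp_factored(1)) (use rr assms in \<open>simp_all add: roofs_iff denoms_ident\<close>)
  then show ?thesis using rr assms(2,3) by (simp add: Q_eq)
qed

lemma Q_scale: "f \<in> Arr T \<Longrightarrow> c \<in> carrier R \<Longrightarrow> Q (Scale T c f) = Scale V c (Q f)"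
  by (simp add: Q_eq V_scale)

lemma Q_sh: "f \<in> Arr T \<Longrightarrow> ShArr V (Q f) = Q (ShArr T f)"
  using V_sh(1)[OF roof_ident, of f] by (simp add: Q_eq)

lemma roof_inv: "s \<in> D \<Longrightarrow> (s, Ident T (Dom T s)) \<in> roofs T S"
  by (simp add: roofs_iff denoms_arr)

lemma fr_decomp:
  assumes "(s, f) \<in> roofs T S"
  shows "fr s f = Q f \<cdot>\<^bsub>V\<^esub> fr s (Ident T (Dom T s))"
proof -
  note rr = assms[unfolded roofs_iff]
  have "Q f \<cdot>\<^bsub>V\<^esub> fr s (Ident T (Dom T s)) = fr s (f \<bullet> Ident T (Dom T s))"
    by (rule Q_comp_fr[OF roof_inv]) (use rr in simp_all)
  moreover have "f \<bullet> Ident T (Dom T s) = f" using rr by simp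
  ultimately show ?thesis by metis
qed

lemma Q_inverse:
  assumes "s \<in> D"
  shows "fr s (Ident T (Dom T s)) \<cdot>\<^bsub>V\<^esub> Q s = Ident V (Dom T s)"
    and "Q s \<cdot>\<^bsub>V\<^esub> fr s (Ident T (Dom T s)) = Ident V (Cod T s)"
    and "iso_arr V (Q s)"
proof -
  have s: "s \<in> Arr T" by (rule denoms_arr[OF assms])
  show 1: "fr s (Ident T (Dom T s)) \<cdot>\<^bsub>V\<^esub> Q s = Ident V (Dom T s)"
    using fr_comp_Q[OF roof_inv[OF assms], of "Ident T (Dom T s)"] s by simp
  have "fr (Ident T (Cod T s) \<bullet> s) (Ident T (Cod T s) \<bullet> s) = fr (Ident T (Cod T s)) (Ident T (Cod T s))"
    by (rule fr_reduce(2)) (use s assms in \<open>simp_all add: roofs_iff denoms_ident\<close>)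
  moreover have "(s, s) \<in> roofs T S" using s assms by (simp add: roofs_iff)
  ultimately show 2: "Q s \<cdot>\<^bsub>V\<^esub> fr s (Ident T (Dom T s)) = Ident V (Cod T s)"
    using s unfolding V_ident fr_decomp[OF \<open>(s, s) \<in> roofs T S\<close>, symmetric] by simp
  show "iso_arr V (Q s)"
    by (rule V.isoI[of _ "fr s (Ident T (Dom T s))"]) (use 1 2 s roof_inv[OF assms] in simp_all)
qed

lemma fr_zeroE:
  assumes "(s, f) \<in> roofs T S" "fr s f = Zero V (Cod T s) (Cod T f)"
  obtains p where "p \<in> D" "p \<in> Arr T" "Cod T p = Dom T s" "f \<bullet> p = Zero T (Dom T p) (Cod T f)"
proof -
  note rr = assms(1)[unfolded roofs_iff]
  have z: "(Ident T (Cod T s), Zero T (Cod T s) (Cod T f)) \<in> roofs T S"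
    using rr by (simp add: roofs_iff denoms_ident)
  have "roof_eq s f (Ident T (Cod T s)) (Zero T (Cod T s) (Cod T f))"
    using assms(2) fr_eq_iff[OF assms(1) z] by (simp add: V_zero)
  then obtain p q where pq: "p \<in> D" "p \<in> Arr T" "q \<in> Arr T" "Cod T p = Dom T s" "Cod T q = Cod T s"
    and e: "s \<bullet> p = Ident T (Cod T s) \<bullet> q" "f \<bullet> p = Zero T (Cod T s) (Cod T f) \<bullet> q"
    unfolding roof_eq_def using rr by auto
  have "Dom T q = Dom T p" using arg_cong[OF e(1), of "Dom T"] pq rr by simp
  then show thesis using that[OF pq(1,2,4)] e(2) pq rr by simp
qed

lemma fr_equalE:
  assumes "(s, f) \<in> roofs T S" "(s, g) \<in> roofs T S" "fr s f = fr s g"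
  obtains p where "p \<in> D" "p \<in> Arr T" "Cod T p = Dom T s" "f \<bullet> p = g \<bullet> p"
proof -
  note rr = assms(1,2)[unfolded roofs_iff]
  have "roof_eq s f s g" using fr_eq_iff[OF assms(1,2)] assms(3) by simp
  then obtain p q where pq: "p \<in> D" "q \<in> D" "p \<in> Arr T" "q \<in> Arr T" "Cod T p = Dom T s" "Cod T q = Dom T s"
    and e: "s \<bullet> p = s \<bullet> q" "f \<bullet> p = g \<bullet> q"
    unfolding roof_eq_def by blast
  have d: "Dom T q = Dom T p" using arg_cong[OF e(1), of "Dom T"] pq rr by simp
  obtain c where c: "c \<in> D" "c \<in> Arr T" "Cod T c = Dom T p" and ec: "p \<bullet> c = q \<bullet> c"
    using denoms_equalizes[of s p q thesis] rr pq d e(1) by simp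
  have "f \<bullet> (p \<bullet> c) = g \<bullet> (q \<bullet> c)" using rr pq c d by (simp add: comp_reassoc[OF e(2)] comp_assoc)
  then show thesis using that[of "p \<bullet> c"] ec c pq rr d by (simp add: denoms_comp)
qed

lemma Q_tri_map:
  assumes "candidate_triangle T (u, v, w)" "candidate_triangle T (u', v', w')" "tri_map a b c (u, v, w) (u', v', w')"
  shows "V.tri_map (Q a) (Q b) (Q c) (Q u, Q v, Q w) (Q u', Q v', Q w')"
proof -
  note cc = candidateD[OF assms(1)] candidateD[OF assms(2)] and m = tri_mapD[OF assms(3)]
  show ?thesis
    by (rule V.tri_mapI) (use cc m in \<open>simp_all add: Q_sh flip: Q_comp\<close>)
qed

lemma Q_candidate: "candidate_triangle T (u, v, w) \<Longrightarrow> candidate_triangle V (Q u, Q v, Q w)"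
  by (simp add: candidate_iff V.candidate_iff)

abbreviation "Q_triangles \<equiv> (\<lambda>(u, v, w). (Q u, Q v, Q w)) ` Tri T"

lemma V_Tri: "Tri V = triangle_closure V Q_triangles"
  by (simp add: verdier_quotient_def triangle_closure_def candidate_triangle_def iso_triangles_def
      iso_arr_def homs_def split_beta)

lemma Q_trianglesE:
  assumes "(u, v, w) \<in> Q_triangles"
  obtains u' v' w' where "(u', v', w') \<in> Tri T" "u = Q u'" "v = Q v'" "w = Q w'"
  using assms by auto

lemma Q_Tri: "(u, v, w) \<in> Tri T \<Longrightarrow> (Q u, Q v, Q w) \<in> Tri V"
  unfolding V_Tri V.closure_iff
  by (intro conjI exI[of _ "Q u"] exI[of _ "Q v"] exI[of _ "Q w"] V.iso_triangles_refl Q_candidate tri_cand)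
    (auto simp: image_iff Bex_def)

lemma Q_triangles_candidate: "\<forall>\<tau>\<in>Q_triangles. candidate_triangle V \<tau>"
  by (auto intro: Q_candidate tri_cand)

lemma verdier_quotient_exact: "exact_triangles R V"
proof (rule V.exact_triangles_basis[OF V_Tri Q_triangles_candidate])
  fix u v w assume "(u, v, w) \<in> Q_triangles"
  then obtain u' v' w' where t: "(u', v', w') \<in> Tri T" "u = Q u'" "v = Q v'" "w = Q w'" by (rule Q_trianglesE)
  note c = triD[OF t(1)]
  show "v \<cdot>\<^bsub>V\<^esub> u = Zero V (Dom V u) (Cod V v)"
    unfolding t(2,3) using tri_zero[OF t(1)] c by (simp flip: Q_comp)
  show "(v, w, Scale V (\<ominus> \<one>) (ShArr V u)) \<in> Tri V"
    unfolding t(2-4) using Q_Tri[OF rotate[OF t(1)]] c by (simp add: Q_sh Q_scale)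
  fix h assume h: "h \<in> Arr V" "Cod V h = Cod V u" "v \<cdot>\<^bsub>V\<^esub> h = Zero V (Dom V h) (Cod V v)"
  obtain s f where sf: "(s, f) \<in> roofs T S" "h = fr s f" using h(1) by (rule V_arrE)
  note rr = sf(1)[unfolded roofs_iff]
  have cf: "Cod T f = Cod T u'" using h(2) sf t c by simp
  have svf: "(s, v' \<bullet> f) \<in> roofs T S" using rr c cf by (simp add: roofs_iff)
  have "fr s (v' \<bullet> f) = Zero V (Cod T s) (Cod T (v' \<bullet> f))"
    using h(3) Q_comp_fr[OF sf(1), of v'] unfolding sf(2) t(3) using c cf rr by simp
  then obtain p where p: "p \<in> D" "p \<in> Arr T" "Cod T p = Dom T s" "v' \<bullet> f \<bullet> p = Zero T (Dom T p) (Cod T (v' \<bullet> f))"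
    using fr_zeroE[OF svf] by metis
  have "\<exists>k\<in>Arr T. Dom T k = Dom T p \<and> Cod T k = Dom T u' \<and> f \<bullet> p = u' \<bullet> k"
    using weak_kernel[OF t(1), of "f \<bullet> p"] rr c cf p by (simp add: comp_assoc)
  then obtain k where k: "k \<in> Arr T" "Dom T k = Dom T p" "Cod T k = Dom T u'" "f \<bullet> p = u' \<bullet> k" by blast
  have r: "(s \<bullet> p, k) \<in> roofs T S" using rr p k by (simp add: roofs_iff denoms_comp)
  have "h = fr (s \<bullet> p) (u' \<bullet> k)" unfolding sf(2) k(4)[symmetric] by (rule fr_reduce(2)[symmetric, OF sf(1) p(1,3)])
  also have "\<dots> = Q u' \<cdot>\<^bsub>V\<^esub> fr (s \<bullet> p) k" by (rule Q_comp_fr[symmetric, OF r]) (use c k in simp_all)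
  finally show "\<exists>k\<in>Arr V. Dom V k = Dom V h \<and> Cod V k = Dom V u \<and> h = u \<cdot>\<^bsub>V\<^esub> k"
    using r k rr p c sf t by (intro bexI[of _ "fr (s \<bullet> p) k"]) simp_all
qed

interpretation V: exact_triangles R V by (rule verdier_quotient_exact)

text \<open>
  A commutative square of fractions between images of arrows \<open>u\<close>, \<open>u'\<close> of \<open>T\<close> is rewritten, by successive refinements of the
  roofs \<open>a\<close> and \<open>b\<close>, as a span of two squares in \<open>T\<close> on a common arrow \<open>u\<^sub>2\<close>.  Both squares extend to maps from a
  triangle on \<open>u\<^sub>2\<close>.  The one towards \<open>u\<close> has denominators as components, so it becomes invertible in the quotient by
  the five lemma.
\<close>

lemma Q_tri_map_exists:
  assumes t: "(u, v, w) \<in> Tri T" "(u', v', w') \<in> Tri T"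
    and ab: "a \<in> Arr V" "b \<in> Arr V" "Dom V a = Dom T u" "Cod V a = Dom T u'" "Dom V b = Cod T u" "Cod V b = Cod T u'"
      "b \<cdot>\<^bsub>V\<^esub> Q u = Q u' \<cdot>\<^bsub>V\<^esub> a"
  shows "\<exists>c. V.tri_map a b c (Q u, Q v, Q w) (Q u', Q v', Q w')"
proof -
  note cc = triD[OF t(1)] triD[OF t(2)]
  obtain s a0 where a: "(s, a0) \<in> roofs T S" "a = fr s a0" using ab(1) by (rule V_arrE)
  obtain t b' where b: "(t, b') \<in> roofs T S" "b = fr t b'" using ab(2) by (rule V_arrE)
  note rr = a(1)[unfolded roofs_iff] b(1)[unfolded roofs_iff]
  have cds: "Cod T s = Dom T u" "Cod T a0 = Dom T u'" "Cod T t = Cod T u" "Cod T b' = Cod T u'" using ab a b by simp_all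
  obtain k u1 where k: "k \<in> D" "k \<in> Arr T" "u1 \<in> Arr T" "Cod T k = Dom T s" "Dom T u1 = Dom T k" "Cod T u1 = Dom T t"
     "u \<bullet> s \<bullet> k = t \<bullet> u1" using Ore[of t "u \<bullet> s" thesis] rr cc cds by simp
  define s1 where "s1 = s \<bullet> k" define a1 where "a1 = a0 \<bullet> k"
  have 1: "(s1, a1) \<in> roofs T S" "a = fr s1 a1" unfolding s1_def a1_def a(2) using fr_reduce[OF a(1) k(1,4)] by simp_all
  note rr1 = 1(1)[unfolded roofs_iff]
  have cds1: "Cod T s1 = Dom T u" "Cod T a1 = Dom T u'" "Dom T s1 = Dom T k" unfolding s1_def a1_def using k rr cds by simp_all
  have sq1: "u \<bullet> s1 = t \<bullet> u1" unfolding s1_def using k rr cc cds by (simp add: comp_assoc)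
  have ru: "(Ident T (Dom T u), u) \<in> roofs T S" using cc by simp
  have bu: "b \<cdot>\<^bsub>V\<^esub> Q u = fr (Ident T (Dom T u) \<bullet> s1) (b' \<bullet> u1)"
    unfolding b(2) Q_eq[OF cc(1) refl]
    by (rule V_comp(1)[OF ru b(1)]) (use k rr rr1 cc cds cds1 sq1 in simp_all)
  then have bu: "b \<cdot>\<^bsub>V\<^esub> Q u = fr s1 (b' \<bullet> u1)" using cds1 rr1 by simp
  have ua: "Q u' \<cdot>\<^bsub>V\<^esub> a = fr s1 (u' \<bullet> a1)" unfolding 1(2) by (rule Q_comp_fr[OF 1(1)]) (use cds1 cc in simp_all)
  have "(s1, b' \<bullet> u1) \<in> roofs T S" "(s1, u' \<bullet> a1) \<in> roofs T S" using rr rr1 cc cds cds1 k by (simp_all add: roofs_iff)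
  then obtain p where p: "p \<in> D" "p \<in> Arr T" "Cod T p = Dom T s1" "b' \<bullet> u1 \<bullet> p = u' \<bullet> a1 \<bullet> p"
    using fr_equalE ab(7)[unfolded bu ua] by metis
  define s2 where "s2 = s1 \<bullet> p" define a2 where "a2 = a1 \<bullet> p" define u2 where "u2 = u1 \<bullet> p"
  have 2: "(s2, a2) \<in> roofs T S" "a = fr s2 a2" unfolding s2_def a2_def 1(2) using fr_reduce[OF 1(1) p(1,3)] by simp_all
  note rr2 = 2(1)[unfolded roofs_iff]
  have cds2: "Cod T s2 = Dom T u" "Cod T a2 = Dom T u'" "Dom T s2 = Dom T p"
     unfolding s2_def a2_def using p rr1 cds1 by simp_all
  have u2: "u2 \<in> Arr T" "Dom T u2 = Dom T p" "Cod T u2 = Dom T t"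
    unfolding u2_def using p k cds1 by simp_all
  have sq2: "t \<bullet> u2 = u \<bullet> s2" unfolding s2_def u2_def using p k rr rr1 cc cds cds1 by (simp add: comp_reassoc[OF sq1] comp_assoc)
  have sq3: "b' \<bullet> u2 = u' \<bullet> a2" using p(4) unfolding a2_def u2_def using p(1-3) k rr rr1 cc cds cds1 by (simp add: comp_assoc)
  obtain v2 w2 where t2: "(u2, v2, w2) \<in> Tri T" using cone_exists[OF u2(1)] by blast
  have "\<exists>c. tri_map s2 t c (u2, v2, w2) (u, v, w)"
    by (rule tri_map_exists[OF t2 t(1)]) (use u2 rr rr2 cds cds2 sq2 in simp_all)
  then obtain c1 where m1: "tri_map s2 t c1 (u2, v2, w2) (u, v, w)" ..
  have "\<exists>c. tri_map a2 b' c (u2, v2, w2) (u', v', w')"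
    by (rule tri_map_exists[OF t2 t(2)]) (use u2 rr rr2 cds cds2 sq3 in simp_all)
  then obtain c2 where m2: "tri_map a2 b' c2 (u2, v2, w2) (u', v', w')" ..
  note Qm1 = Q_tri_map[OF tri_cand[OF t2] tri_cand[OF t(1)] m1]
  note Qm2 = Q_tri_map[OF tri_cand[OF t2] tri_cand[OF t(2)] m2]
  have isos: "s2 \<in> D" "t \<in> D" using rr2 rr by simp_all
  have "iso_arr V (Q c1)"
    by (rule V.five_lemma[OF Q_Tri[OF t2] Q_Tri[OF t(1)] Qm1 Q_inverse(3)[OF isos(1)] Q_inverse(3)[OF isos(2)]])
  then obtain d where d: "d \<in> Arr V" "Dom V d = Cod V (Q c1)" "Cod V d = Dom V (Q c1)"
    "d \<cdot>\<^bsub>V\<^esub> Q c1 = Ident V (Dom V (Q c1))" "Q c1 \<cdot>\<^bsub>V\<^esub> d = Ident V (Cod V (Q c1))" by (rule V.isoE)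
  have "V.tri_map (fr s2 (Ident T (Dom T s2))) (fr t (Ident T (Dom T t))) d (Q u, Q v, Q w) (Q u2, Q v2, Q w2)"
    by (rule V.tri_map_inverse[OF Q_candidate[OF tri_cand[OF t2]] Q_candidate[OF tri_cand[OF t(1)]] Qm1 _ _ _ _ _ _ _ _ _ _ d])
      (use rr rr2 roof_inv[OF isos(1)] roof_inv[OF isos(2)] Q_inverse[OF isos(1)] Q_inverse[OF isos(2)] in simp_all)
  from V.tri_map_comp[OF Q_candidate[OF tri_cand[OF t(1)]] Q_candidate[OF tri_cand[OF t2]] Q_candidate[OF tri_cand[OF t(2)]] this Qm2]
  show ?thesis unfolding b(2) 2(2) fr_decomp[OF b(1)] fr_decomp[OF 2(1)] by blast
qed

theorem verdier_quotient_triangulated: "triangulated R V"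
proof
  fix u v w u' v' w' a b
  assume h: "(u, v, w) \<in> Tri V" "(u', v', w') \<in> Tri V" "a \<in> Arr V" "b \<in> Arr V"
      "Dom V a = Dom V u" "Cod V a = Dom V u'" "Dom V b = Cod V u" "Cod V b = Cod V u'" "b \<cdot>\<^bsub>V\<^esub> u = u' \<cdot>\<^bsub>V\<^esub> a"
  show "\<exists>c. V.tri_map a b c (u, v, w) (u', v', w')"
  proof (rule V.tri_map_exists_basis[OF V_Tri Q_triangles_candidate _ h])
    fix u v w u' v' w' a b
    assume u: "(u, v, w) \<in> Q_triangles" and u': "(u', v', w') \<in> Q_triangles"
      and ab: "a \<in> Arr V" "b \<in> Arr V"
      "Dom V a = Dom V u" "Cod V a = Dom V u'" "Dom V b = Cod V u" "Cod V b = Cod V u'" "b \<cdot>\<^bsub>V\<^esub> u = u' \<cdot>\<^bsub>V\<^esub> a"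
    obtain u1 v1 w1 where t: "(u1, v1, w1) \<in> Tri T" "u = Q u1" "v = Q v1" "w = Q w1" using u by (rule Q_trianglesE)
    obtain u2 v2 w2 where t': "(u2, v2, w2) \<in> Tri T" "u' = Q u2" "v' = Q v2" "w' = Q w2" using u' by (rule Q_trianglesE)
    show "\<exists>c. V.tri_map a b c (u, v, w) (u', v', w')"
      unfolding t(2-4) t'(2-4)
      by (rule Q_tri_map_exists[OF t(1) t'(1)]) (use ab t t' triD[OF t(1)] triD[OF t'(1)] in simp_all)
  qed
next
  fix h assume "h \<in> Arr V"
  then obtain s f where sf: "(s, f) \<in> roofs T S" "h = fr s f" by (rule V_arrE)
  note rr = sf(1)[unfolded roofs_iff] have sD: "s \<in> D" using rr by simp
  define i where "i = fr s (Ident T (Dom T s))"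
  have i: "i \<in> Arr V" "Dom V i = Cod T s" "Cod V i = Dom T s" using roof_inv[OF sD] rr by (simp_all add: i_def)
  note ii = Q_inverse[OF sD, folded i_def]
  have hi: "h = Q f \<cdot>\<^bsub>V\<^esub> i" using fr_decomp[OF sf(1)] sf(2) by (simp add: i_def)
  have hs: "h \<cdot>\<^bsub>V\<^esub> Q s = Q f" unfolding hi using i ii rr by (simp add: V.comp_assoc)
  have ho: "h \<in> Arr V" "Dom V h = Cod T s" "Cod V h = Cod T f" using sf by simp_all
  obtain v w where t: "(f, v, w) \<in> Tri T" using cone_exists rr by blast
  note c = triD[OF t]
  have "(h, Q v, ShArr V (Q s) \<cdot>\<^bsub>V\<^esub> Q w) \<in> Tri V"
    by (rule V.iso_triangle_change[OF Q_Tri[OF t], of _ _ _ "Q s" "Ident V (Cod T f)" "Ident V (Cod T v)"])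
      (use c rr ho hs ii in \<open>simp_all add: V.candidate_iff V.tri_map_def\<close>)
  then show "\<exists>v w. (h, v, w) \<in> Tri V" by blast
  obtain t w where t: "(t, f, w) \<in> Tri T" using cocone_exists rr by blast
  note c = triD[OF t]
  have "(Q s \<cdot>\<^bsub>V\<^esub> Q t, h, Q w) \<in> Tri V"
    by (rule V.iso_triangle_change[OF Q_Tri[OF t], of _ _ _ "Ident V (Dom T t)" "Q s" "Ident V (Cod T f)"])
      (use c rr ho hs ii in \<open>simp_all add: V.candidate_iff V.tri_map_def\<close>)
  then show "\<exists>u w. (u, h, w) \<in> Tri V" by blast
next
  obtain Z where Z: "Z \<in> Obj T" "Ident T Z = Zero T Z Z" and t: "\<forall>E\<in>Obj T. (Zero T Z E, Ident T E, Zero T E (ShObj T Z)) \<in> Tri T"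
    using zero_object by blast
  have "(Zero V Z E, Ident V E, Zero V E (ShObj V Z)) \<in> Tri V" if "E \<in> Obj V" for E
    using Q_Tri[of "Zero T Z E" "Ident T E" "Zero T E (ShObj T Z)"] t that Z by simp
  moreover have "Ident V Z = Zero V Z Z" using arg_cong[OF Z(2), of Q] Z(1) by simp
  ultimately show "\<exists>Z\<in>Obj V. Ident V Z = Zero V Z Z \<and>
      (\<forall>E\<in>Obj V. (Zero V Z E, Ident V E, Zero V E (ShObj V Z)) \<in> Tri V)" using Z(1) by (intro bexI[of _ Z]) simp_all
next
  fix X r assume X: "X \<in> Obj V" and r: "r \<in> carrier R"
  then obtain v w where t: "(Scale T r (Ident T X), v, w) \<in> Tri T"
        "Scale T r (Ident T (Cod T v)) = Zero T (Cod T v) (Cod T v)" using koszul[of X r] by auto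
  note c = triD[OF t(1)]
  have "(Scale V r (Ident V X), Q v, Q w) \<in> Tri V" using Q_Tri[OF t(1)] X r by (simp add: Q_scale)
  moreover have "Scale V r (Ident V (Cod V (Q v))) = Zero V (Cod V (Q v)) (Cod V (Q v))"
    using arg_cong[OF t(2), of Q] c r by (simp add: Q_scale)
  ultimately show "\<exists>v w. (Scale V r (Ident V X), v, w) \<in> Tri V \<and>
        Scale V r (Ident V (Cod V v)) = Zero V (Cod V v) (Cod V v)" by blast
next
  fix f g assume fg: "f \<in> Arr V" "g \<in> Arr V" "Dom V g = Cod V f"
  obtain s f' t g' x where h: "(s, f') \<in> roofs T S" "(t, g') \<in> roofs T S" "f = fr s f'" "g = fr t g'" "x \<in> Arr T"
    "Dom T x = Dom T s" "Cod T x = Dom T t" "f' = t \<bullet> x" "g \<cdot>\<^bsub>V\<^esub> f = fr s (g' \<bullet> x)" "(s, g' \<bullet> x) \<in> roofs T S"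
    using fg by (rule V_comp_ex)
  note rr = h(1,2)[unfolded roofs_iff] have sD: "s \<in> D" "t \<in> D" using rr by simp_all
  have dg: "Dom T g' = Cod T x" using rr h(7) by simp
  have ga: "g' \<in> Arr T" using rr by simp
  obtain v1 w1 v2 w2 v3 w3 a b c where o: "(x, v1, w1) \<in> Tri T" "(g', v2, w2) \<in> Tri T" "(g' \<bullet> x, v3, w3) \<in> Tri T"
        "(a, b, c) \<in> Tri T" "Dom T a = Cod T v1" "Cod T a = Cod T v3" "Cod T b = Cod T v2"
    using octahedron[OF h(5) ga dg] by (elim exE conjE)
  note cc = triD[OF o(1)] triD[OF o(2)] triD[OF o(3)] triD[OF o(4)]
  define j where "j = fr t (Ident T (Dom T t))"
  have j: "j \<in> Arr V" "Dom V j = Cod T t" "Cod V j = Dom T t" using roof_inv[OF sD(2)] rr by (simp_all add: j_def)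
  note jj = Q_inverse[OF sD(2), folded j_def]
  note ss = Q_inverse[OF sD(1)]
  have fo: "f \<in> Arr V" "Dom V f = Cod T s" "Cod V f = Cod T t" using h fg rr by simp_all
  have go: "g \<in> Arr V" "Dom V g = Cod T t" "Cod V g = Cod T g'" using h fg rr by simp_all
  define i where "i = fr s (Ident T (Dom T s))"
  have i: "i \<in> Arr V" "Dom V i = Cod T s" "Cod V i = Dom T s" using roof_inv[OF sD(1)] rr by (simp_all add: i_def)
  note ii = Q_inverse[OF sD(1), folded i_def]
  have fs: "f \<cdot>\<^bsub>V\<^esub> Q s = Q t \<cdot>\<^bsub>V\<^esub> Q x"
  proof -
    have "f \<cdot>\<^bsub>V\<^esub> Q s = Q f'"
      unfolding h(3) fr_decomp[OF h(1)] i_def[symmetric] using i ii rr by (simp add: V.comp_assoc)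
    also have "\<dots> = Q t \<cdot>\<^bsub>V\<^esub> Q x" unfolding h(8) by (rule Q_comp) (use rr h(5-7) in simp_all)
    finally show ?thesis .
  qed
  have gt: "g \<cdot>\<^bsub>V\<^esub> Q t = Q g'"
    unfolding h(4) fr_decomp[OF h(2)] j_def[symmetric] using j jj rr by (simp add: V.comp_assoc)
  have gfs: "g \<cdot>\<^bsub>V\<^esub> f \<cdot>\<^bsub>V\<^esub> Q s = Q (g' \<bullet> x)"
    using rr h(5-7) fo go fg by (simp add: V.comp_assoc fs V.comp_reassoc[OF gt] Q_comp)
  have vt: "Q v1 \<cdot>\<^bsub>V\<^esub> j \<cdot>\<^bsub>V\<^esub> Q t = Q v1" using j jj cc h(5-7) rr by (simp add: V.comp_assoc)
  have 1: "(f, Q v1 \<cdot>\<^bsub>V\<^esub> j, ShArr V (Q s) \<cdot>\<^bsub>V\<^esub> Q w1) \<in> Tri V"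
    by (rule V.iso_triangle_change[OF Q_Tri[OF o(1)], of _ _ _ "Q s" "Q t" "Ident V (Cod T v1)"])
      (use cc rr fo h(5-7) j fs vt ss jj in \<open>simp_all add: V.candidate_iff V.tri_map_def\<close>)
  have 2: "(g, Q v2, ShArr V (Q t) \<cdot>\<^bsub>V\<^esub> Q w2) \<in> Tri V"
    by (rule V.iso_triangle_change[OF Q_Tri[OF o(2)], of _ _ _ "Q t" "Ident V (Cod T g')" "Ident V (Cod T v2)"])
      (use cc rr go h(5-7) gt jj in \<open>simp_all add: V.candidate_iff V.tri_map_def\<close>)
  have 3: "(g \<cdot>\<^bsub>V\<^esub> f, Q v3, ShArr V (Q s) \<cdot>\<^bsub>V\<^esub> Q w3) \<in> Tri V"
    by (rule V.iso_triangle_change[OF Q_Tri[OF o(3)], of _ _ _ "Q s" "Ident V (Cod T g')" "Ident V (Cod T v3)"])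
      (use cc rr go fo h(5-7) gfs ss fg(3) in \<open>simp_all add: V.candidate_iff V.tri_map_def\<close>)
  have 4: "Dom V (Q a) = Cod V (Q v1 \<cdot>\<^bsub>V\<^esub> j)" "Cod V (Q a) = Cod V (Q v3)" "Cod V (Q b) = Cod V (Q v2)"
    using o(5-7) cc j h(5-7) by simp_all
  show "\<exists>v1 w1 v2 w2 v3 w3 a b c. (f, v1, w1) \<in> Tri V \<and> (g, v2, w2) \<in> Tri V \<and> (g \<cdot>\<^bsub>V\<^esub> f, v3, w3) \<in> Tri V \<and>
        (a, b, c) \<in> Tri V \<and> Dom V a = Cod V v1 \<and> Cod V a = Cod V v3 \<and> Cod V b = Cod V v2"
    using 1 2 3 Q_Tri[OF o(4)] 4 by blast
qed

end

section \<open>Modules, complexes and homotopies\<close>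

context cring
begin

lemma module_abelian: "module R M \<Longrightarrow> abelian_group M"
  by (simp add: module_def)

text \<open>
  Rewrite rules for modules with explicit carriers.  As in \<open>algebra_simps\<close>, opposites become differences, differences
  are moved outwards and across equations, and the remaining sums are sorted; this decides all additive identities below.
\<close>

lemma mod_closed [simp]:
  "module R M \<Longrightarrow> \<zero>\<^bsub>M\<^esub> \<in> carrier M"
  "module R M \<Longrightarrow> x \<in> carrier M \<Longrightarrow> y \<in> carrier M \<Longrightarrow> x \<oplus>\<^bsub>M\<^esub> y \<in> carrier M"
  "module R M \<Longrightarrow> x \<in> carrier M \<Longrightarrow> \<ominus>\<^bsub>M\<^esub> x \<in> carrier M"
  "module R M \<Longrightarrow> x \<in> carrier M \<Longrightarrow> y \<in> carrier M \<Longrightarrow> x \<ominus>\<^bsub>M\<^esub> y \<in> carrier M"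
  "module R M \<Longrightarrow> r \<in> carrier R \<Longrightarrow> x \<in> carrier M \<Longrightarrow> r \<odot>\<^bsub>M\<^esub> x \<in> carrier M"
  by (auto dest: module_abelian simp: abelian_groupE(1) abelian_group.a_inv_closed module.smult_closed
      abelian_group.minus_closed abelian_group.axioms(1) abelian_monoid.zero_closed abelian_monoid.a_closed)

lemma mod_zero [simp]:
  "module R M \<Longrightarrow> x \<in> carrier M \<Longrightarrow> \<zero>\<^bsub>M\<^esub> \<oplus>\<^bsub>M\<^esub> x = x"
  "module R M \<Longrightarrow> x \<in> carrier M \<Longrightarrow> x \<oplus>\<^bsub>M\<^esub> \<zero>\<^bsub>M\<^esub> = x"
  "module R M \<Longrightarrow> x \<in> carrier M \<Longrightarrow> x \<ominus>\<^bsub>M\<^esub> \<zero>\<^bsub>M\<^esub> = x"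
  "module R M \<Longrightarrow> x \<in> carrier M \<Longrightarrow> x \<ominus>\<^bsub>M\<^esub> x = \<zero>\<^bsub>M\<^esub>"
proof -
  assume M: "module R M" and x: "x \<in> carrier M"
  interpret M: abelian_group M by (rule module_abelian[OF M])
  show "\<zero>\<^bsub>M\<^esub> \<oplus>\<^bsub>M\<^esub> x = x" "x \<oplus>\<^bsub>M\<^esub> \<zero>\<^bsub>M\<^esub> = x" "x \<ominus>\<^bsub>M\<^esub> \<zero>\<^bsub>M\<^esub> = x" "x \<ominus>\<^bsub>M\<^esub> x = \<zero>\<^bsub>M\<^esub>"
    using x by (simp_all add: a_minus_def M.r_neg)
qed

lemma mod_ac:
  "module R M \<Longrightarrow> x \<in> carrier M \<Longrightarrow> y \<in> carrier M \<Longrightarrow> x \<oplus>\<^bsub>M\<^esub> y = y \<oplus>\<^bsub>M\<^esub> x"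
  "module R M \<Longrightarrow> x \<in> carrier M \<Longrightarrow> y \<in> carrier M \<Longrightarrow> z \<in> carrier M \<Longrightarrow> x \<oplus>\<^bsub>M\<^esub> y \<oplus>\<^bsub>M\<^esub> z = x \<oplus>\<^bsub>M\<^esub> (y \<oplus>\<^bsub>M\<^esub> z)"
  "module R M \<Longrightarrow> x \<in> carrier M \<Longrightarrow> y \<in> carrier M \<Longrightarrow> z \<in> carrier M \<Longrightarrow> x \<oplus>\<^bsub>M\<^esub> (y \<oplus>\<^bsub>M\<^esub> z) = y \<oplus>\<^bsub>M\<^esub> (x \<oplus>\<^bsub>M\<^esub> z)"
  by (auto dest!: module_abelian dest: abelian_group.axioms(1) simp: abelian_monoid.a_assoc abelian_monoid.a_comm abelian_monoid.a_lcomm)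

lemma mod_diff_eq:
  assumes "module R M" "x \<in> carrier M" "y \<in> carrier M" "z \<in> carrier M"
  shows "x \<ominus>\<^bsub>M\<^esub> y = z \<longleftrightarrow> x = z \<oplus>\<^bsub>M\<^esub> y" and "z = x \<ominus>\<^bsub>M\<^esub> y \<longleftrightarrow> z \<oplus>\<^bsub>M\<^esub> y = x"
proof -
  interpret M: abelian_group M by (rule module_abelian[OF assms(1)])
  have 1: "x = z \<oplus>\<^bsub>M\<^esub> y" if "x \<ominus>\<^bsub>M\<^esub> y = z"
    using that[symmetric] assms by (simp add: a_minus_def M.a_assoc M.l_neg)
  have 2: "x \<ominus>\<^bsub>M\<^esub> y = z" if "x = z \<oplus>\<^bsub>M\<^esub> y"
    using that assms by (simp add: a_minus_def M.a_assoc M.r_neg)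
  show "x \<ominus>\<^bsub>M\<^esub> y = z \<longleftrightarrow> x = z \<oplus>\<^bsub>M\<^esub> y" "z = x \<ominus>\<^bsub>M\<^esub> y \<longleftrightarrow> z \<oplus>\<^bsub>M\<^esub> y = x"
    using 1 2 by metis+
qed

lemma mod_uminus: "module R M \<Longrightarrow> x \<in> carrier M \<Longrightarrow> \<ominus>\<^bsub>M\<^esub> x = \<zero>\<^bsub>M\<^esub> \<ominus>\<^bsub>M\<^esub> x"
  by (simp add: a_minus_def)

lemma mod_diff_simps:
  assumes "module R M" "x \<in> carrier M" "y \<in> carrier M" "z \<in> carrier M"
  shows "x \<oplus>\<^bsub>M\<^esub> (y \<ominus>\<^bsub>M\<^esub> z) = (x \<oplus>\<^bsub>M\<^esub> y) \<ominus>\<^bsub>M\<^esub> z" "(x \<ominus>\<^bsub>M\<^esub> z) \<oplus>\<^bsub>M\<^esub> y = (x \<oplus>\<^bsub>M\<^esub> y) \<ominus>\<^bsub>M\<^esub> z"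
    "x \<ominus>\<^bsub>M\<^esub> (y \<ominus>\<^bsub>M\<^esub> z) = (x \<oplus>\<^bsub>M\<^esub> z) \<ominus>\<^bsub>M\<^esub> y" "(x \<ominus>\<^bsub>M\<^esub> y) \<ominus>\<^bsub>M\<^esub> z = x \<ominus>\<^bsub>M\<^esub> (y \<oplus>\<^bsub>M\<^esub> z)"
proof -
  interpret M: abelian_group M by (rule module_abelian[OF assms(1)])
  show "x \<oplus>\<^bsub>M\<^esub> (y \<ominus>\<^bsub>M\<^esub> z) = (x \<oplus>\<^bsub>M\<^esub> y) \<ominus>\<^bsub>M\<^esub> z" "(x \<ominus>\<^bsub>M\<^esub> z) \<oplus>\<^bsub>M\<^esub> y = (x \<oplus>\<^bsub>M\<^esub> y) \<ominus>\<^bsub>M\<^esub> z"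
    "x \<ominus>\<^bsub>M\<^esub> (y \<ominus>\<^bsub>M\<^esub> z) = (x \<oplus>\<^bsub>M\<^esub> z) \<ominus>\<^bsub>M\<^esub> y" "(x \<ominus>\<^bsub>M\<^esub> y) \<ominus>\<^bsub>M\<^esub> z = x \<ominus>\<^bsub>M\<^esub> (y \<oplus>\<^bsub>M\<^esub> z)"
    using assms by (simp_all add: a_minus_def M.a_ac M.minus_add)
qed

lemma mod_smult_distrib:
  assumes "module R M" "r \<in> carrier R" "x \<in> carrier M" "y \<in> carrier M"
  shows "r \<odot>\<^bsub>M\<^esub> (x \<oplus>\<^bsub>M\<^esub> y) = r \<odot>\<^bsub>M\<^esub> x \<oplus>\<^bsub>M\<^esub> r \<odot>\<^bsub>M\<^esub> y"
    "r \<odot>\<^bsub>M\<^esub> (x \<ominus>\<^bsub>M\<^esub> y) = r \<odot>\<^bsub>M\<^esub> x \<ominus>\<^bsub>M\<^esub> r \<odot>\<^bsub>M\<^esub> y"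
proof -
  interpret M: module R M by (rule assms(1))
  show "r \<odot>\<^bsub>M\<^esub> (x \<oplus>\<^bsub>M\<^esub> y) = r \<odot>\<^bsub>M\<^esub> x \<oplus>\<^bsub>M\<^esub> r \<odot>\<^bsub>M\<^esub> y" "r \<odot>\<^bsub>M\<^esub> (x \<ominus>\<^bsub>M\<^esub> y) = r \<odot>\<^bsub>M\<^esub> x \<ominus>\<^bsub>M\<^esub> r \<odot>\<^bsub>M\<^esub> y"
    using assms by (simp_all add: a_minus_def M.smult_r_distr M.smult_r_minus)
qed

lemma mod_smult_const:
  assumes "module R M"
  shows "r \<in> carrier R \<Longrightarrow> r \<odot>\<^bsub>M\<^esub> \<zero>\<^bsub>M\<^esub> = \<zero>\<^bsub>M\<^esub>"
    "r \<in> carrier R \<Longrightarrow> x \<in> carrier M \<Longrightarrow> (\<ominus> r) \<odot>\<^bsub>M\<^esub> x = \<zero>\<^bsub>M\<^esub> \<ominus>\<^bsub>M\<^esub> (r \<odot>\<^bsub>M\<^esub> x)"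
    "x \<in> carrier M \<Longrightarrow> \<one> \<odot>\<^bsub>M\<^esub> x = x" "x \<in> carrier M \<Longrightarrow> \<zero> \<odot>\<^bsub>M\<^esub> x = \<zero>\<^bsub>M\<^esub>"
proof -
  interpret M: module R M by (rule assms(1))
  show "r \<in> carrier R \<Longrightarrow> r \<odot>\<^bsub>M\<^esub> \<zero>\<^bsub>M\<^esub> = \<zero>\<^bsub>M\<^esub>"
    "r \<in> carrier R \<Longrightarrow> x \<in> carrier M \<Longrightarrow> (\<ominus> r) \<odot>\<^bsub>M\<^esub> x = \<zero>\<^bsub>M\<^esub> \<ominus>\<^bsub>M\<^esub> (r \<odot>\<^bsub>M\<^esub> x)"
    "x \<in> carrier M \<Longrightarrow> \<one> \<odot>\<^bsub>M\<^esub> x = x" "x \<in> carrier M \<Longrightarrow> \<zero> \<odot>\<^bsub>M\<^esub> x = \<zero>\<^bsub>M\<^esub>"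
    by (simp_all add: a_minus_def M.smult_l_minus)
qed

lemmas mod_smult = mod_smult_distrib mod_smult_const

lemma mod_smult_two:
  "module R M \<Longrightarrow> r \<in> carrier R \<Longrightarrow> s \<in> carrier R \<Longrightarrow> x \<in> carrier M \<Longrightarrow> (r \<otimes> s) \<odot>\<^bsub>M\<^esub> x = r \<odot>\<^bsub>M\<^esub> (s \<odot>\<^bsub>M\<^esub> x)"
  "module R M \<Longrightarrow> r \<in> carrier R \<Longrightarrow> s \<in> carrier R \<Longrightarrow> x \<in> carrier M \<Longrightarrow> (r \<oplus> s) \<odot>\<^bsub>M\<^esub> x = r \<odot>\<^bsub>M\<^esub> x \<oplus>\<^bsub>M\<^esub> s \<odot>\<^bsub>M\<^esub> x"
  by (simp_all add: module.smult_assoc1 module.smult_l_distr)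

lemmas mod_simps = mod_diff_eq mod_uminus mod_diff_simps mod_smult mod_ac

lemma lin_mapI:
  assumes "\<And>m. m \<in> carrier M \<Longrightarrow> f m \<in> carrier N"
    "\<And>m m'. m \<in> carrier M \<Longrightarrow> m' \<in> carrier M \<Longrightarrow> f (m \<oplus>\<^bsub>M\<^esub> m') = f m \<oplus>\<^bsub>N\<^esub> f m'"
    "\<And>r m. r \<in> carrier R \<Longrightarrow> m \<in> carrier M \<Longrightarrow> f (r \<odot>\<^bsub>M\<^esub> m) = r \<odot>\<^bsub>N\<^esub> f m"
  shows "f \<in> lin_maps R M N"
  using assms by (auto simp: lin_maps_def)

lemma lin_mapD:
  assumes "f \<in> lin_maps R M N"
  shows "m \<in> carrier M \<Longrightarrow> f m \<in> carrier N"
    "m \<in> carrier M \<Longrightarrow> m' \<in> carrier M \<Longrightarrow> f (m \<oplus>\<^bsub>M\<^esub> m') = f m \<oplus>\<^bsub>N\<^esub> f m'"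
    "r \<in> carrier R \<Longrightarrow> m \<in> carrier M \<Longrightarrow> f (r \<odot>\<^bsub>M\<^esub> m) = r \<odot>\<^bsub>N\<^esub> f m"
  using assms by (auto simp: lin_maps_def)

lemma lin_map_diff:
  assumes f: "f \<in> lin_maps R M N" and M: "module R M" and N: "module R N"
  shows "f \<zero>\<^bsub>M\<^esub> = \<zero>\<^bsub>N\<^esub>"
    "x \<in> carrier M \<Longrightarrow> y \<in> carrier M \<Longrightarrow> f (x \<ominus>\<^bsub>M\<^esub> y) = f x \<ominus>\<^bsub>N\<^esub> f y"
proof -
  note fs = lin_mapD[OF f]
  show "f \<zero>\<^bsub>M\<^esub> = \<zero>\<^bsub>N\<^esub>"
    using fs(3)[OF zero_closed mod_closed(1)[OF M]] fs(1)[OF mod_closed(1)[OF M]] M N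
    by (simp add: mod_smult_const)
  show "f (x \<ominus>\<^bsub>M\<^esub> y) = f x \<ominus>\<^bsub>N\<^esub> f y" if "x \<in> carrier M" "y \<in> carrier M"
  proof -
    have "f x = f ((x \<ominus>\<^bsub>M\<^esub> y) \<oplus>\<^bsub>M\<^esub> y)"
      using mod_diff_eq(1)[OF M that mod_closed(4)[OF M that]] by simp
    also have "\<dots> = f (x \<ominus>\<^bsub>M\<^esub> y) \<oplus>\<^bsub>N\<^esub> f y" using that M by (simp add: fs)
    finally show ?thesis using that M N by (simp add: mod_diff_eq fs)
  qed
qed

lemma dir_sum_simps [simp]:
  "x \<in> carrier (dir_sum M N) \<longleftrightarrow> (\<exists>m n. x = Pair m n \<and> m \<in> carrier M \<and> n \<in> carrier N)"
  "Pair a b \<oplus>\<^bsub>dir_sum M N\<^esub> Pair c d = Pair (a \<oplus>\<^bsub>M\<^esub> c) (b \<oplus>\<^bsub>N\<^esub> d)"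
  "r \<odot>\<^bsub>dir_sum M N\<^esub> Pair a b = Pair (r \<odot>\<^bsub>M\<^esub> a) (r \<odot>\<^bsub>N\<^esub> b)"
  "\<zero>\<^bsub>dir_sum M N\<^esub> = Pair \<zero>\<^bsub>M\<^esub> \<zero>\<^bsub>N\<^esub>"
  by (auto simp: dir_sum_def)

lemma dir_sum_module [simp]:
  assumes M: "module R M" and N: "module R N" shows "module R (dir_sum M N)"
proof -
  have "abelian_group (dir_sum M N)"
  proof (rule abelian_groupI)
    fix x assume "x \<in> carrier (dir_sum M N)"
    then obtain a b where x: "x = Pair a b" "a \<in> carrier M" "b \<in> carrier N" by auto
    show "\<exists>y\<in>carrier (dir_sum M N). y \<oplus>\<^bsub>dir_sum M N\<^esub> x = \<zero>\<^bsub>dir_sum M N\<^esub>"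
      by (rule bexI[of _ "Pair (\<zero>\<^bsub>M\<^esub> \<ominus>\<^bsub>M\<^esub> a) (\<zero>\<^bsub>N\<^esub> \<ominus>\<^bsub>N\<^esub> b)"]) (use x M N in \<open>simp_all add: mod_simps\<close>)
  qed (use M N in \<open>auto simp: mod_ac\<close>)
  then show ?thesis
    by (intro moduleI) (use M N in \<open>auto simp: is_cring mod_smult mod_smult_two\<close>)
qed

lemma dir_sum_minus [simp]:
  assumes M: "module R M" and N: "module R N" and ab: "a \<in> carrier M" "c \<in> carrier M" "b \<in> carrier N" "d \<in> carrier N"
  shows "Pair a b \<ominus>\<^bsub>dir_sum M N\<^esub> Pair c d = Pair (a \<ominus>\<^bsub>M\<^esub> c) (b \<ominus>\<^bsub>N\<^esub> d)"
  by (subst mod_diff_eq[OF dir_sum_module[OF M N]]) (use assms in \<open>simp_all add: mod_simps\<close>)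

text \<open>
  Intersecting a submodule of the sum with the two summands.
\<close>

lemma dir_sum_fin_gen:
  assumes M: "module R M" "fin_gen R M" and N: "module R N" "fin_gen R N"
  shows "fin_gen R (dir_sum M N)"
proof -
  obtain A where A: "finite A" "A \<subseteq> carrier M" "\<And>K. submodule K R M \<Longrightarrow> A \<subseteq> K \<Longrightarrow> K = carrier M"
    using M(2) unfolding fin_gen_def by blast
  obtain B where B: "finite B" "B \<subseteq> carrier N" "\<And>K. submodule K R N \<Longrightarrow> B \<subseteq> K \<Longrightarrow> K = carrier N"
    using N(2) unfolding fin_gen_def by blast
  define C where "C = (\<lambda>a. Pair a \<zero>\<^bsub>N\<^esub>) ` A \<union> (\<lambda>b. Pair \<zero>\<^bsub>M\<^esub> b) ` B"
  have "K = carrier (dir_sum M N)" if K: "submodule K R (dir_sum M N)" "C \<subseteq> K" for K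
  proof -
    note sm = module.submoduleE[OF dir_sum_module[OF M(1) N(1)] K(1)]
    have Kadd: "x \<oplus>\<^bsub>dir_sum M N\<^esub> y \<in> K" if "x \<in> K" "y \<in> K" for x y using sm(5) that by blast
    have Kinv: "\<ominus>\<^bsub>dir_sum M N\<^esub> x \<in> K" if "x \<in> K" for x using sm(3) that by blast
    have Ksm: "r \<odot>\<^bsub>dir_sum M N\<^esub> x \<in> K" if "r \<in> carrier R" "x \<in> K" for r x using sm(4) that by blast
    have minus: "\<ominus>\<^bsub>dir_sum M N\<^esub> Pair a b = Pair (\<ominus>\<^bsub>M\<^esub> a) (\<ominus>\<^bsub>N\<^esub> b)" if "a \<in> carrier M" "b \<in> carrier N" for a b
      using that M N by (subst mod_uminus) (simp_all add: mod_uminus)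
    have zK: "Pair \<zero>\<^bsub>M\<^esub> \<zero>\<^bsub>N\<^esub> \<in> K"
    proof -
      obtain x where x: "x \<in> K" using sm(2) by blast
      then have "\<zero> \<odot>\<^bsub>dir_sum M N\<^esub> x \<in> K" by (intro Ksm) simp_all
      moreover have "x \<in> carrier (dir_sum M N)" using sm(1) x by blast
      ultimately show ?thesis using M N by (auto simp: mod_smult_const)
    qed
    have z: "\<ominus>\<^bsub>M\<^esub> \<zero>\<^bsub>M\<^esub> = \<zero>\<^bsub>M\<^esub>" "\<ominus>\<^bsub>N\<^esub> \<zero>\<^bsub>N\<^esub> = \<zero>\<^bsub>N\<^esub>" using M N by (simp_all add: mod_uminus)
    have "submodule {a \<in> carrier M. Pair a \<zero>\<^bsub>N\<^esub> \<in> K} R M"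
    proof (rule module.submoduleI[OF M(1)])
      fix a b r assume "a \<in> {a \<in> carrier M. Pair a \<zero>\<^bsub>N\<^esub> \<in> K}"
      then have a: "a \<in> carrier M" "Pair a \<zero>\<^bsub>N\<^esub> \<in> K" by auto
      show "\<ominus>\<^bsub>M\<^esub> a \<in> {a \<in> carrier M. Pair a \<zero>\<^bsub>N\<^esub> \<in> K}" using Kinv[OF a(2)] a M N by (simp add: minus z)
      show "r \<odot>\<^bsub>M\<^esub> a \<in> {a \<in> carrier M. Pair a \<zero>\<^bsub>N\<^esub> \<in> K}" if "r \<in> carrier R" using Ksm[OF that a(2)] a M N that by (simp add: mod_smult)
      show "a \<oplus>\<^bsub>M\<^esub> b \<in> {a \<in> carrier M. Pair a \<zero>\<^bsub>N\<^esub> \<in> K}" if "b \<in> {a \<in> carrier M. Pair a \<zero>\<^bsub>N\<^esub> \<in> K}"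
        using Kadd[OF a(2), of "Pair b \<zero>\<^bsub>N\<^esub>"] a M N that by simp
    qed (use zK M in auto)
    then have 1: "{a \<in> carrier M. Pair a \<zero>\<^bsub>N\<^esub> \<in> K} = carrier M"
      by (rule A(3)) (use A(2) K(2) C_def in auto)
    have "submodule {a \<in> carrier N. Pair \<zero>\<^bsub>M\<^esub> a \<in> K} R N"
    proof (rule module.submoduleI[OF N(1)])
      fix a b r assume "a \<in> {a \<in> carrier N. Pair \<zero>\<^bsub>M\<^esub> a \<in> K}"
      then have a: "a \<in> carrier N" "Pair \<zero>\<^bsub>M\<^esub> a \<in> K" by auto
      show "\<ominus>\<^bsub>N\<^esub> a \<in> {a \<in> carrier N. Pair \<zero>\<^bsub>M\<^esub> a \<in> K}" using Kinv[OF a(2)] a M N by (simp add: minus z)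
      show "r \<odot>\<^bsub>N\<^esub> a \<in> {a \<in> carrier N. Pair \<zero>\<^bsub>M\<^esub> a \<in> K}" if "r \<in> carrier R" using Ksm[OF that a(2)] a M N that by (simp add: mod_smult)
      show "a \<oplus>\<^bsub>N\<^esub> b \<in> {a \<in> carrier N. Pair \<zero>\<^bsub>M\<^esub> a \<in> K}" if "b \<in> {a \<in> carrier N. Pair \<zero>\<^bsub>M\<^esub> a \<in> K}"
        using Kadd[OF a(2), of "Pair \<zero>\<^bsub>M\<^esub> b"] a M N that by simp
    qed (use zK N in auto)
    then have 2: "{a \<in> carrier N. Pair \<zero>\<^bsub>M\<^esub> a \<in> K} = carrier N"
      by (rule B(3)) (use B(2) K(2) C_def in auto)
    have "Pair a b \<in> K" if "a \<in> carrier M" "b \<in> carrier N" for a b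
      using Kadd[of "Pair a \<zero>\<^bsub>N\<^esub>" "Pair \<zero>\<^bsub>M\<^esub> b"] 1 2 that M N by auto
    then show ?thesis using sm(1) by auto
  qed
  moreover have "finite C" "C \<subseteq> carrier (dir_sum M N)" using A B M N by (auto simp: C_def)
  ultimately show ?thesis unfolding fin_gen_def by blast
qed

text \<open>
  Degrees of complexes are brought into the form in which the definitions state them.
\<close>

lemma index_simps [simp]: "1 + (i::int) = i + 1" "2 + (i::int) = i + 2" "3 + (i::int) = i + 3"
  by (rule add.commute)+

abbreviation "Cx \<equiv> bounded_cplxs R"
abbreviation "Ch \<equiv> chain_maps R"

lemma cplx_module [simp]: "X \<in> Cx \<Longrightarrow> module R (Mdl X i)"
  unfolding bounded_cplxs_def by blast

lemma cplx_dif_lin: "X \<in> Cx \<Longrightarrow> Dif X i \<in> lin_maps R (Mdl X i) (Mdl X (i + 1))"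
  unfolding bounded_cplxs_def by blast

lemma cplx_dif_dif: "X \<in> Cx \<Longrightarrow> m \<in> carrier (Mdl X i) \<Longrightarrow> Dif X (i + 1) (Dif X i m) = \<zero>\<^bsub>Mdl X (i + 2)\<^esub>"
  unfolding bounded_cplxs_def by blast

text \<open>
  The equation for \<open>j\<close> makes the rules applicable however the degree of the target happens to be written.
\<close>

lemma cplx_simps [simp]:
  assumes "X \<in> Cx"
  shows "m \<in> carrier (Mdl X i) \<Longrightarrow> j = i + 1 \<Longrightarrow> Dif X i m \<in> carrier (Mdl X j)"
    "m \<in> carrier (Mdl X i) \<Longrightarrow> n \<in> carrier (Mdl X i) \<Longrightarrow> Dif X i (m \<oplus>\<^bsub>Mdl X i\<^esub> n) = Dif X i m \<oplus>\<^bsub>Mdl X (i + 1)\<^esub> Dif X i n"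
    "m \<in> carrier (Mdl X i) \<Longrightarrow> n \<in> carrier (Mdl X i) \<Longrightarrow> Dif X i (m \<ominus>\<^bsub>Mdl X i\<^esub> n) = Dif X i m \<ominus>\<^bsub>Mdl X (i + 1)\<^esub> Dif X i n"
    "r \<in> carrier R \<Longrightarrow> m \<in> carrier (Mdl X i) \<Longrightarrow> Dif X i (r \<odot>\<^bsub>Mdl X i\<^esub> m) = r \<odot>\<^bsub>Mdl X (i + 1)\<^esub> Dif X i m"
    "Dif X i \<zero>\<^bsub>Mdl X i\<^esub> = \<zero>\<^bsub>Mdl X (i + 1)\<^esub>"
    "m \<in> carrier (Mdl X i) \<Longrightarrow> j = i + 1 \<Longrightarrow> Dif X j (Dif X i m) = \<zero>\<^bsub>Mdl X (i + 2)\<^esub>"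
  using lin_mapD[OF cplx_dif_lin[OF assms, of i]] lin_map_diff[OF cplx_dif_lin[OF assms, of i] cplx_module[OF assms] cplx_module[OF assms]]
     cplx_dif_dif[OF assms] by blast+

lemma cplxI:
  assumes "\<And>i. module R (Mdl X i)" "\<And>i. fin_gen R (Mdl X i)"
    "\<And>i m. m \<in> carrier (Mdl X i) \<Longrightarrow> Dif X i m \<in> carrier (Mdl X (i + 1))"
    "\<And>i m n. m \<in> carrier (Mdl X i) \<Longrightarrow> n \<in> carrier (Mdl X i) \<Longrightarrow> Dif X i (m \<oplus>\<^bsub>Mdl X i\<^esub> n) = Dif X i m \<oplus>\<^bsub>Mdl X (i + 1)\<^esub> Dif X i n"
    "\<And>i m r. r \<in> carrier R \<Longrightarrow> m \<in> carrier (Mdl X i) \<Longrightarrow> Dif X i (r \<odot>\<^bsub>Mdl X i\<^esub> m) = r \<odot>\<^bsub>Mdl X (i + 1)\<^esub> Dif X i m"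
    "\<And>i m. m \<in> carrier (Mdl X i) \<Longrightarrow> Dif X (i + 1) (Dif X i m) = \<zero>\<^bsub>Mdl X (i + 2)\<^esub>"
    "finite {i. carrier (Mdl X i) \<noteq> {\<zero>\<^bsub>Mdl X i\<^esub>}}"
  shows "X \<in> Cx"
  unfolding bounded_cplxs_def using assms lin_mapI[of "Mdl X i" "Dif X i" "Mdl X (i + 1)" for i] by auto

lemma cplx_fin_gen: "X \<in> Cx \<Longrightarrow> fin_gen R (Mdl X i)"
  and cplx_finite: "X \<in> Cx \<Longrightarrow> finite {i. carrier (Mdl X i) \<noteq> {\<zero>\<^bsub>Mdl X i\<^esub>}}"
  unfolding bounded_cplxs_def by blast+

lemma finite_reindex: "finite {i. P i} \<Longrightarrow> finite {i. P (i + (k::int))}"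
  by (rule finite_imageD[of "\<lambda>i. i + k"]) (auto elim: finite_subset[rotated] intro: inj_onI)

lemma shift_cplx_simps [simp]:
  "Mdl (shift_cplx X) i = Mdl X (i + 1)"
  "Dif (shift_cplx X) i m = \<ominus>\<^bsub>Mdl X (i + 2)\<^esub> Dif X (i + 1) m"
  by (simp_all add: shift_cplx_def)

lemma shift_cplx [simp]: "X \<in> Cx \<Longrightarrow> shift_cplx X \<in> Cx"
  by (rule cplxI) (simp_all add: mod_simps cplx_fin_gen finite_reindex[OF cplx_finite])

lemma cone_simps [simp]:
  "Mdl (cone X Y f) i = dir_sum (Mdl X (i + 1)) (Mdl Y i)"
  "Dif (cone X Y f) i (Pair a b) = Pair (\<ominus>\<^bsub>Mdl X (i + 2)\<^esub> Dif X (i + 1) a) (f (i + 1) a \<oplus>\<^bsub>Mdl Y (i + 1)\<^esub> Dif Y i b)"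
  by (simp_all add: cone_def)

lemma chain_map_lin: "f \<in> Ch X Y \<Longrightarrow> f i \<in> lin_maps R (Mdl X i) (Mdl Y i)"
  unfolding chain_maps_def by blast

lemma chain_map_dif: "f \<in> Ch X Y \<Longrightarrow> m \<in> carrier (Mdl X i) \<Longrightarrow> f (i + 1) (Dif X i m) = Dif Y i (f i m)"
  unfolding chain_maps_def by blast

lemma chain_map_simps:
  assumes "f \<in> Ch X Y" "X \<in> Cx" "Y \<in> Cx"
  shows "m \<in> carrier (Mdl X i) \<Longrightarrow> f i m \<in> carrier (Mdl Y i)"
    "m \<in> carrier (Mdl X i) \<Longrightarrow> n \<in> carrier (Mdl X i) \<Longrightarrow> f i (m \<oplus>\<^bsub>Mdl X i\<^esub> n) = f i m \<oplus>\<^bsub>Mdl Y i\<^esub> f i n"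
    "m \<in> carrier (Mdl X i) \<Longrightarrow> n \<in> carrier (Mdl X i) \<Longrightarrow> f i (m \<ominus>\<^bsub>Mdl X i\<^esub> n) = f i m \<ominus>\<^bsub>Mdl Y i\<^esub> f i n"
    "r \<in> carrier R \<Longrightarrow> m \<in> carrier (Mdl X i) \<Longrightarrow> f i (r \<odot>\<^bsub>Mdl X i\<^esub> m) = r \<odot>\<^bsub>Mdl Y i\<^esub> f i m"
    "f i \<zero>\<^bsub>Mdl X i\<^esub> = \<zero>\<^bsub>Mdl Y i\<^esub>"
    "m \<in> carrier (Mdl X i) \<Longrightarrow> j = i + 1 \<Longrightarrow> f j (Dif X i m) = Dif Y i (f i m)"
  using lin_mapD[OF chain_map_lin[OF assms(1), of i]] lin_map_diff[OF chain_map_lin[OF assms(1), of i] cplx_module[OF assms(2)] cplx_module[OF assms(3)]]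
    chain_map_dif[OF assms(1)] by blast+

lemma chain_mapI:
  assumes "\<And>i m. m \<in> carrier (Mdl X i) \<Longrightarrow> f i m \<in> carrier (Mdl Y i)"
    "\<And>i m n. m \<in> carrier (Mdl X i) \<Longrightarrow> n \<in> carrier (Mdl X i) \<Longrightarrow> f i (m \<oplus>\<^bsub>Mdl X i\<^esub> n) = f i m \<oplus>\<^bsub>Mdl Y i\<^esub> f i n"
    "\<And>i m r. r \<in> carrier R \<Longrightarrow> m \<in> carrier (Mdl X i) \<Longrightarrow> f i (r \<odot>\<^bsub>Mdl X i\<^esub> m) = r \<odot>\<^bsub>Mdl Y i\<^esub> f i m"
    "\<And>i m. m \<in> carrier (Mdl X i) \<Longrightarrow> f (i + 1) (Dif X i m) = Dif Y i (f i m)"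
  shows "f \<in> Ch X Y"
  unfolding chain_maps_def using assms lin_mapI[of "Mdl X i" "f i" "Mdl Y i" for i] by auto

text \<open>
  Families of degree \<open>-1\<close>, the carriers of homotopies.
\<close>

definition graded_map where
  "graded_map X Y h \<longleftrightarrow> (\<forall>i. h i \<in> lin_maps R (Mdl X i) (Mdl Y (i - 1)))"

lemma graded_map_simps:
  assumes "graded_map X Y h" "X \<in> Cx" "Y \<in> Cx"
  shows "m \<in> carrier (Mdl X i) \<Longrightarrow> j = i - 1 \<Longrightarrow> h i m \<in> carrier (Mdl Y j)"
    "m \<in> carrier (Mdl X i) \<Longrightarrow> n \<in> carrier (Mdl X i) \<Longrightarrow> h i (m \<oplus>\<^bsub>Mdl X i\<^esub> n) = h i m \<oplus>\<^bsub>Mdl Y (i - 1)\<^esub> h i n"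
    "m \<in> carrier (Mdl X i) \<Longrightarrow> n \<in> carrier (Mdl X i) \<Longrightarrow> h i (m \<ominus>\<^bsub>Mdl X i\<^esub> n) = h i m \<ominus>\<^bsub>Mdl Y (i - 1)\<^esub> h i n"
    "r \<in> carrier R \<Longrightarrow> m \<in> carrier (Mdl X i) \<Longrightarrow> h i (r \<odot>\<^bsub>Mdl X i\<^esub> m) = r \<odot>\<^bsub>Mdl Y (i - 1)\<^esub> h i m"
    "h i \<zero>\<^bsub>Mdl X i\<^esub> = \<zero>\<^bsub>Mdl Y (i - 1)\<^esub>"
proof -
  have h: "h i \<in> lin_maps R (Mdl X i) (Mdl Y (i - 1))" using assms(1) by (simp add: graded_map_def)
  note hs = lin_mapD[OF h] lin_map_diff[OF h cplx_module[OF assms(2)] cplx_module[OF assms(3)]]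
  show "m \<in> carrier (Mdl X i) \<Longrightarrow> j = i - 1 \<Longrightarrow> h i m \<in> carrier (Mdl Y j)"
    "m \<in> carrier (Mdl X i) \<Longrightarrow> n \<in> carrier (Mdl X i) \<Longrightarrow> h i (m \<oplus>\<^bsub>Mdl X i\<^esub> n) = h i m \<oplus>\<^bsub>Mdl Y (i - 1)\<^esub> h i n"
    "m \<in> carrier (Mdl X i) \<Longrightarrow> n \<in> carrier (Mdl X i) \<Longrightarrow> h i (m \<ominus>\<^bsub>Mdl X i\<^esub> n) = h i m \<ominus>\<^bsub>Mdl Y (i - 1)\<^esub> h i n"
    "r \<in> carrier R \<Longrightarrow> m \<in> carrier (Mdl X i) \<Longrightarrow> h i (r \<odot>\<^bsub>Mdl X i\<^esub> m) = r \<odot>\<^bsub>Mdl Y (i - 1)\<^esub> h i m"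
    "h i \<zero>\<^bsub>Mdl X i\<^esub> = \<zero>\<^bsub>Mdl Y (i - 1)\<^esub>"
    using hs by blast+
qed

lemma graded_mapI:
  assumes "\<And>i m. m \<in> carrier (Mdl X i) \<Longrightarrow> h i m \<in> carrier (Mdl Y (i - 1))"
    "\<And>i m n. m \<in> carrier (Mdl X i) \<Longrightarrow> n \<in> carrier (Mdl X i) \<Longrightarrow> h i (m \<oplus>\<^bsub>Mdl X i\<^esub> n) = h i m \<oplus>\<^bsub>Mdl Y (i - 1)\<^esub> h i n"
    "\<And>i m r. r \<in> carrier R \<Longrightarrow> m \<in> carrier (Mdl X i) \<Longrightarrow> h i (r \<odot>\<^bsub>Mdl X i\<^esub> m) = r \<odot>\<^bsub>Mdl Y (i - 1)\<^esub> h i m"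
  shows "graded_map X Y h"
  unfolding graded_map_def using assms lin_mapI[of "Mdl X i" "h i" "Mdl Y (i - 1)" for i] by auto

lemma homotopicI:
  assumes "graded_map X Y h"
   "\<And>i m. m \<in> carrier (Mdl X i) \<Longrightarrow> f i m = g i m \<oplus>\<^bsub>Mdl Y i\<^esub>
             (Dif Y (i - 1) (h i m) \<oplus>\<^bsub>Mdl Y i\<^esub> h (i + 1) (Dif X i m))"
  shows "homotopic R X Y f g"
  using assms unfolding homotopic_def graded_map_def by blast

lemma homotopicE:
  assumes "homotopic R X Y f g"
  obtains h where "graded_map X Y h"
   "\<forall>i. \<forall>m\<in>carrier (Mdl X i). f i m = g i m \<oplus>\<^bsub>Mdl Y i\<^esub>
             (Dif Y (i - 1) (h i m) \<oplus>\<^bsub>Mdl Y i\<^esub> h (i + 1) (Dif X i m))"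
  using assms unfolding homotopic_def graded_map_def by blast

lemma cone_cplx [simp]:
  assumes X: "X \<in> Cx" and Y: "Y \<in> Cx" and f: "f \<in> Ch X Y"
  shows "cone X Y f \<in> Cx"
proof (rule cplxI)
  note fs = chain_map_simps[OF f X Y]
  show "finite {i. carrier (Mdl (cone X Y f) i) \<noteq> {\<zero>\<^bsub>Mdl (cone X Y f) i\<^esub>}}"
    by (rule finite_subset[OF _ finite_UnI[OF finite_reindex[OF cplx_finite[OF X], of 1] cplx_finite[OF Y]]])
      (use X Y in \<open>auto simp: set_eq_iff\<close>)
qed (use X Y f in \<open>auto simp: mod_simps cplx_fin_gen chain_map_simps[OF f X Y] intro: dir_sum_fin_gen\<close>)

lemma homotopic_refl: assumes "X \<in> Cx" "Y \<in> Cx" "f \<in> Ch X Y" shows "homotopic R X Y f f"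
  by (rule homotopicI[of _ _ "\<lambda>i m. \<zero>\<^bsub>Mdl Y (i - 1)\<^esub>"])
    (use assms in \<open>auto simp: mod_simps chain_map_simps[OF assms(3,1,2)] intro!: graded_mapI\<close>)

lemma homotopic_sym:
  assumes X: "X \<in> Cx" and Y: "Y \<in> Cx" and f: "f \<in> Ch X Y" and g: "g \<in> Ch X Y"
    and h: "homotopic R X Y f g"
  shows "homotopic R X Y g f"
proof -
  obtain k where k: "graded_map X Y k" and e0: "\<forall>i. \<forall>m\<in>carrier (Mdl X i). f i m = g i m \<oplus>\<^bsub>Mdl Y i\<^esub>
             (Dif Y (i - 1) (k i m) \<oplus>\<^bsub>Mdl Y i\<^esub> k (i + 1) (Dif X i m))" using h by (rule homotopicE)
  note e = e0[rule_format]
  note s = chain_map_simps[OF f X Y] chain_map_simps[OF g X Y] graded_map_simps[OF k X Y]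
  show ?thesis
    by (rule homotopicI[of _ _ "\<lambda>i m. \<zero>\<^bsub>Mdl Y (i - 1)\<^esub> \<ominus>\<^bsub>Mdl Y (i - 1)\<^esub> k i m"])
     (use X Y in \<open>auto simp: mod_simps s e intro!: graded_mapI\<close>)
qed

lemma homotopic_trans:
  assumes X: "X \<in> Cx" and Y: "Y \<in> Cx" and f: "f \<in> Ch X Y" and g: "g \<in> Ch X Y" and f': "f' \<in> Ch X Y"
    and h: "homotopic R X Y f g" "homotopic R X Y g f'"
  shows "homotopic R X Y f f'"
proof -
  obtain k where k: "graded_map X Y k" and e0: "\<forall>i. \<forall>m\<in>carrier (Mdl X i). f i m = g i m \<oplus>\<^bsub>Mdl Y i\<^esub>
             (Dif Y (i - 1) (k i m) \<oplus>\<^bsub>Mdl Y i\<^esub> k (i + 1) (Dif X i m))" using h(1) by (rule homotopicE)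
  note e = e0[rule_format]
  obtain l where l: "graded_map X Y l" and e'0: "\<forall>i. \<forall>m\<in>carrier (Mdl X i). g i m = f' i m \<oplus>\<^bsub>Mdl Y i\<^esub>
             (Dif Y (i - 1) (l i m) \<oplus>\<^bsub>Mdl Y i\<^esub> l (i + 1) (Dif X i m))" using h(2) by (rule homotopicE)
  note e' = e'0[rule_format]
  note s = chain_map_simps[OF f' X Y] graded_map_simps[OF k X Y] graded_map_simps[OF l X Y]
  show ?thesis
    by (rule homotopicI[of _ _ "\<lambda>i m. k i m \<oplus>\<^bsub>Mdl Y (i - 1)\<^esub> l i m"])
     (use X Y in \<open>auto simp: mod_simps s e e' intro!: graded_mapI\<close>)
qed

lemma chain_map_comp:
  assumes "X \<in> Cx" "Y \<in> Cx" "Z \<in> Cx" "f \<in> Ch X Y" "g \<in> Ch Y Z"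
  shows "(\<lambda>i m. g i (f i m)) \<in> Ch X Z"
  by (rule chain_mapI) (use assms in \<open>auto simp: chain_map_simps[OF assms(4,1,2)] chain_map_simps[OF assms(5,2,3)]\<close>)

lemma homotopic_comp:
  assumes X: "X \<in> Cx" and Y: "Y \<in> Cx" and Z: "Z \<in> Cx" and f: "f \<in> Ch X Y" "f' \<in> Ch X Y" and g: "g \<in> Ch Y Z" "g' \<in> Ch Y Z"
    and h: "homotopic R X Y f f'" "homotopic R Y Z g g'"
  shows "homotopic R X Z (\<lambda>i m. g i (f i m)) (\<lambda>i m. g' i (f' i m))"
proof -
  obtain k where k: "graded_map X Y k" and e0: "\<forall>i. \<forall>m\<in>carrier (Mdl X i). f i m = f' i m \<oplus>\<^bsub>Mdl Y i\<^esub>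
             (Dif Y (i - 1) (k i m) \<oplus>\<^bsub>Mdl Y i\<^esub> k (i + 1) (Dif X i m))" using h(1) by (rule homotopicE)
  note e = e0[rule_format]
  obtain l where l: "graded_map Y Z l" and e'0: "\<forall>i. \<forall>m\<in>carrier (Mdl Y i). g i m = g' i m \<oplus>\<^bsub>Mdl Z i\<^esub>
             (Dif Z (i - 1) (l i m) \<oplus>\<^bsub>Mdl Z i\<^esub> l (i + 1) (Dif Y i m))" using h(2) by (rule homotopicE)
  note e' = e'0[rule_format]
  note s = chain_map_simps[OF f(1) X Y] chain_map_simps[OF f(2) X Y]
    chain_map_simps[OF g(1) Y Z] chain_map_simps[OF g(2) Y Z] graded_map_simps[OF k X Y] graded_map_simps[OF l Y Z]
  have e2: "g' i (f i m) = g' i (f' i m) \<oplus>\<^bsub>Mdl Z i\<^esub>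
             (Dif Z (i - 1) (g' (i - 1) (k i m)) \<oplus>\<^bsub>Mdl Z i\<^esub> g' i (k (i + 1) (Dif X i m)))" if "m \<in> carrier (Mdl X i)" for i m
  proof -
    have "g' i (Dif Y (i - 1) (k i m)) = Dif Z (i - 1) (g' (i - 1) (k i m))" using that X Y s by (intro s) simp_all
    then show ?thesis using X Y Z that unfolding e[OF that] by (simp add: s)
  qed
  show ?thesis
    by (rule homotopicI[of _ _ "\<lambda>i m. g' (i - 1) (k i m) \<oplus>\<^bsub>Mdl Z (i - 1)\<^esub> l i (f i m)"])
     (use X Y Z in \<open>auto simp: mod_simps s e' e2 intro!: graded_mapI\<close>)
qed

lemma chain_map_plus:
  assumes "X \<in> Cx" "Y \<in> Cx" "f \<in> Ch X Y" "g \<in> Ch X Y"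
  shows "(\<lambda>i m. f i m \<oplus>\<^bsub>Mdl Y i\<^esub> g i m) \<in> Ch X Y"
  by (rule chain_mapI) (use assms in \<open>auto simp: mod_simps chain_map_simps[OF assms(3,1,2)] chain_map_simps[OF assms(4,1,2)]\<close>)

lemma homotopic_plus:
  assumes X: "X \<in> Cx" and Y: "Y \<in> Cx" and f: "f \<in> Ch X Y" "f' \<in> Ch X Y" and g: "g \<in> Ch X Y" "g' \<in> Ch X Y"
    and h: "homotopic R X Y f f'" "homotopic R X Y g g'"
  shows "homotopic R X Y (\<lambda>i m. f i m \<oplus>\<^bsub>Mdl Y i\<^esub> g i m) (\<lambda>i m. f' i m \<oplus>\<^bsub>Mdl Y i\<^esub> g' i m)"
proof -
  obtain k where k: "graded_map X Y k" and e0: "\<forall>i. \<forall>m\<in>carrier (Mdl X i). f i m = f' i m \<oplus>\<^bsub>Mdl Y i\<^esub>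
             (Dif Y (i - 1) (k i m) \<oplus>\<^bsub>Mdl Y i\<^esub> k (i + 1) (Dif X i m))" using h(1) by (rule homotopicE)
  note e = e0[rule_format]
  obtain l where l: "graded_map X Y l" and e'0: "\<forall>i. \<forall>m\<in>carrier (Mdl X i). g i m = g' i m \<oplus>\<^bsub>Mdl Y i\<^esub>
             (Dif Y (i - 1) (l i m) \<oplus>\<^bsub>Mdl Y i\<^esub> l (i + 1) (Dif X i m))" using h(2) by (rule homotopicE)
  note e' = e'0[rule_format]
  note s = chain_map_simps[OF f(2) X Y] chain_map_simps[OF g(2) X Y] graded_map_simps[OF k X Y] graded_map_simps[OF l X Y]
  show ?thesis
    by (rule homotopicI[of _ _ "\<lambda>i m. k i m \<oplus>\<^bsub>Mdl Y (i - 1)\<^esub> l i m"])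
     (use X Y in \<open>auto simp: mod_simps s e e' intro!: graded_mapI\<close>)
qed

lemma chain_map_scale:
  assumes "X \<in> Cx" "Y \<in> Cx" "f \<in> Ch X Y" "r \<in> carrier R"
  shows "(\<lambda>i m. r \<odot>\<^bsub>Mdl Y i\<^esub> f i m) \<in> Ch X Y"
  by (rule chain_mapI) (use assms in \<open>auto simp: mod_simps chain_map_simps[OF assms(3,1,2)] m_comm simp flip: mod_smult_two\<close>)

lemma homotopic_scale:
  assumes X: "X \<in> Cx" and Y: "Y \<in> Cx" and f: "f \<in> Ch X Y" "f' \<in> Ch X Y" and r: "r \<in> carrier R"
    and h: "homotopic R X Y f f'"
  shows "homotopic R X Y (\<lambda>i m. r \<odot>\<^bsub>Mdl Y i\<^esub> f i m) (\<lambda>i m. r \<odot>\<^bsub>Mdl Y i\<^esub> f' i m)"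
proof -
  obtain k where k: "graded_map X Y k" and e0: "\<forall>i. \<forall>m\<in>carrier (Mdl X i). f i m = f' i m \<oplus>\<^bsub>Mdl Y i\<^esub>
             (Dif Y (i - 1) (k i m) \<oplus>\<^bsub>Mdl Y i\<^esub> k (i + 1) (Dif X i m))" using h by (rule homotopicE)
  note e = e0[rule_format]
  note s = chain_map_simps[OF f(2) X Y] graded_map_simps[OF k X Y]
  have 1: "graded_map X Y (\<lambda>i m. r \<odot>\<^bsub>Mdl Y (i - 1)\<^esub> k i m)"
    by (rule graded_mapI) (use X Y r in \<open>auto simp: mod_simps s m_comm simp flip: mod_smult_two\<close>)
  show ?thesis
    by (rule homotopicI[OF 1]) (use X Y r in \<open>auto simp: mod_simps s e\<close>)
qed

lemma chain_map_shift:
  assumes "X \<in> Cx" "Y \<in> Cx" "f \<in> Ch X Y"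
  shows "(\<lambda>i. f (i + 1)) \<in> Ch (shift_cplx X) (shift_cplx Y)"
  by (rule chain_mapI) (use assms in \<open>auto simp: mod_simps chain_map_simps[OF assms(3,1,2)]\<close>)

lemma homotopic_shift:
  assumes X: "X \<in> Cx" and Y: "Y \<in> Cx" and f: "f \<in> Ch X Y" "f' \<in> Ch X Y"
    and h: "homotopic R X Y f f'"
  shows "homotopic R (shift_cplx X) (shift_cplx Y) (\<lambda>i. f (i + 1)) (\<lambda>i. f' (i + 1))"
proof -
  obtain k where k: "graded_map X Y k" and e0: "\<forall>i. \<forall>m\<in>carrier (Mdl X i). f i m = f' i m \<oplus>\<^bsub>Mdl Y i\<^esub>
             (Dif Y (i - 1) (k i m) \<oplus>\<^bsub>Mdl Y i\<^esub> k (i + 1) (Dif X i m))" using h by (rule homotopicE)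
  note e = e0[rule_format]
  note s = chain_map_simps[OF f(2) X Y] graded_map_simps[OF k X Y]
  show ?thesis
    by (rule homotopicI[of _ _ "\<lambda>i m. \<zero>\<^bsub>Mdl Y i\<^esub> \<ominus>\<^bsub>Mdl Y i\<^esub> k (i + 1) m"])
     (use X Y in \<open>auto simp: mod_simps s e intro!: graded_mapI\<close>)
qed

section \<open>The homotopy category as a linear category\<close>

abbreviation "K \<equiv> Kb R"

lemma homotopy_class_iff: "g \<in> homotopy_class R X Y f \<longleftrightarrow> g \<in> Ch X Y \<and> homotopic R X Y f g"
  by (simp add: homotopy_class_def)

lemma homotopy_class_eq_iff:
  assumes "X \<in> Cx" "Y \<in> Cx" "f \<in> Ch X Y" "g \<in> Ch X Y"
  shows "homotopy_class R X Y f = homotopy_class R X Y g \<longleftrightarrow> homotopic R X Y f g"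
proof
  assume "homotopy_class R X Y f = homotopy_class R X Y g"
  moreover have "g \<in> homotopy_class R X Y g" using assms by (simp add: homotopy_class_iff homotopic_refl)
  ultimately show "homotopic R X Y f g" using homotopy_class_iff by blast
next
  assume h: "homotopic R X Y f g"
  show "homotopy_class R X Y f = homotopy_class R X Y g"
    unfolding homotopy_class_def
    using homotopic_trans[OF assms(1-4) _ h] homotopic_trans[OF assms(1,2,4,3) _ homotopic_sym[OF assms h]] by blast
qed

lemma karr_eq_iff:
  assumes "X \<in> Cx" "Y \<in> Cx" "f \<in> Ch X Y" "g \<in> Ch X Y"
  shows "karr R X Y f = karr R X Y g \<longleftrightarrow> homotopic R X Y f g"
  using homotopy_class_eq_iff[OF assms] by (simp add: karr_def)

lemma karr_cong:
  assumes "\<And>i m. m \<in> carrier (Mdl X i) \<Longrightarrow> f i m = g i m"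
  shows "karr R X Y f = karr R X Y g"
proof -
  have "homotopic R X Y f h \<longleftrightarrow> homotopic R X Y g h" for h
    unfolding homotopic_def using assms by simp
  then show ?thesis by (simp add: karr_def homotopy_class_def)
qed

lemma K_obj [simp]: "Obj K = Cx" and K_sh_obj [simp]: "ShObj K = shift_cplx"
  by (simp_all add: Kb_def homotopy_category_def)

lemma K_dom [simp]: "Dom K (karr R X Y f) = X" and K_cod [simp]: "Cod K (karr R X Y f) = Y"
  by (simp_all add: Kb_def homotopy_category_def karr_def)

lemma K_arr [simp]: "X \<in> Cx \<Longrightarrow> Y \<in> Cx \<Longrightarrow> f \<in> Ch X Y \<Longrightarrow> karr R X Y f \<in> Arr K"
  unfolding Kb_def homotopy_category_def by auto

lemma K_arrE:
  assumes "a \<in> Arr K"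
  obtains X Y f where "X \<in> Cx" "Y \<in> Cx" "f \<in> Ch X Y" "a = karr R X Y f"
  using assms unfolding Kb_def homotopy_category_def by auto

lemma K_arr_objE:
  assumes "a \<in> Arr K" "Dom K a = X" "Cod K a = Y"
  obtains f where "X \<in> Cx" "Y \<in> Cx" "f \<in> Ch X Y" "a = karr R X Y f"
  using assms by (elim K_arrE) auto

lemma K_ident: "Ident K X = karr R X X (\<lambda>i m. m)"
  and K_zero: "Zero K X Y = karr R X Y (\<lambda>i m. \<zero>\<^bsub>Mdl Y i\<^esub>)"
  by (simp_all add: Kb_def homotopy_category_def)

lemma class_self: "X \<in> Cx \<Longrightarrow> Y \<in> Cx \<Longrightarrow> f \<in> Ch X Y \<Longrightarrow> f \<in> homotopy_class R X Y f"
  by (simp add: homotopy_class_iff homotopic_refl)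

text \<open>
  The operations of the homotopy category are unions over representatives; they are evaluated by showing that every
  choice of representatives contributes the same class.
\<close>

lemma K_comp:
  assumes o: "X \<in> Cx" "Y \<in> Cx" "Z \<in> Cx" and f: "f \<in> Ch X Y" and g: "g \<in> Ch Y Z"
  shows "karr R Y Z g \<cdot>\<^bsub>K\<^esub> karr R X Y f = karr R X Z (\<lambda>i m. g i (f i m))"
proof -
  have "\<Union>{homotopy_class R X Z (\<lambda>i m. g' i (f' i m)) |f' g'. f' \<in> homotopy_class R X Y f \<and> g' \<in> homotopy_class R Y Z g}
     = homotopy_class R X Z (\<lambda>i m. g i (f i m))" (is "\<Union>?A = ?B")
  proof (rule Union_constant)
    show "?A \<noteq> {}" using class_self[OF o(1,2) f] class_self[OF o(2,3) g] by blast
    fix C assume "C \<in> ?A"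
    then obtain f' g' where C: "C = homotopy_class R X Z (\<lambda>i m. g' i (f' i m))" "f' \<in> Ch X Y" "homotopic R X Y f f'"
      "g' \<in> Ch Y Z" "homotopic R Y Z g g'" unfolding homotopy_class_iff by blast
    show "C = ?B" unfolding C(1)
      using homotopy_class_eq_iff[OF o(1,3) chain_map_comp[OF o f g] chain_map_comp[OF o C(2,4)]]
        homotopic_comp[OF o f C(2) g C(4,3,5)] by simp
  qed
  then show ?thesis by (simp add: Kb_def homotopy_category_def karr_def)
qed

lemma K_plus:
  assumes o: "X \<in> Cx" "Y \<in> Cx" and f: "f \<in> Ch X Y" and g: "g \<in> Ch X Y"
  shows "Plus K (karr R X Y f) (karr R X Y g) = karr R X Y (\<lambda>i m. f i m \<oplus>\<^bsub>Mdl Y i\<^esub> g i m)"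
proof -
  have "\<Union>{homotopy_class R X Y (\<lambda>i m. f' i m \<oplus>\<^bsub>Mdl Y i\<^esub> g' i m) |f' g'. f' \<in> homotopy_class R X Y f \<and> g' \<in> homotopy_class R X Y g}
     = homotopy_class R X Y (\<lambda>i m. f i m \<oplus>\<^bsub>Mdl Y i\<^esub> g i m)" (is "\<Union>?A = ?B")
  proof (rule Union_constant)
    show "?A \<noteq> {}" using class_self[OF o f] class_self[OF o g] by blast
    fix C assume "C \<in> ?A"
    then obtain f' g' where C: "C = homotopy_class R X Y (\<lambda>i m. f' i m \<oplus>\<^bsub>Mdl Y i\<^esub> g' i m)" "f' \<in> Ch X Y" "homotopic R X Y f f'"
      "g' \<in> Ch X Y" "homotopic R X Y g g'" unfolding homotopy_class_iff by blast
    show "C = ?B" unfolding C(1)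
      using homotopy_class_eq_iff[OF o chain_map_plus[OF o f g] chain_map_plus[OF o C(2,4)]]
        homotopic_plus[OF o f C(2) g C(4,3,5)] by simp
  qed
  then show ?thesis by (simp add: Kb_def homotopy_category_def karr_def)
qed

lemma K_scale:
  assumes o: "X \<in> Cx" "Y \<in> Cx" and f: "f \<in> Ch X Y" and r: "r \<in> carrier R"
  shows "Scale K r (karr R X Y f) = karr R X Y (\<lambda>i m. r \<odot>\<^bsub>Mdl Y i\<^esub> f i m)"
proof -
  have "\<Union>{homotopy_class R X Y (\<lambda>i m. r \<odot>\<^bsub>Mdl Y i\<^esub> f' i m) |f'. f' \<in> homotopy_class R X Y f}
     = homotopy_class R X Y (\<lambda>i m. r \<odot>\<^bsub>Mdl Y i\<^esub> f i m)" (is "\<Union>?A = ?B")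
  proof (rule Union_constant)
    show "?A \<noteq> {}" using class_self[OF o f] by blast
    fix C assume "C \<in> ?A"
    then obtain f' where C: "C = homotopy_class R X Y (\<lambda>i m. r \<odot>\<^bsub>Mdl Y i\<^esub> f' i m)" "f' \<in> Ch X Y" "homotopic R X Y f f'"
      unfolding homotopy_class_iff by blast
    show "C = ?B" unfolding C(1)
      using homotopy_class_eq_iff[OF o chain_map_scale[OF o f r] chain_map_scale[OF o C(2) r]]
        homotopic_scale[OF o f C(2) r C(3)] by simp
  qed
  then show ?thesis by (simp add: Kb_def homotopy_category_def karr_def)
qed

lemma K_sh:
  assumes o: "X \<in> Cx" "Y \<in> Cx" and f: "f \<in> Ch X Y"
  shows "ShArr K (karr R X Y f) = karr R (shift_cplx X) (shift_cplx Y) (\<lambda>i. f (i + 1))"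
proof -
  note so = shift_cplx[OF o(1)] shift_cplx[OF o(2)]
  have "\<Union>{homotopy_class R (shift_cplx X) (shift_cplx Y) (\<lambda>i. f' (i + 1)) |f'. f' \<in> homotopy_class R X Y f}
     = homotopy_class R (shift_cplx X) (shift_cplx Y) (\<lambda>i. f (i + 1))" (is "\<Union>?A = ?B")
  proof (rule Union_constant)
    show "?A \<noteq> {}" using class_self[OF o f] by blast
    fix C assume "C \<in> ?A"
    then obtain f' where C: "C = homotopy_class R (shift_cplx X) (shift_cplx Y) (\<lambda>i. f' (i + 1))" "f' \<in> Ch X Y" "homotopic R X Y f f'"
      unfolding homotopy_class_iff by blast
    show "C = ?B" unfolding C(1)
      using homotopy_class_eq_iff[OF so chain_map_shift[OF o f] chain_map_shift[OF o C(2)]]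
        homotopic_shift[OF o f C(2,3)] by simp
  qed
  then show ?thesis by (simp add: Kb_def homotopy_category_def karr_def)
qed

lemma chain_map_ident [simp]: "X \<in> Cx \<Longrightarrow> (\<lambda>i m. m) \<in> Ch X X"
  by (rule chain_mapI) auto

lemma chain_map_zero [simp]: "X \<in> Cx \<Longrightarrow> Y \<in> Cx \<Longrightarrow> (\<lambda>i m. \<zero>\<^bsub>Mdl Y i\<^esub>) \<in> Ch X Y"
  by (rule chain_mapI) (auto simp: mod_simps)

lemmas chain_map_intros = chain_map_comp chain_map_plus chain_map_scale chain_map_shift

lemma Kb_shift_linear: "shift_linear_category R K"
proof (unfold_locales)
  fix a assume "a \<in> Arr K"
  then obtain X Y f where o: "X \<in> Cx" "Y \<in> Cx" and f: "f \<in> Ch X Y" and a: "a = karr R X Y f" by (rule K_arrE)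
  note fs = chain_map_simps[OF f o]
  show "Dom K a \<in> Obj K" "Cod K a \<in> Obj K" unfolding a using o by simp_all
  show "Ident K Z \<cdot>\<^bsub>K\<^esub> a = a" if "Cod K a = Z" for Z
    using that o f unfolding a K_ident by (auto simp: K_comp)
  show "a \<cdot>\<^bsub>K\<^esub> Ident K Z = a" if "Dom K a = Z" for Z
    using that o f unfolding a K_ident by (auto simp: K_comp)
  show "Plus K a (Zero K X' Y') = a" if "Dom K a = X'" "Cod K a = Y'" for X' Y'
  proof -
    have "X' = X" "Y' = Y" using that a by simp_all
    then show ?thesis using o f unfolding a K_zero by (auto simp: K_plus fs intro!: karr_cong)
  qed
  show "Scale K \<zero> a = Zero K (Dom K a) (Cod K a)"
    using o f unfolding a K_zero by (auto simp: K_scale fs mod_smult_const intro!: karr_cong)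
  show "Scale K \<one> a = a"
    using o f unfolding a by (auto simp: K_scale fs mod_smult_const intro!: karr_cong)
  show "ShArr K a \<in> Arr K" "Dom K (ShArr K a) = ShObj K (Dom K a)" "Cod K (ShArr K a) = ShObj K (Cod K a)"
    using o f unfolding a by (simp_all add: K_sh chain_map_shift)
  fix r assume r: "r \<in> carrier R"
  show "Scale K r a \<in> Arr K" "Dom K (Scale K r a) = Dom K a" "Cod K (Scale K r a) = Cod K a"
    using o f r unfolding a by (simp_all add: K_scale chain_map_scale)
  show "ShArr K (Scale K r a) = Scale K r (ShArr K a)"
    using o f r unfolding a by (simp add: K_scale chain_map_scale K_sh chain_map_shift)
  fix s assume s: "s \<in> carrier R"
  show "Scale K (r \<otimes> s) a = Scale K r (Scale K s a)"
    using o f r s unfolding a by (auto simp: K_scale chain_map_scale mod_smult_two fs intro!: karr_cong)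
  show "Scale K (r \<oplus> s) a = Plus K (Scale K r a) (Scale K s a)"
    using o f r s unfolding a by (auto simp: K_scale K_plus chain_map_scale mod_smult_two fs intro!: karr_cong)
next
  fix X assume X: "X \<in> Obj K"
  then show "Ident K X \<in> Arr K" "Dom K (Ident K X) = X" "Cod K (Ident K X) = X" "ShObj K X \<in> Obj K"
    by (simp_all add: K_ident)
  show "ShArr K (Ident K X) = Ident K (ShObj K X)" using X by (simp add: K_ident K_sh)
  fix Y assume Y: "Y \<in> Obj K"
  show "Zero K X Y \<in> Arr K" "Dom K (Zero K X Y) = X" "Cod K (Zero K X Y) = Y"
    using X Y by (simp_all add: K_zero)
next
  fix a b assume "a \<in> Arr K" "b \<in> Arr K" and c: "Dom K b = Cod K a"
  then obtain X Y Z f g where o: "X \<in> Cx" "Y \<in> Cx" "Z \<in> Cx" and f: "f \<in> Ch X Y" "g \<in> Ch Y Z"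
    and ab: "a = karr R X Y f" "b = karr R Y Z g" by (elim K_arrE) auto
  note fs = chain_map_simps[OF f(1) o(1,2)] chain_map_simps[OF f(2) o(2,3)]
  show "b \<cdot>\<^bsub>K\<^esub> a \<in> Arr K" "Dom K (b \<cdot>\<^bsub>K\<^esub> a) = Dom K a" "Cod K (b \<cdot>\<^bsub>K\<^esub> a) = Cod K b"
    using o f chain_map_comp[OF o f] unfolding ab by (simp_all add: K_comp)
  show "ShArr K (b \<cdot>\<^bsub>K\<^esub> a) = ShArr K b \<cdot>\<^bsub>K\<^esub> ShArr K a"
    using o f chain_map_comp[OF o f] unfolding ab by (simp add: K_comp K_sh chain_map_shift)
  fix r assume r: "r \<in> carrier R"
  show "Scale K r b \<cdot>\<^bsub>K\<^esub> a = Scale K r (b \<cdot>\<^bsub>K\<^esub> a)"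
    using o f r chain_map_comp[OF o f] unfolding ab by (simp add: K_comp K_scale chain_map_scale)
  show "b \<cdot>\<^bsub>K\<^esub> Scale K r a = Scale K r (b \<cdot>\<^bsub>K\<^esub> a)"
    using o f r chain_map_comp[OF o f] unfolding ab by (auto simp: K_comp K_scale chain_map_scale fs intro!: karr_cong)
next
  fix a b c assume "a \<in> Arr K" "b \<in> Arr K" "c \<in> Arr K" "Dom K b = Cod K a" "Dom K c = Cod K b"
  then obtain W X Y Z f g h where o: "W \<in> Cx" "X \<in> Cx" "Y \<in> Cx" "Z \<in> Cx" and f: "f \<in> Ch W X" "g \<in> Ch X Y" "h \<in> Ch Y Z"
    and ab: "a = karr R W X f" "b = karr R X Y g" "c = karr R Y Z h" by (elim K_arrE) auto
  show "c \<cdot>\<^bsub>K\<^esub> b \<cdot>\<^bsub>K\<^esub> a = c \<cdot>\<^bsub>K\<^esub> (b \<cdot>\<^bsub>K\<^esub> a)"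
    using o f chain_map_comp[OF o(1-3) f(1,2)] chain_map_comp[OF o(2-4) f(2,3)] unfolding ab by (simp add: K_comp)
next
  fix a b assume "a \<in> Arr K" "b \<in> Arr K" "Dom K a = Dom K b" "Cod K a = Cod K b"
  then obtain X Y f g where o: "X \<in> Cx" "Y \<in> Cx" and f: "f \<in> Ch X Y" "g \<in> Ch X Y"
    and ab: "a = karr R X Y f" "b = karr R X Y g" by (elim K_arrE) auto
  note fs = chain_map_simps[OF f(1) o] chain_map_simps[OF f(2) o]
  show "Plus K a b \<in> Arr K" "Dom K (Plus K a b) = Dom K a" "Cod K (Plus K a b) = Cod K a"
    using o f chain_map_plus[OF o f] unfolding ab by (simp_all add: K_plus)
  show "Plus K a b = Plus K b a"
    using o f unfolding ab by (auto simp: K_plus fs mod_ac intro!: karr_cong)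
next
  fix a b c assume "a \<in> Arr K" "b \<in> Arr K" "c \<in> Arr K" "Dom K a = Dom K b" "Cod K a = Cod K b" "Dom K b = Dom K c" "Cod K b = Cod K c"
  then obtain X Y f g h where o: "X \<in> Cx" "Y \<in> Cx" and f: "f \<in> Ch X Y" "g \<in> Ch X Y" "h \<in> Ch X Y"
    and ab: "a = karr R X Y f" "b = karr R X Y g" "c = karr R X Y h" by (elim K_arrE) auto
  note fs = chain_map_simps[OF f(1) o] chain_map_simps[OF f(2) o] chain_map_simps[OF f(3) o]
  show "Plus K (Plus K a b) c = Plus K a (Plus K b c)"
    using o f chain_map_plus[OF o f(1,2)] chain_map_plus[OF o f(2,3)] unfolding ab by (auto simp: K_plus fs mod_ac intro!: karr_cong)
next
  fix a b c assume "a \<in> Arr K" "b \<in> Arr K" "c \<in> Arr K" "Dom K a = Cod K c" "Dom K b = Cod K c" "Cod K a = Cod K b"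
  then obtain X Y Z f g h where o: "X \<in> Cx" "Y \<in> Cx" "Z \<in> Cx" and f: "f \<in> Ch Y Z" "g \<in> Ch Y Z" "h \<in> Ch X Y"
    and ab: "a = karr R Y Z f" "b = karr R Y Z g" "c = karr R X Y h" by (elim K_arrE) auto
  show "Plus K a b \<cdot>\<^bsub>K\<^esub> c = Plus K (a \<cdot>\<^bsub>K\<^esub> c) (b \<cdot>\<^bsub>K\<^esub> c)"
    using o f chain_map_plus[OF o(2,3) f(1,2)] chain_map_comp[OF o f(3,1)] chain_map_comp[OF o f(3,2)] unfolding ab by (simp add: K_plus K_comp)
next
  fix a b c assume "a \<in> Arr K" "b \<in> Arr K" "c \<in> Arr K" "Dom K c = Cod K a" "Dom K c = Cod K b" "Dom K a = Dom K b"
  then obtain X Y Z f g h where o: "X \<in> Cx" "Y \<in> Cx" "Z \<in> Cx" and f: "f \<in> Ch X Y" "g \<in> Ch X Y" "h \<in> Ch Y Z"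
    and ab: "a = karr R X Y f" "b = karr R X Y g" "c = karr R Y Z h" by (elim K_arrE) auto
  note fs = chain_map_simps[OF f(1) o(1,2)] chain_map_simps[OF f(2) o(1,2)] chain_map_simps[OF f(3) o(2,3)]
  show "c \<cdot>\<^bsub>K\<^esub> Plus K a b = Plus K (c \<cdot>\<^bsub>K\<^esub> a) (c \<cdot>\<^bsub>K\<^esub> b)"
    using o f chain_map_plus[OF o(1,2) f(1,2)] chain_map_comp[OF o f(1,3)] chain_map_comp[OF o f(2,3)] unfolding ab
    by (auto simp: K_plus K_comp fs intro!: karr_cong)
qed

section \<open>Triangles in the homotopy category\<close>

lemma shift_incl_chain [simp]: "X \<in> Cx \<Longrightarrow> Y \<in> Cx \<Longrightarrow> f \<in> Ch X Y \<Longrightarrow> (\<lambda>i m. Pair \<zero>\<^bsub>Mdl X (i + 1)\<^esub> m) \<in> Ch Y (cone X Y f)"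
  by (rule chain_mapI) (auto simp: mod_simps chain_map_simps)

lemma cone_proj_chain [simp]: "X \<in> Cx \<Longrightarrow> Y \<in> Cx \<Longrightarrow> f \<in> Ch X Y \<Longrightarrow> (\<lambda>i. pfst) \<in> Ch (cone X Y f) (shift_cplx X)"
  by (rule chain_mapI) (auto simp: mod_simps chain_map_simps)

abbreviation "cone_incl X \<equiv> (\<lambda>i m. Pair \<zero>\<^bsub>Mdl X (i + 1)\<^esub> m)"

definition "std_triangles = {standard_triangle R X Y f |X Y f. X \<in> Cx \<and> Y \<in> Cx \<and> f \<in> Ch X Y}"

lemma K_Tri: "Tri K = triangle_closure K std_triangles"
  by (simp add: Kb_def std_triangles_def triangle_closure_def candidate_triangle_def iso_triangles_def
      iso_arr_def homs_def split_beta)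

lemma std_trianglesE:
  assumes "(u, v, w) \<in> std_triangles"
  obtains X Y f where "X \<in> Cx" "Y \<in> Cx" "f \<in> Ch X Y" "u = karr R X Y f" "v = karr R Y (cone X Y f) (cone_incl X)"
    "w = karr R (cone X Y f) (shift_cplx X) (\<lambda>i. pfst)"
  using assms unfolding std_triangles_def standard_triangle_def by auto

interpretation K: shift_linear_category R K by (rule Kb_shift_linear)

lemma std_candidate: "\<forall>\<tau>\<in>std_triangles. candidate_triangle K \<tau>"
  unfolding std_triangles_def standard_triangle_def by (auto simp: K.candidate_iff)

lemma std_Tri:
  assumes "X \<in> Cx" "Y \<in> Cx" "f \<in> Ch X Y"
  shows "(karr R X Y f, karr R Y (cone X Y f) (cone_incl X), karr R (cone X Y f) (shift_cplx X) (\<lambda>i. pfst)) \<in> Tri K"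
proof -
  have m: "(karr R X Y f, karr R Y (cone X Y f) (cone_incl X), karr R (cone X Y f) (shift_cplx X) (\<lambda>i. pfst)) \<in> std_triangles"
    unfolding std_triangles_def standard_triangle_def using assms by blast
  show ?thesis unfolding K_Tri K.closure_iff
    using m K.iso_triangles_refl[OF bspec[OF std_candidate m]] bspec[OF std_candidate m] by blast
qed

lemma karr_eqI:
  assumes "X \<in> Cx" "Y \<in> Cx" "f \<in> Ch X Y" "g \<in> Ch X Y" "graded_map X Y h"
   "\<And>i m. m \<in> carrier (Mdl X i) \<Longrightarrow> f i m = g i m \<oplus>\<^bsub>Mdl Y i\<^esub>
             (Dif Y (i - 1) (h i m) \<oplus>\<^bsub>Mdl Y i\<^esub> h (i + 1) (Dif X i m))"
  shows "karr R X Y f = karr R X Y g"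
  using karr_eq_iff[OF assms(1-4)] homotopicI[OF assms(5,6)] by simp

text \<open>
  The homotopy is \<open>x \<mapsto> (x, 0)\<close>.
\<close>

lemma cone_incl_comp_zero:
  assumes o: "X \<in> Cx" "Y \<in> Cx" and f: "f \<in> Ch X Y"
  shows "karr R X (cone X Y f) (\<lambda>i m. Pair \<zero>\<^bsub>Mdl X (i + 1)\<^esub> (f i m)) = karr R X (cone X Y f) (\<lambda>i m. \<zero>\<^bsub>Mdl (cone X Y f) i\<^esub>)"
proof (rule karr_eqI)
  note fs = chain_map_simps[OF f o]
  show "graded_map X (cone X Y f) (\<lambda>i m. Pair m \<zero>\<^bsub>Mdl Y (i - 1)\<^esub>)"
    by (rule graded_mapI) (use o in \<open>auto simp: mod_simps\<close>)
qed (use assms chain_map_comp[OF o cone_cplx[OF o f] f shift_incl_chain[OF o f]] chain_map_zero[OF o(1) cone_cplx[OF o f]] in \<open>auto simp: mod_simps chain_map_simps[OF f o]\<close>)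

text \<open>
  A null homotopy of \<open>E \<rightarrow> Y \<rightarrow> cone f\<close> has two components.  The first is a chain map \<open>E \<rightarrow> X\<close>, the second a homotopy
  between \<open>h\<close> and its composite with \<open>f\<close>.
\<close>

lemma cone_weak_kernel:
  assumes o: "X \<in> Cx" "Y \<in> Cx" "E \<in> Cx" and f: "f \<in> Ch X Y" and h: "h \<in> Ch E Y"
    and z: "homotopic R E (cone X Y f) (\<lambda>i m. Pair \<zero>\<^bsub>Mdl X (i + 1)\<^esub> (h i m)) (\<lambda>i m. \<zero>\<^bsub>Mdl (cone X Y f) i\<^esub>)"
  shows "\<exists>k\<in>Ch E X. karr R E Y h = karr R E Y (\<lambda>i m. f i (k i m))"
proof -
  note fs = chain_map_simps[OF f o(1,2)] chain_map_simps[OF h o(3,2)]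
  obtain k where k: "graded_map E (cone X Y f) k"
    and e0: "\<forall>i. \<forall>m\<in>carrier (Mdl E i). Pair \<zero>\<^bsub>Mdl X (i + 1)\<^esub> (h i m) = \<zero>\<^bsub>Mdl (cone X Y f) i\<^esub> \<oplus>\<^bsub>Mdl (cone X Y f) i\<^esub>
             (Dif (cone X Y f) (i - 1) (k i m) \<oplus>\<^bsub>Mdl (cone X Y f) i\<^esub> k (i + 1) (Dif E i m))"
    using z by (rule homotopicE)
  note ks = graded_map_simps[OF k o(3) cone_cplx[OF o(1,2) f]]
  define p where "p i m = pfst (k i m)" for i m
  define q where "q i m = psnd (k i m)" for i m
  have kpq: "k i m = Pair (p i m) (q i m)" "p i m \<in> carrier (Mdl X i)" "q i m \<in> carrier (Mdl Y (i - 1))"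
    if "m \<in> carrier (Mdl E i)" for i m
    using ks(1)[OF that refl] unfolding p_def q_def by auto
  have e: "Pair \<zero>\<^bsub>Mdl X (i + 1)\<^esub> (h i m) = Pair (\<zero>\<^bsub>Mdl X (i + 1)\<^esub> \<ominus>\<^bsub>Mdl X (i + 1)\<^esub> Dif X i (p i m) \<oplus>\<^bsub>Mdl X (i + 1)\<^esub> p (i + 1) (Dif E i m))
     (f i (p i m) \<oplus>\<^bsub>Mdl Y i\<^esub> Dif Y (i - 1) (q i m) \<oplus>\<^bsub>Mdl Y i\<^esub> q (i + 1) (Dif E i m))" if m: "m \<in> carrier (Mdl E i)" for i m
    using e0[rule_format, OF m] m o kpq[OF m] kpq[of "Dif E i m" "i + 1"] by (simp add: mod_simps fs)
  have pd: "p (i + 1) (Dif E i m) = Dif X i (p i m)" if m: "m \<in> carrier (Mdl E i)" for i m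
    using e[OF m] m o kpq[OF m] kpq[of "Dif E i m" "i + 1"] by (simp add: mod_simps)
  have hq: "h i m = f i (p i m) \<oplus>\<^bsub>Mdl Y i\<^esub> (Dif Y (i - 1) (q i m) \<oplus>\<^bsub>Mdl Y i\<^esub> q (i + 1) (Dif E i m))" if m: "m \<in> carrier (Mdl E i)" for i m
    using e[OF m] m o kpq[OF m] kpq[of "Dif E i m" "i + 1"] by (simp add: mod_simps fs)
  have p: "p \<in> Ch E X"
  proof (rule chain_mapI)
    fix i m n assume mn: "m \<in> carrier (Mdl E i)" "n \<in> carrier (Mdl E i)"
    show "p i (m \<oplus>\<^bsub>Mdl E i\<^esub> n) = p i m \<oplus>\<^bsub>Mdl X i\<^esub> p i n"
      using ks(2)[OF mn] kpq(1)[OF mn(1)] kpq(1)[OF mn(2)] kpq(1)[of "m \<oplus>\<^bsub>Mdl E i\<^esub> n" i] mn o by simp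
  next
    fix i m r assume r: "r \<in> carrier R" and m: "m \<in> carrier (Mdl E i)"
    show "p i (r \<odot>\<^bsub>Mdl E i\<^esub> m) = r \<odot>\<^bsub>Mdl X i\<^esub> p i m"
      using ks(4)[OF r m] kpq(1)[OF m] kpq(1)[of "r \<odot>\<^bsub>Mdl E i\<^esub> m" i] m r o by simp
  qed (use kpq pd in simp_all)
  have q: "graded_map E Y q"
  proof (rule graded_mapI)
    fix i m n assume mn: "m \<in> carrier (Mdl E i)" "n \<in> carrier (Mdl E i)"
    show "q i (m \<oplus>\<^bsub>Mdl E i\<^esub> n) = q i m \<oplus>\<^bsub>Mdl Y (i - 1)\<^esub> q i n"
      using ks(2)[OF mn] kpq(1)[OF mn(1)] kpq(1)[OF mn(2)] kpq(1)[of "m \<oplus>\<^bsub>Mdl E i\<^esub> n" i] mn o by simp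
  next
    fix i m r assume r: "r \<in> carrier R" and m: "m \<in> carrier (Mdl E i)"
    show "q i (r \<odot>\<^bsub>Mdl E i\<^esub> m) = r \<odot>\<^bsub>Mdl Y (i - 1)\<^esub> q i m"
      using ks(4)[OF r m] kpq(1)[OF m] kpq(1)[of "r \<odot>\<^bsub>Mdl E i\<^esub> m" i] m r o by simp
  qed (use kpq in simp_all)
  have "karr R E Y h = karr R E Y (\<lambda>i m. f i (p i m))"
    by (rule karr_eqI[OF o(3,2) h chain_map_comp[OF o(3,1,2) p f] q]) (rule hq)
  then show ?thesis using p by blast
qed

text \<open>
  The cone of the inclusion \<open>Y \<rightarrow> cone f\<close> consists of elements \<open>(y, (x, y'))\<close>.  It is homotopy equivalent to the shift of
  \<open>X\<close> by projection to \<open>x\<close>, with inverse \<open>x \<mapsto> (- f x, (x, 0))\<close> and homotopy \<open>(y, (x, y')) \<mapsto> (y', (0, 0))\<close>.  Under this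
  equivalence the projection to \<open>y\<close> becomes \<open>- f\<close>, via the homotopy \<open>y'\<close>.
\<close>

lemma rotation_maps:
  assumes o: "X \<in> Cx" "Y \<in> Cx" and f: "f \<in> Ch X Y"
  defines "I \<equiv> cone_incl X"
  defines "C \<equiv> cone Y (cone X Y f) I"
  shows "(\<lambda>i m. pfst (psnd m)) \<in> Ch C (shift_cplx X)"
    and "(\<lambda>i x. Pair (\<ominus>\<^bsub>Mdl Y (i + 1)\<^esub> f (i + 1) x) (Pair x \<zero>\<^bsub>Mdl Y i\<^esub>)) \<in> Ch (shift_cplx X) C"
    and "karr R C C (\<lambda>i m. m) = karr R C C (\<lambda>i m. Pair (\<ominus>\<^bsub>Mdl Y (i + 1)\<^esub> f (i + 1) (pfst (psnd m))) (Pair (pfst (psnd m)) \<zero>\<^bsub>Mdl Y i\<^esub>))"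
    and "karr R C (shift_cplx Y) (\<lambda>i. pfst) = karr R C (shift_cplx Y) (\<lambda>i m. (\<ominus> \<one>) \<odot>\<^bsub>Mdl Y (i + 1)\<^esub> f (i + 1) (pfst (psnd m)))"
proof -
  note fs = chain_map_simps[OF f o]
  have I: "I \<in> Ch Y (cone X Y f)" unfolding I_def using o f by simp
  have C: "C \<in> Cx" "cone X Y f \<in> Cx" unfolding C_def using o f I by simp_all
  have CM: "Mdl C i = dir_sum (Mdl Y (i + 1)) (dir_sum (Mdl X (i + 1)) (Mdl Y i))" for i by (simp add: C_def)
  have CD: "Dif C i (Pair y (Pair x z)) = Pair (\<ominus>\<^bsub>Mdl Y (i + 2)\<^esub> Dif Y (i + 1) y)
     (Pair (\<zero>\<^bsub>Mdl X (i + 2)\<^esub> \<oplus>\<^bsub>Mdl X (i + 2)\<^esub> (\<ominus>\<^bsub>Mdl X (i + 2)\<^esub> Dif X (i + 1) x)) (y \<oplus>\<^bsub>Mdl Y (i + 1)\<^esub> (f (i + 1) x \<oplus>\<^bsub>Mdl Y (i + 1)\<^esub> Dif Y i z)))" for i x y z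
    by (simp add: C_def I_def)
  show c: "(\<lambda>i m. pfst (psnd m)) \<in> Ch C (shift_cplx X)"
    by (rule chain_mapI) (use o in \<open>auto simp: CM CD mod_simps fs\<close>)
  show s: "(\<lambda>i x. Pair (\<ominus>\<^bsub>Mdl Y (i + 1)\<^esub> f (i + 1) x) (Pair x \<zero>\<^bsub>Mdl Y i\<^esub>)) \<in> Ch (shift_cplx X) C"
    by (rule chain_mapI) (use o in \<open>auto simp: CM CD mod_simps fs\<close>)
  show "karr R C C (\<lambda>i m. m) = karr R C C (\<lambda>i m. Pair (\<ominus>\<^bsub>Mdl Y (i + 1)\<^esub> f (i + 1) (pfst (psnd m))) (Pair (pfst (psnd m)) \<zero>\<^bsub>Mdl Y i\<^esub>))"
    by (rule karr_eqI[of _ _ _ _ "\<lambda>i m. Pair (psnd (psnd m)) (Pair \<zero>\<^bsub>Mdl X i\<^esub> \<zero>\<^bsub>Mdl Y (i - 1)\<^esub>)"])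
      (use o C chain_map_comp[OF C(1) shift_cplx[OF o(1)] C(1) c s] in \<open>auto simp: CM CD mod_simps fs intro!: graded_mapI\<close>)
  show "karr R C (shift_cplx Y) (\<lambda>i. pfst) = karr R C (shift_cplx Y) (\<lambda>i m. (\<ominus> \<one>) \<odot>\<^bsub>Mdl Y (i + 1)\<^esub> f (i + 1) (pfst (psnd m)))"
    by (rule karr_eqI[of _ _ _ _ "\<lambda>i m. psnd (psnd m)"])
      (use o C f c cone_proj_chain[OF o(2) C(2) I] in \<open>auto simp: CM CD mod_simps fs intro!: graded_mapI chain_mapI simp flip: C_def\<close>)
qed

lemma Kb_exact: "exact_triangles R K"
proof (rule K.exact_triangles_basis[OF K_Tri std_candidate])
  fix u v w assume "(u, v, w) \<in> std_triangles"
  then obtain X Y f where o: "X \<in> Cx" "Y \<in> Cx" and f: "f \<in> Ch X Y" and t: "u = karr R X Y f" "v = karr R Y (cone X Y f) (cone_incl X)"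
    "w = karr R (cone X Y f) (shift_cplx X) (\<lambda>i. pfst)" by (rule std_trianglesE)
  note C = cone_cplx[OF o f] and I = shift_incl_chain[OF o f] and P = cone_proj_chain[OF o f]
  show "v \<cdot>\<^bsub>K\<^esub> u = Zero K (Dom K u) (Cod K v)"
    unfolding t K_comp[OF o C f I] using cone_incl_comp_zero[OF o f] by (simp add: K_zero)
  show "\<exists>k\<in>Arr K. Dom K k = Dom K h \<and> Cod K k = Dom K u \<and> h = u \<cdot>\<^bsub>K\<^esub> k"
    if h: "h \<in> Arr K" "Cod K h = Cod K u" "v \<cdot>\<^bsub>K\<^esub> h = Zero K (Dom K h) (Cod K v)" for h
  proof -
    obtain E g where E: "E \<in> Cx" and g: "g \<in> Ch E Y" and hg: "h = karr R E Y g"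
      using h(1,2) unfolding t by (elim K_arrE) auto
    have "karr R E (cone X Y f) (\<lambda>i m. Pair \<zero>\<^bsub>Mdl X (i + 1)\<^esub> (g i m)) = karr R E (cone X Y f) (\<lambda>i m. \<zero>\<^bsub>Mdl (cone X Y f) i\<^esub>)"
      using h(3) unfolding hg t K_comp[OF E o(2) C g I] by (simp add: K_zero)
    then have "homotopic R E (cone X Y f) (\<lambda>i m. Pair \<zero>\<^bsub>Mdl X (i + 1)\<^esub> (g i m)) (\<lambda>i m. \<zero>\<^bsub>Mdl (cone X Y f) i\<^esub>)"
      using karr_eq_iff[OF E C chain_map_comp[OF E o(2) C g I] chain_map_zero[OF E C]] by simp
    from cone_weak_kernel[OF o E f g this]
    obtain k where k: "k \<in> Ch E X" "karr R E Y g = karr R E Y (\<lambda>i m. f i (k i m))" by blast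
    show ?thesis unfolding hg t k(2)
      by (rule bexI[of _ "karr R E X k"]) (use o E f k in \<open>simp_all add: K_comp\<close>)
  qed
  define D where "D = cone Y (cone X Y f) (cone_incl X)"
  note r = rotation_maps[OF o f, folded D_def]
  have D: "D \<in> Cx" unfolding D_def using o C I by simp
  define c where "c = karr R D (shift_cplx X) (\<lambda>i m. pfst (psnd m))"
  define c' where "c' = karr R (shift_cplx X) D (\<lambda>i x. Pair (\<ominus>\<^bsub>Mdl Y (i + 1)\<^esub> f (i + 1) x) (Pair x \<zero>\<^bsub>Mdl Y i\<^esub>))"
  note so = shift_cplx[OF o(1)] shift_cplx[OF o(2)]
  have cc: "c \<in> Arr K" "c' \<in> Arr K" "Dom K c = D" "Cod K c = shift_cplx X" "Dom K c' = shift_cplx X" "Cod K c' = D"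
    unfolding c_def c'_def using D so r(1,2) by simp_all
  have "c' \<cdot>\<^bsub>K\<^esub> c = Ident K D"
    unfolding c_def c'_def K_comp[OF D so(1) D r(1,2)] K_ident by (rule r(3)[symmetric])
  moreover have "c \<cdot>\<^bsub>K\<^esub> c' = Ident K (shift_cplx X)"
    unfolding c_def c'_def K_comp[OF so(1) D so(1) r(2,1)] K_ident by simp
  ultimately have ci: "iso_arr K c" using cc by (intro K.isoI[of c c']) simp_all
  define \<iota> where "\<iota> = karr R (cone X Y f) D (cone_incl Y)"
  define \<pi> where "\<pi> = karr R D (shift_cplx Y) (\<lambda>i. pfst)"
  have std: "(v, \<iota>, \<pi>) \<in> Tri K" unfolding t \<iota>_def \<pi>_def D_def by (rule std_Tri[OF o(2) C I])
  note Ic = shift_incl_chain[OF o(2) C I, folded D_def] and Pc = cone_proj_chain[OF o(2) C I, folded D_def]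
  have ip: "\<iota> \<in> Arr K" "\<pi> \<in> Arr K" "Dom K \<iota> = cone X Y f" "Cod K \<iota> = D" "Dom K \<pi> = D" "Cod K \<pi> = shift_cplx Y"
    unfolding \<iota>_def \<pi>_def using C D so Ic Pc by simp_all
  have uvw: "u \<in> Arr K" "v \<in> Arr K" "w \<in> Arr K" "Dom K u = X" "Cod K u = Y" "Dom K v = Y" "Cod K v = cone X Y f"
    "Dom K w = cone X Y f" "Cod K w = shift_cplx X" unfolding t using o f C I P so by simp_all
  have 1: "c \<cdot>\<^bsub>K\<^esub> \<iota> = w" unfolding c_def \<iota>_def K_comp[OF C D so(1) Ic r(1)] t by simp
  have 2: "K.neg (ShArr K u) \<cdot>\<^bsub>K\<^esub> c = \<pi>"
  proof -
    have n: "\<ominus> \<one> \<in> carrier R" by simp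
    note fsh = chain_map_shift[OF o f]
    show ?thesis
      unfolding t K_sh[OF o f] K_scale[OF so fsh n] c_def \<pi>_def K_comp[OF D so r(1) chain_map_scale[OF so fsh n]] r(4)
      by simp
  qed
  have iso: "K.tri_map (Ident K Y) (Ident K (cone X Y f)) c (v, \<iota>, \<pi>) (v, w, K.neg (ShArr K u))"
    by (rule K.tri_mapI) (use uvw ip cc 1 2 o C so in simp_all)
  have cand: "candidate_triangle K (v, \<iota>, \<pi>)" "candidate_triangle K (v, w, K.neg (ShArr K u))"
    using uvw ip o by (simp_all add: K.candidate_iff)
  have it: "iso_triangles K (v, \<iota>, \<pi>) (v, w, K.neg (ShArr K u))"
    by (rule K.tri_map_isoI[OF iso _ _ ci cand]) (use o C in simp_all)
  have m: "(v, \<iota>, \<pi>) \<in> std_triangles"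
    unfolding std_triangles_def standard_triangle_def t \<iota>_def \<pi>_def D_def using o C I by blast
  show "(v, w, K.neg (ShArr K u)) \<in> Tri K"
    unfolding K_Tri K.closure_iff using cand(2) m it by blast
qed

interpretation K: exact_triangles R K by (rule Kb_exact)

definition zero_cplx :: "'a cplx" where
  "zero_cplx = \<lparr>Mdl = (\<lambda>_. \<lparr>carrier = {Scal \<zero>}, monoid.mult = undefined, one = undefined, zero = Scal \<zero>,
     add = (\<lambda>_ _. Scal \<zero>), smult = (\<lambda>_ _. Scal \<zero>)\<rparr>), Dif = (\<lambda>_ _. Scal \<zero>)\<rparr>"

lemma zero_cplx_simps [simp]:
  "carrier (Mdl zero_cplx i) = {Scal \<zero>}" "\<zero>\<^bsub>Mdl zero_cplx i\<^esub> = Scal \<zero>"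
  "x \<oplus>\<^bsub>Mdl zero_cplx i\<^esub> y = Scal \<zero>" "r \<odot>\<^bsub>Mdl zero_cplx i\<^esub> y = Scal \<zero>" "Dif zero_cplx i x = Scal \<zero>"
  by (simp_all add: zero_cplx_def)

lemma zero_cplx [simp]: "zero_cplx \<in> Cx"
proof (rule cplxI)
  fix i
  have "abelian_group (Mdl zero_cplx i)" by (rule abelian_groupI) auto
  then show m: "module R (Mdl zero_cplx i)" by (intro moduleI) (auto simp: is_cring)
  have "N = carrier (Mdl zero_cplx i)" if "submodule N R (Mdl zero_cplx i)" for N
    using module.submoduleE(1,2)[OF m that] by auto
  then show "fin_gen R (Mdl zero_cplx i)" unfolding fin_gen_def by blast
qed auto

definition unshift_cplx :: "'a cplx \<Rightarrow> 'a cplx" where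
  "unshift_cplx X = \<lparr>Mdl = (\<lambda>i. Mdl X (i - 1)), Dif = (\<lambda>i m. \<ominus>\<^bsub>Mdl X i\<^esub> Dif X (i - 1) m)\<rparr>"

lemma unshift_cplx_simps [simp]:
  "Mdl (unshift_cplx X) i = Mdl X (i - 1)"
  "Dif (unshift_cplx X) i m = \<ominus>\<^bsub>Mdl X i\<^esub> Dif X (i - 1) m"
  by (simp_all add: unshift_cplx_def)

lemma unshift_cplx [simp]:
  assumes X: "X \<in> Cx" shows "unshift_cplx X \<in> Cx"
proof (rule cplxI)
  show "finite {i. carrier (Mdl (unshift_cplx X) i) \<noteq> {\<zero>\<^bsub>Mdl (unshift_cplx X) i\<^esub>}}"
    using finite_reindex[OF cplx_finite[OF X], of "- 1"] by simp
qed (use X in \<open>simp_all add: mod_simps cplx_fin_gen\<close>)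

lemma K_zero_object:
  assumes E: "E \<in> Cx"
  shows "(Zero K zero_cplx E, Ident K E, Zero K E (ShObj K zero_cplx)) \<in> Tri K"
proof -
  define z where "z = (\<lambda>(i::int) (m::'a elt). \<zero>\<^bsub>Mdl E i\<^esub>)"
  have z: "z \<in> Ch zero_cplx E" unfolding z_def using chain_map_zero[OF zero_cplx E] .
  define C where "C = cone zero_cplx E z"
  have C: "C \<in> Cx" unfolding C_def by (rule cone_cplx[OF zero_cplx E z])
  have CM: "Mdl C i = dir_sum (Mdl zero_cplx (i + 1)) (Mdl E i)" for i by (simp add: C_def)
  have CD: "Dif C i (Pair a b) = Pair (\<ominus>\<^bsub>Mdl zero_cplx (i + 2)\<^esub> Scal \<zero>) (\<zero>\<^bsub>Mdl E (i + 1)\<^esub> \<oplus>\<^bsub>Mdl E (i + 1)\<^esub> Dif E i b)" for i a b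
    by (simp add: C_def z_def)
  have p: "(\<lambda>i. psnd) \<in> Ch C E"
    by (rule chain_mapI) (use E in \<open>auto simp: CM CD mod_simps\<close>)
  note i = shift_incl_chain[OF zero_cplx E z, folded C_def]
  note q = cone_proj_chain[OF zero_cplx E z, folded C_def]
  note t = std_Tri[OF zero_cplx E z, folded C_def]
  have "(karr R zero_cplx E z, karr R C E (\<lambda>i. psnd) \<cdot>\<^bsub>K\<^esub> karr R E C (cone_incl zero_cplx),
     karr R C (shift_cplx zero_cplx) (\<lambda>i. pfst) \<cdot>\<^bsub>K\<^esub> karr R E C (cone_incl zero_cplx)) \<in> Tri K"
  proof (rule K.replace_cone[OF t])
    show "karr R E C (cone_incl zero_cplx) \<cdot>\<^bsub>K\<^esub> karr R C E (\<lambda>i. psnd) = Ident K (Dom K (karr R C E (\<lambda>i. psnd)))"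
      using K_comp[OF C E C p i] by (auto simp: K_ident CM intro!: karr_cong)
    show "karr R C E (\<lambda>i. psnd) \<cdot>\<^bsub>K\<^esub> karr R E C (cone_incl zero_cplx) = Ident K (Cod K (karr R C E (\<lambda>i. psnd)))"
      using K_comp[OF E C E i p] by (simp add: K_ident)
  qed (use C E p i in simp_all)
  also have "karr R C E (\<lambda>i. psnd) \<cdot>\<^bsub>K\<^esub> karr R E C (cone_incl zero_cplx) = Ident K E"
    using K_comp[OF E C E i p] by (simp add: K_ident)
  also have "karr R C (shift_cplx zero_cplx) (\<lambda>i. pfst) \<cdot>\<^bsub>K\<^esub> karr R E C (cone_incl zero_cplx) = Zero K E (ShObj K zero_cplx)"
    using K_comp[OF E C shift_cplx[OF zero_cplx] i q] by (simp add: K_zero)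
  also have "karr R zero_cplx E z = Zero K zero_cplx E" by (simp add: K_zero z_def)
  finally show ?thesis .
qed

text \<open>
  The cocone is the unshifted cone of \<open>f\<close>, with \<open>t\<close> the projection to \<open>X\<close>.  The cone of \<open>t\<close> consists of elements
  \<open>((x, y), x')\<close> and is identified with \<open>Y\<close> by \<open>f x' - y\<close>; the sign is chosen such that the inclusion of \<open>X\<close> corresponds
  to \<open>f\<close>.
\<close>

lemma K_cocone:
  assumes o: "X \<in> Cx" "Y \<in> Cx" and f: "f \<in> Ch X Y"
  shows "\<exists>u w. (u, karr R X Y f, w) \<in> Tri K"
proof -
  note fs = chain_map_simps[OF f o]
  define W where "W = unshift_cplx (cone X Y f)"
  have W: "W \<in> Cx" unfolding W_def using o f by simp
  have WM: "Mdl W i = dir_sum (Mdl X i) (Mdl Y (i - 1))" for i by (simp add: W_def)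
  have WD: "Dif W i (Pair a b) = Pair (Dif X i a) (\<ominus>\<^bsub>Mdl Y i\<^esub> (f i a \<oplus>\<^bsub>Mdl Y i\<^esub> Dif Y (i - 1) b))"
    if "a \<in> carrier (Mdl X i)" "b \<in> carrier (Mdl Y (i - 1))" for i a b
    using that o by (simp add: W_def mod_simps fs)
  have t: "(\<lambda>i. pfst) \<in> Ch W X" by (rule chain_mapI) (use o in \<open>auto simp: WM WD mod_simps fs\<close>)
  define C where "C = cone W X (\<lambda>i. pfst)"
  have C: "C \<in> Cx" unfolding C_def by (rule cone_cplx[OF W o(1) t])
  have CM: "Mdl C i = dir_sum (dir_sum (Mdl X (i + 1)) (Mdl Y i)) (Mdl X i)" for i by (simp add: C_def WM)
  have CD: "Dif C i (Pair (Pair a b) c) = Pair (Pair (\<ominus>\<^bsub>Mdl X (i + 2)\<^esub> Dif X (i + 1) a) (f (i + 1) a \<oplus>\<^bsub>Mdl Y (i + 1)\<^esub> Dif Y i b)) (a \<oplus>\<^bsub>Mdl X (i + 1)\<^esub> Dif X i c)"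
    if "a \<in> carrier (Mdl X (i + 1))" "b \<in> carrier (Mdl Y i)" "c \<in> carrier (Mdl X i)" for i a b c
    using that o by (simp add: C_def WM WD mod_simps fs)
  define \<phi> where "\<phi> = (\<lambda>i m. f i (psnd m) \<ominus>\<^bsub>Mdl Y i\<^esub> psnd (pfst m))"
  define \<psi> where "\<psi> = (\<lambda>i m. Pair (Pair \<zero>\<^bsub>Mdl X (i + 1)\<^esub> (\<ominus>\<^bsub>Mdl Y i\<^esub> m)) \<zero>\<^bsub>Mdl X i\<^esub>)"
  have \<phi>: "\<phi> \<in> Ch C Y" unfolding \<phi>_def
    by (rule chain_mapI) (use o in \<open>auto simp: CM CD mod_simps fs\<close>)
  have \<psi>: "\<psi> \<in> Ch Y C" unfolding \<psi>_def
    by (rule chain_mapI) (use o in \<open>auto simp: CM CD mod_simps fs\<close>)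
  have \<psi>\<phi>: "karr R C C (\<lambda>i m. m) = karr R C C (\<lambda>i m. \<psi> i (\<phi> i m))"
    by (rule karr_eqI[of _ _ _ _ "\<lambda>i m. Pair (Pair (psnd m) \<zero>\<^bsub>Mdl Y (i - 1)\<^esub>) \<zero>\<^bsub>Mdl X (i - 1)\<^esub>"])
      (use o C chain_map_comp[OF C o(2) C \<phi> \<psi>] in \<open>auto simp: CM CD mod_simps fs \<phi>_def \<psi>_def intro!: graded_mapI\<close>)
  have \<phi>\<psi>: "karr R Y Y (\<lambda>i m. \<phi> i (\<psi> i m)) = karr R Y Y (\<lambda>i m. m)"
    by (rule karr_cong) (use o in \<open>simp add: \<phi>_def \<psi>_def mod_simps fs\<close>)
  note i = shift_incl_chain[OF W o(1) t, folded C_def]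
  have "(karr R W X (\<lambda>i. pfst), karr R C Y \<phi> \<cdot>\<^bsub>K\<^esub> karr R X C (cone_incl W), karr R C (shift_cplx W) (\<lambda>i. pfst) \<cdot>\<^bsub>K\<^esub> karr R Y C \<psi>) \<in> Tri K"
    by (rule K.replace_cone[OF std_Tri[OF W o(1) t, folded C_def]])
      (use C o \<phi> \<psi> \<phi>\<psi> \<psi>\<phi> in \<open>simp_all add: K_comp K_ident\<close>)
  moreover have "karr R C Y \<phi> \<cdot>\<^bsub>K\<^esub> karr R X C (cone_incl W) = karr R X Y f"
    unfolding K_comp[OF o(1) C o(2) i \<phi>] by (rule karr_cong) (use o in \<open>simp add: \<phi>_def WM mod_simps fs\<close>)
  ultimately show ?thesis by metis
qed

text \<open>
  The map of cones induced by a square that commutes up to the homotopy \<open>h\<close>.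
\<close>

lemma K_cone_map:
  assumes o: "X \<in> Cx" "Y \<in> Cx" "X' \<in> Cx" "Y' \<in> Cx" and f: "f \<in> Ch X Y" "f' \<in> Ch X' Y'" "a \<in> Ch X X'" "b \<in> Ch Y Y'"
    and h: "graded_map X Y' h" and e: "\<And>i m. m \<in> carrier (Mdl X i) \<Longrightarrow> b i (f i m) = f' i (a i m) \<oplus>\<^bsub>Mdl Y' i\<^esub>
             (Dif Y' (i - 1) (h i m) \<oplus>\<^bsub>Mdl Y' i\<^esub> h (i + 1) (Dif X i m))"
  shows "(\<lambda>i m. Pair (a (i + 1) (pfst m)) (b i (psnd m) \<oplus>\<^bsub>Mdl Y' i\<^esub> h (i + 1) (pfst m))) \<in> Ch (cone X Y f) (cone X' Y' f')"
proof -
  note fs = chain_map_simps[OF f(1) o(1,2)] chain_map_simps[OF f(2) o(3,4)] chain_map_simps[OF f(3) o(1,3)] chain_map_simps[OF f(4) o(2,4)]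
    graded_map_simps[OF h o(1,4)]
  show ?thesis by (rule chain_mapI) (use o in \<open>auto simp: mod_simps fs e\<close>)
qed

text \<open>
  The cone of \<open>\<alpha> : cone f \<rightarrow> cone (g f)\<close>, \<open>(x, y) \<mapsto> (x, g y)\<close>, consists of elements \<open>((x, y), (x', z))\<close>.  It is homotopy
  equivalent to the cone of \<open>g\<close> by \<open>(y + f x', z)\<close>, with inverse \<open>(y, z) \<mapsto> ((0, y), (0, z))\<close> and homotopy
  \<open>((x', 0), (0, 0))\<close>.
\<close>

lemma K_octahedron:
  assumes o: "X \<in> Cx" "Y \<in> Cx" "Z \<in> Cx" and f: "f \<in> Ch X Y" and g: "g \<in> Ch Y Z"
  defines "gf \<equiv> (\<lambda>i m. g i (f i m))"
  shows "\<exists>a b c. (a, b, c) \<in> Tri K \<and> Dom K a = cone X Y f \<and> Cod K a = cone X Z gf \<and> Cod K b = cone Y Z g"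
proof -
  note fs = chain_map_simps[OF f o(1,2)] chain_map_simps[OF g o(2,3)]
  have gf: "gf \<in> Ch X Z" unfolding gf_def by (rule chain_map_comp[OF o f g])
  define A where "A = cone X Y f"
  define B where "B = cone Y Z g"
  define C where "C = cone X Z gf"
  have ABC: "A \<in> Cx" "B \<in> Cx" "C \<in> Cx" unfolding A_def B_def C_def using o f g gf by simp_all
  define \<alpha> where "\<alpha> = (\<lambda>i m. Pair (pfst m) (g i (psnd m)))"
  have \<alpha>: "\<alpha> \<in> Ch A C" unfolding \<alpha>_def A_def C_def gf_def
    by (rule chain_mapI) (use o in \<open>auto simp: mod_simps fs\<close>)
  define D where "D = cone A C \<alpha>"
  have D: "D \<in> Cx" unfolding D_def by (rule cone_cplx[OF ABC(1,3) \<alpha>])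
  have DM: "Mdl D i = dir_sum (dir_sum (Mdl X (i + 2)) (Mdl Y (i + 1))) (dir_sum (Mdl X (i + 1)) (Mdl Z i))" for i
    by (simp add: D_def A_def C_def)
  have DD: "Dif D i (Pair (Pair x y) (Pair x' z)) = Pair (Pair (Dif X (i + 2) x) (\<ominus>\<^bsub>Mdl Y (i + 2)\<^esub> (f (i + 2) x \<oplus>\<^bsub>Mdl Y (i + 2)\<^esub> Dif Y (i + 1) y)))
     (Pair (x \<ominus>\<^bsub>Mdl X (i + 2)\<^esub> Dif X (i + 1) x') (g (i + 1) y \<oplus>\<^bsub>Mdl Z (i + 1)\<^esub> (g (i + 1) (f (i + 1) x') \<oplus>\<^bsub>Mdl Z (i + 1)\<^esub> Dif Z i z)))"
    if "x \<in> carrier (Mdl X (i + 2))" "y \<in> carrier (Mdl Y (i + 1))" "x' \<in> carrier (Mdl X (i + 1))" "z \<in> carrier (Mdl Z i)" for i x y x' z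
    using that o by (simp add: D_def A_def C_def gf_def \<alpha>_def mod_simps fs)
  define \<phi> where "\<phi> = (\<lambda>i m. Pair (psnd (pfst m) \<oplus>\<^bsub>Mdl Y (i + 1)\<^esub> f (i + 1) (pfst (psnd m))) (psnd (psnd m)))"
  define \<psi> where "\<psi> = (\<lambda>i m. Pair (Pair \<zero>\<^bsub>Mdl X (i + 2)\<^esub> (pfst m)) (Pair \<zero>\<^bsub>Mdl X (i + 1)\<^esub> (psnd m)))"
  have \<phi>: "\<phi> \<in> Ch D B" unfolding \<phi>_def B_def
    by (rule chain_mapI) (use o in \<open>auto simp: DM DD mod_simps fs\<close>)
  have \<psi>: "\<psi> \<in> Ch B D" unfolding \<psi>_def B_def
    by (rule chain_mapI) (use o in \<open>auto simp: DM DD mod_simps fs\<close>)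
  have \<psi>\<phi>: "karr R D D (\<lambda>i m. m) = karr R D D (\<lambda>i m. \<psi> i (\<phi> i m))"
    by (rule karr_eqI[of _ _ _ _ "\<lambda>i m. Pair (Pair (pfst (psnd m)) \<zero>\<^bsub>Mdl Y i\<^esub>) (Pair \<zero>\<^bsub>Mdl X i\<^esub> \<zero>\<^bsub>Mdl Z (i - 1)\<^esub>)"])
      (use o D chain_map_comp[OF D ABC(2) D \<phi> \<psi>] in \<open>auto simp: DM DD mod_simps fs \<phi>_def \<psi>_def intro!: graded_mapI\<close>)
  have \<phi>\<psi>: "karr R B B (\<lambda>i m. \<phi> i (\<psi> i m)) = karr R B B (\<lambda>i m. m)"
    by (rule karr_cong) (use o in \<open>auto simp: \<phi>_def \<psi>_def B_def mod_simps fs\<close>)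
  have "(karr R A C \<alpha>, karr R D B \<phi> \<cdot>\<^bsub>K\<^esub> karr R C D (cone_incl A), karr R D (shift_cplx A) (\<lambda>i. pfst) \<cdot>\<^bsub>K\<^esub> karr R B D \<psi>) \<in> Tri K"
    by (rule K.replace_cone[OF std_Tri[OF ABC(1,3) \<alpha>, folded D_def]])
      (use D ABC \<phi> \<psi> \<phi>\<psi> \<psi>\<phi> in \<open>simp_all add: K_comp K_ident\<close>)
  moreover have "Cod K (karr R D B \<phi> \<cdot>\<^bsub>K\<^esub> karr R C D (cone_incl A)) = B"
    unfolding K_comp[OF ABC(3) D ABC(2) shift_incl_chain[OF ABC(1,3) \<alpha>, folded D_def] \<phi>] by simp
  ultimately have "\<exists>a b c. (a, b, c) \<in> Tri K \<and> Dom K a = A \<and> Cod K a = C \<and> Cod K b = B"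
    using K_dom K_cod by blast
  then show ?thesis by (simp add: A_def B_def C_def)
qed

text \<open>
  A null homotopy of multiplication by \<open>r\<close> on its own cone is \<open>(a, b) \<mapsto> (b, 0)\<close>.
\<close>

lemma K_koszul:
  assumes X: "X \<in> Cx" and r: "r \<in> carrier R"
  defines "f \<equiv> (\<lambda>i m. r \<odot>\<^bsub>Mdl X i\<^esub> m)"
  shows "f \<in> Ch X X" "Scale K r (Ident K (cone X X f)) = Zero K (cone X X f) (cone X X f)"
proof -
  show f: "f \<in> Ch X X" unfolding f_def by (rule chain_map_scale[OF X X chain_map_ident[OF X] r])
  define C where "C = cone X X f"
  have C: "C \<in> Cx" unfolding C_def by (rule cone_cplx[OF X X f])
  have CM: "Mdl C i = dir_sum (Mdl X (i + 1)) (Mdl X i)" for i by (simp add: C_def)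
  have CD: "Dif C i (Pair a b) = Pair (\<ominus>\<^bsub>Mdl X (i + 2)\<^esub> Dif X (i + 1) a) (r \<odot>\<^bsub>Mdl X (i + 1)\<^esub> a \<oplus>\<^bsub>Mdl X (i + 1)\<^esub> Dif X i b)" for i a b
    by (simp add: C_def f_def)
  have "karr R C C (\<lambda>i m. r \<odot>\<^bsub>Mdl C i\<^esub> m) = karr R C C (\<lambda>i m. \<zero>\<^bsub>Mdl C i\<^esub>)"
  proof (rule karr_eqI)
    show "graded_map C C (\<lambda>i m. Pair (psnd m) \<zero>\<^bsub>Mdl X (i - 1)\<^esub>)"
      by (rule graded_mapI) (use X in \<open>auto simp: CM mod_simps\<close>)
  qed (use X r C chain_map_scale[OF C C chain_map_ident[OF C] r] chain_map_zero[OF C C] in \<open>auto simp: CM CD mod_simps\<close>)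
  then show "Scale K r (Ident K (cone X X f)) = Zero K (cone X X f) (cone X X f)"
    using C r by (simp add: K_ident K_zero K_scale flip: C_def)
qed

theorem Kb_triangulated: "triangulated R K"
proof
  fix u v w u' v' w' a b
  assume h: "(u, v, w) \<in> Tri K" "(u', v', w') \<in> Tri K" "a \<in> Arr K" "b \<in> Arr K"
      "Dom K a = Dom K u" "Cod K a = Dom K u'" "Dom K b = Cod K u" "Cod K b = Cod K u'" "b \<cdot>\<^bsub>K\<^esub> u = u' \<cdot>\<^bsub>K\<^esub> a"
  show "\<exists>c. K.tri_map a b c (u, v, w) (u', v', w')"
  proof (rule K.tri_map_exists_basis[OF K_Tri std_candidate _ h])
    fix u v w u' v' w' a b
    assume u: "(u, v, w) \<in> std_triangles" and u': "(u', v', w') \<in> std_triangles"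
      and ab: "a \<in> Arr K" "b \<in> Arr K"
      "Dom K a = Dom K u" "Cod K a = Dom K u'" "Dom K b = Cod K u" "Cod K b = Cod K u'" "b \<cdot>\<^bsub>K\<^esub> u = u' \<cdot>\<^bsub>K\<^esub> a"
    obtain X Y f where o: "X \<in> Cx" "Y \<in> Cx" and f: "f \<in> Ch X Y" and t: "u = karr R X Y f" "v = karr R Y (cone X Y f) (cone_incl X)"
      "w = karr R (cone X Y f) (shift_cplx X) (\<lambda>i. pfst)" using u by (rule std_trianglesE)
    obtain X' Y' f' where o': "X' \<in> Cx" "Y' \<in> Cx" and f': "f' \<in> Ch X' Y'" and t': "u' = karr R X' Y' f'" "v' = karr R Y' (cone X' Y' f') (cone_incl X')"
      "w' = karr R (cone X' Y' f') (shift_cplx X') (\<lambda>i. pfst)" using u' by (rule std_trianglesE)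
    obtain p where p: "p \<in> Ch X X'" "a = karr R X X' p" using ab(1,3,4) unfolding t t' by (elim K_arrE) auto
    obtain q where q: "q \<in> Ch Y Y'" "b = karr R Y Y' q" using ab(2,5,6) unfolding t t' by (elim K_arrE) auto
    have "homotopic R X Y' (\<lambda>i m. q i (f i m)) (\<lambda>i m. f' i (p i m))"
      using ab(7) unfolding t t' p q K_comp[OF o o'(2) f q(1)] K_comp[OF o(1) o' p(1) f']
      using karr_eq_iff[OF o(1) o'(2) chain_map_comp[OF o o'(2) f q(1)] chain_map_comp[OF o(1) o' p(1) f']] by simp
    then obtain k where k: "graded_map X Y' k" and e0: "\<forall>i. \<forall>m\<in>carrier (Mdl X i). q i (f i m) = f' i (p i m) \<oplus>\<^bsub>Mdl Y' i\<^esub>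
             (Dif Y' (i - 1) (k i m) \<oplus>\<^bsub>Mdl Y' i\<^esub> k (i + 1) (Dif X i m))" by (rule homotopicE)
    note fs = chain_map_simps[OF f o] chain_map_simps[OF f' o'] chain_map_simps[OF p(1) o(1) o'(1)] chain_map_simps[OF q(1) o(2) o'(2)]
      graded_map_simps[OF k o(1) o'(2)]
    define c where "c = (\<lambda>i m. Pair (p (i + 1) (pfst m)) (q i (psnd m) \<oplus>\<^bsub>Mdl Y' i\<^esub> k (i + 1) (pfst m)))"
    have c: "c \<in> Ch (cone X Y f) (cone X' Y' f')"
      unfolding c_def by (rule K_cone_map[OF o o' f f' p(1) q(1) k]) (rule e0[rule_format])
    note C = cone_cplx[OF o f] and C' = cone_cplx[OF o' f']
    note I = shift_incl_chain[OF o f] and I' = shift_incl_chain[OF o' f']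
    note P = cone_proj_chain[OF o f] and P' = cone_proj_chain[OF o' f']
    note s = shift_cplx[OF o(1)] shift_cplx[OF o'(1)]
    have 1: "karr R (cone X Y f) (cone X' Y' f') c \<cdot>\<^bsub>K\<^esub> v = v' \<cdot>\<^bsub>K\<^esub> b"
      unfolding t t' q K_comp[OF o(2) C C' I c] K_comp[OF o(2) o'(2) C' q(1) I']
      by (rule karr_cong) (use o o' in \<open>simp add: c_def fs\<close>)
    have 2: "ShArr K a \<cdot>\<^bsub>K\<^esub> w = w' \<cdot>\<^bsub>K\<^esub> karr R (cone X Y f) (cone X' Y' f') c"
      unfolding t t' p K_sh[OF o(1) o'(1) p(1)] K_comp[OF C s P chain_map_shift[OF o(1) o'(1) p(1)]] K_comp[OF C C' s(2) c P']
      by (rule karr_cong) (use o o' in \<open>simp add: c_def fs\<close>)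
    have "K.tri_map a b (karr R (cone X Y f) (cone X' Y' f') c) (u, v, w) (u', v', w')"
      by (rule K.tri_mapI) (use ab 1 2 C C' c t t' in simp_all)
    then show "\<exists>c. K.tri_map a b c (u, v, w) (u', v', w')" ..
  qed
next
  fix a assume "a \<in> Arr K"
  then obtain X Y f where o: "X \<in> Cx" "Y \<in> Cx" and f: "f \<in> Ch X Y" and a: "a = karr R X Y f" by (rule K_arrE)
  show "\<exists>v w. (a, v, w) \<in> Tri K" unfolding a using std_Tri[OF o f] by blast
  show "\<exists>u w. (u, a, w) \<in> Tri K" unfolding a by (rule K_cocone[OF o f])
next
  have "Ident K zero_cplx = Zero K zero_cplx zero_cplx"
    unfolding K_ident K_zero by (rule karr_cong) simp
  then show "\<exists>Z\<in>Obj K. Ident K Z = Zero K Z Z \<and> (\<forall>E\<in>Obj K. (Zero K Z E, Ident K E, Zero K E (ShObj K Z)) \<in> Tri K)"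
    using K_zero_object by (intro bexI[of _ zero_cplx]) simp_all
next
  fix a b assume "a \<in> Arr K" "b \<in> Arr K" "Dom K b = Cod K a"
  then obtain X Y Z f g where o: "X \<in> Cx" "Y \<in> Cx" "Z \<in> Cx" and f: "f \<in> Ch X Y" "g \<in> Ch Y Z"
    and ab: "a = karr R X Y f" "b = karr R Y Z g" by (elim K_arrE) auto
  obtain \<alpha> \<beta> \<gamma> where t: "(\<alpha>, \<beta>, \<gamma>) \<in> Tri K" "Dom K \<alpha> = cone X Y f" "Cod K \<alpha> = cone X Z (\<lambda>i m. g i (f i m))" "Cod K \<beta> = cone Y Z g"
    using K_octahedron[OF o f] by blast
  show "\<exists>v1 w1 v2 w2 v3 w3 \<alpha> \<beta> \<gamma>. (a, v1, w1) \<in> Tri K \<and> (b, v2, w2) \<in> Tri K \<and> (b \<cdot>\<^bsub>K\<^esub> a, v3, w3) \<in> Tri K \<and>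
        (\<alpha>, \<beta>, \<gamma>) \<in> Tri K \<and> Dom K \<alpha> = Cod K v1 \<and> Cod K \<alpha> = Cod K v3 \<and> Cod K \<beta> = Cod K v2"
    unfolding ab K_comp[OF o f]
    by (rule exI conjI t(1) std_Tri[OF o(1,2) f(1)] std_Tri[OF o(2,3) f(2)] std_Tri[OF o(1,3) chain_map_comp[OF o f]])+
      (simp_all add: t(2-4))
next
  fix X r assume X: "X \<in> Obj K" and r: "r \<in> carrier R"
  then have X': "X \<in> Cx" by simp
  note k = K_koszul[OF X' r]
  have "Scale K r (Ident K X) = karr R X X (\<lambda>i m. r \<odot>\<^bsub>Mdl X i\<^esub> m)" using X' r by (simp add: K_ident K_scale)
  then show "\<exists>v w. (Scale K r (Ident K X), v, w) \<in> Tri K \<and> Scale K r (Ident K (Cod K v)) = Zero K (Cod K v) (Cod K v)"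
    using std_Tri[OF X' X' k(1)] k(2)
    by (intro exI[of _ "karr R X (cone X X (\<lambda>i m. r \<odot>\<^bsub>Mdl X i\<^esub> m)) (cone_incl X)"]
       exI[of _ "karr R (cone X X (\<lambda>i m. r \<odot>\<^bsub>Mdl X i\<^esub> m)) (shift_cplx X) (\<lambda>i. pfst)"]) simp
qed

section \<open>Acyclic complexes\<close>

interpretation K: triangulated R K by (rule Kb_triangulated)

lemma acyclic_cplx: "A \<in> acyclics R \<Longrightarrow> A \<in> Cx"
  by (simp add: acyclics_def)

lemma acyclicE:
  assumes "A \<in> acyclics R" "m \<in> carrier (Mdl A i)" "Dif A i m = \<zero>\<^bsub>Mdl A (i + 1)\<^esub>"
  obtains n where "n \<in> carrier (Mdl A (i - 1))" "m = Dif A (i - 1) n"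
proof -
  have a: "{m \<in> carrier (Mdl A (i - 1 + 1)). Dif A (i - 1 + 1) m = \<zero>\<^bsub>Mdl A (i - 1 + 2)\<^esub>} = Dif A (i - 1) ` carrier (Mdl A (i - 1))"
    using assms(1) unfolding acyclics_def by blast
  have "i - 1 + 2 = i + 1" by simp
  then have "m \<in> Dif A (i - 1) ` carrier (Mdl A (i - 1))"
    using assms(2,3) a by auto
  then show thesis using that by blast
qed

lemma acyclicI:
  assumes A: "A \<in> Cx" and "\<And>i m. m \<in> carrier (Mdl A i) \<Longrightarrow> Dif A i m = \<zero>\<^bsub>Mdl A (i + 1)\<^esub> \<Longrightarrow>
     \<exists>n\<in>carrier (Mdl A (i - 1)). m = Dif A (i - 1) n"
  shows "A \<in> acyclics R"
proof -
  have "{m \<in> carrier (Mdl A (i + 1)). Dif A (i + 1) m = \<zero>\<^bsub>Mdl A (i + 2)\<^esub>} = Dif A i ` carrier (Mdl A i)" (is "?Z = ?B") for i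
  proof
    show "?B \<subseteq> ?Z" using A by auto
    show "?Z \<subseteq> ?B" using assms(2)[of _ "i + 1"] by auto
  qed
  then show ?thesis using A by (simp add: acyclics_def)
qed

text \<open>
  A cycle \<open>m\<close> equals \<open>r (i m)\<close> up to a boundary, and \<open>i m\<close> is a boundary.
\<close>

lemma acyclic_retract:
  assumes A: "A \<in> acyclics R" and X: "X \<in> Cx" and i: "i \<in> Ch X A" and r: "r \<in> Ch A X"
    and h: "homotopic R X X (\<lambda>j m. m) (\<lambda>j m. r j (i j m))"
  shows "X \<in> acyclics R"
proof (rule acyclicI[OF X])
  fix j m assume m: "m \<in> carrier (Mdl X j)" "Dif X j m = \<zero>\<^bsub>Mdl X (j + 1)\<^esub>"
  have A': "A \<in> Cx" by (rule acyclic_cplx[OF A])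
  note fs = chain_map_simps[OF i X A'] chain_map_simps[OF r A' X]
  obtain k where k: "graded_map X X k" and e0: "\<forall>i'. \<forall>m\<in>carrier (Mdl X i'). m = r i' (i i' m) \<oplus>\<^bsub>Mdl X i'\<^esub>
             (Dif X (i' - 1) (k i' m) \<oplus>\<^bsub>Mdl X i'\<^esub> k (i' + 1) (Dif X i' m))" using h by (rule homotopicE)
  note ks = graded_map_simps[OF k X X]
  have "Dif A j (i j m) = \<zero>\<^bsub>Mdl A (j + 1)\<^esub>" using fs(6)[OF m(1) refl] m(2) fs(5)[of "j + 1"] by simp
  then obtain n where n: "n \<in> carrier (Mdl A (j - 1))" "i j m = Dif A (j - 1) n"
    using acyclicE[OF A fs(1)[OF m(1)]] by blast
  have k0: "k (j + 1) \<zero>\<^bsub>Mdl X (j + 1)\<^esub> = \<zero>\<^bsub>Mdl X j\<^esub>" using ks(5)[of "j + 1"] by simp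
  have rn: "r j (Dif A (j - 1) n) = Dif X (j - 1) (r (j - 1) n)" using n(1) by (intro fs(12)) simp_all
  have "m = r j (i j m) \<oplus>\<^bsub>Mdl X j\<^esub> (Dif X (j - 1) (k j m) \<oplus>\<^bsub>Mdl X j\<^esub> k (j + 1) (Dif X j m))"
    using e0 m(1) by blast
  also have "\<dots> = Dif X (j - 1) (r (j - 1) n \<oplus>\<^bsub>Mdl X (j - 1)\<^esub> k j m)"
    unfolding n(2) m(2) k0 rn using X m(1) n(1) by (simp add: fs ks)
  finally show "\<exists>n\<in>carrier (Mdl X (j - 1)). m = Dif X (j - 1) n"
    using X m(1) n(1) by (intro bexI[of _ "r (j - 1) n \<oplus>\<^bsub>Mdl X (j - 1)\<^esub> k j m"]) (simp_all add: fs ks)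
qed

lemma acyclic_retract_arr:
  assumes A: "A \<in> acyclics R" and "a \<in> Arr K" "b \<in> Arr K" "Dom K a = X" "Cod K a = A" "Dom K b = A" "Cod K b = X"
    and e: "b \<cdot>\<^bsub>K\<^esub> a = Ident K X"
  shows "X \<in> acyclics R"
proof -
  obtain i r where o: "X \<in> Cx" "A \<in> Cx" and i: "i \<in> Ch X A" "a = karr R X A i" and r: "r \<in> Ch A X" "b = karr R A X r"
    using assms(2-7) by (elim K_arrE) auto
  have "homotopic R X X (\<lambda>j m. m) (\<lambda>j m. r j (i j m))"
    using e unfolding i(2) r(2) K_comp[OF o o(1) i(1) r(1)] K_ident
    using karr_eq_iff[OF o(1,1) chain_map_ident[OF o(1)] chain_map_comp[OF o o(1) i(1) r(1)]] by simp
  then show ?thesis by (rule acyclic_retract[OF A o(1) i(1) r(1)])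
qed

lemma acyclic_cone:
  assumes X: "X \<in> acyclics R" and Y: "Y \<in> acyclics R" and f: "f \<in> Ch X Y"
  shows "cone X Y f \<in> acyclics R"
proof (rule acyclicI)
  note o = acyclic_cplx[OF X] acyclic_cplx[OF Y]
  note fs = chain_map_simps[OF f o]
  show "cone X Y f \<in> Cx" by (rule cone_cplx[OF o f])
  fix i m assume m: "m \<in> carrier (Mdl (cone X Y f) i)" "Dif (cone X Y f) i m = \<zero>\<^bsub>Mdl (cone X Y f) (i + 1)\<^esub>"
  obtain a b where ab: "m = Pair a b" "a \<in> carrier (Mdl X (i + 1))" "b \<in> carrier (Mdl Y i)" using m(1) by auto
  have "Dif X (i + 1) a = \<zero>\<^bsub>Mdl X (i + 1 + 1)\<^esub>" and fab: "f (i + 1) a \<oplus>\<^bsub>Mdl Y (i + 1)\<^esub> Dif Y i b = \<zero>\<^bsub>Mdl Y (i + 1)\<^esub>"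
    using m(2) ab o by (simp_all add: mod_simps)
  then obtain a' where a': "a' \<in> carrier (Mdl X i)" "a = Dif X i a'"
    using acyclicE[OF X ab(2)] by auto
  have "Dif Y i (f i a' \<oplus>\<^bsub>Mdl Y i\<^esub> b) = \<zero>\<^bsub>Mdl Y (i + 1)\<^esub>" using fab a' ab(3) o by (simp add: fs)
  then obtain b' where b': "b' \<in> carrier (Mdl Y (i - 1))" "f i a' \<oplus>\<^bsub>Mdl Y i\<^esub> b = Dif Y (i - 1) b'"
    using acyclicE[OF Y, of "f i a' \<oplus>\<^bsub>Mdl Y i\<^esub> b" i] a' ab(3) o by (auto simp: fs)
  show "\<exists>n\<in>carrier (Mdl (cone X Y f) (i - 1)). m = Dif (cone X Y f) (i - 1) n"
    by (rule bexI[of _ "Pair (\<ominus>\<^bsub>Mdl X i\<^esub> a') b'"])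
     (use a' b' ab o in \<open>simp_all add: mod_simps fs flip: b'(2)\<close>)
qed

lemma acyclics_triangulated: "triangulated_subcategory R K (acyclics R)"
proof (unfold_locales)
  show "acyclics R \<subseteq> Obj K" using acyclic_cplx by auto
  show iso: "Y \<in> acyclics R" if X: "X \<in> acyclics R" and i: "iso_obj K X Y" for X Y
  proof -
    obtain a where a: "iso_arr K a" "a \<in> Arr K" "Dom K a = X" "Cod K a = Y" using i by (rule K.iso_objE)
    obtain b where b: "b \<in> Arr K" "Dom K b = Cod K a" "Cod K b = Dom K a" "a \<cdot>\<^bsub>K\<^esub> b = Ident K (Cod K a)"
      using a(1) by (rule K.isoE)
    show ?thesis by (rule acyclic_retract_arr[OF X b(1) a(2)]) (use a b in simp_all)
  qed
  have "zero_cplx \<in> acyclics R" by (rule acyclicI) auto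
  moreover have "Ident K zero_cplx = Zero K zero_cplx zero_cplx"
    unfolding K_ident K_zero by (rule karr_cong) simp
  ultimately show "\<exists>Z\<in>acyclics R. Ident K Z = Zero K Z Z" by blast
  show "Cod K v \<in> acyclics R" if t: "(u, v, w) \<in> Tri K" "Dom K u \<in> acyclics R" "Cod K u \<in> acyclics R" for u v w
  proof -
    have "u \<in> Arr K" using K.triD[OF t(1)] by simp
    then obtain X Y f where o: "X \<in> Cx" "Y \<in> Cx" and f: "f \<in> Ch X Y" and u: "u = karr R X Y f" by (rule K_arrE)
    have "iso_obj K (cone X Y f) (Cod K v)"
      using K.cone_unique[OF std_Tri[OF o f] t(1)[unfolded u]] by simp
    then show ?thesis using iso acyclic_cone[OF _ _ f] t(2,3) u by simp
  qed
  show "X \<in> acyclics R" if X: "X \<in> Obj K" and s: "ShObj K X \<in> acyclics R" for X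
  proof (rule acyclicI)
    show X': "X \<in> Cx" using X by simp
    fix i m assume m: "m \<in> carrier (Mdl X i)" "Dif X i m = \<zero>\<^bsub>Mdl X (i + 1)\<^esub>"
    have s': "shift_cplx X \<in> acyclics R" using s by simp
    obtain n where "n \<in> carrier (Mdl (shift_cplx X) (i - 1 - 1))" "m = Dif (shift_cplx X) (i - 1 - 1) n"
      by (rule acyclicE[OF s', of m "i - 1"]) (use m X' in \<open>auto simp: mod_simps\<close>)
    then show "\<exists>n\<in>carrier (Mdl X (i - 1)). m = Dif X (i - 1) n"
      using X' by (intro bexI[of _ "\<ominus>\<^bsub>Mdl X (i - 1)\<^esub> n"]) (simp_all add: mod_simps)
  qed
qed

section \<open>Perfect complexes\<close>

definition "projective_cplxs = {P \<in> Cx. \<forall>i. projective R (Mdl P i)}"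

lemma projective_zero: "projective R (Mdl zero_cplx i)"
  unfolding projective_def
proof (intro allI ballI impI)
  fix M N :: "'a emodule" and g f assume g: "g \<in> lin_maps R M N" and f: "f \<in> lin_maps R (Mdl zero_cplx i) N"
    and m: "module R M \<and> module R N \<and> g ` carrier M = carrier N"
  have "g \<zero>\<^bsub>M\<^esub> = \<zero>\<^bsub>N\<^esub>" "f (Scal \<zero>) = \<zero>\<^bsub>N\<^esub>"
    using lin_map_diff(1)[OF g] lin_map_diff(1)[OF f cplx_module[OF zero_cplx]] m by simp_all
  then show "\<exists>h\<in>lin_maps R (Mdl zero_cplx i) M. \<forall>x\<in>carrier (Mdl zero_cplx i). g (h x) = f x"
    using m by (intro bexI[of _ "\<lambda>_. \<zero>\<^bsub>M\<^esub>"] lin_mapI) (simp_all add: mod_smult)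
qed

lemma projective_dir_sum:
  assumes mod: "module R P" "module R Q" and pr: "projective R P" "projective R Q"
  shows "projective R (dir_sum P Q)"
  unfolding projective_def
proof (intro allI ballI impI)
  fix M N :: "'a emodule" and g f assume g: "g \<in> lin_maps R M N" and f: "f \<in> lin_maps R (dir_sum P Q) N"
    and m: "module R M \<and> module R N \<and> g ` carrier M = carrier N"
  note fs = lin_mapD[OF f] and gs = lin_mapD[OF g]
  have "(\<lambda>x. f (Pair x \<zero>\<^bsub>Q\<^esub>)) \<in> lin_maps R P N"
  proof (rule lin_mapI)
    show "f (Pair (x \<oplus>\<^bsub>P\<^esub> y) \<zero>\<^bsub>Q\<^esub>) = f (Pair x \<zero>\<^bsub>Q\<^esub>) \<oplus>\<^bsub>N\<^esub> f (Pair y \<zero>\<^bsub>Q\<^esub>)" if "x \<in> carrier P" "y \<in> carrier P" for x y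
      using fs(2)[of "Pair x \<zero>\<^bsub>Q\<^esub>" "Pair y \<zero>\<^bsub>Q\<^esub>"] that mod by simp
    show "f (Pair (r \<odot>\<^bsub>P\<^esub> x) \<zero>\<^bsub>Q\<^esub>) = r \<odot>\<^bsub>N\<^esub> f (Pair x \<zero>\<^bsub>Q\<^esub>)" if "r \<in> carrier R" "x \<in> carrier P" for r x
      using fs(3)[of r "Pair x \<zero>\<^bsub>Q\<^esub>"] that mod by (simp add: mod_smult)
  qed (use mod fs(1) in simp)
  then obtain h where h: "h \<in> lin_maps R P M" "\<forall>x\<in>carrier P. g (h x) = f (Pair x \<zero>\<^bsub>Q\<^esub>)"
    using pr(1) g m unfolding projective_def by meson
  have "(\<lambda>x. f (Pair \<zero>\<^bsub>P\<^esub> x)) \<in> lin_maps R Q N"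
  proof (rule lin_mapI)
    show "f (Pair \<zero>\<^bsub>P\<^esub> (x \<oplus>\<^bsub>Q\<^esub> y)) = f (Pair \<zero>\<^bsub>P\<^esub> x) \<oplus>\<^bsub>N\<^esub> f (Pair \<zero>\<^bsub>P\<^esub> y)" if "x \<in> carrier Q" "y \<in> carrier Q" for x y
      using fs(2)[of "Pair \<zero>\<^bsub>P\<^esub> x" "Pair \<zero>\<^bsub>P\<^esub> y"] that mod by simp
    show "f (Pair \<zero>\<^bsub>P\<^esub> (r \<odot>\<^bsub>Q\<^esub> x)) = r \<odot>\<^bsub>N\<^esub> f (Pair \<zero>\<^bsub>P\<^esub> x)" if "r \<in> carrier R" "x \<in> carrier Q" for r x
      using fs(3)[of r "Pair \<zero>\<^bsub>P\<^esub> x"] that mod by (simp add: mod_smult)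
  qed (use mod fs(1) in simp)
  then obtain k where k: "k \<in> lin_maps R Q M" "\<forall>x\<in>carrier Q. g (k x) = f (Pair \<zero>\<^bsub>P\<^esub> x)"
    using pr(2) g m unfolding projective_def by meson
  note hs = lin_mapD[OF h(1)] and ks = lin_mapD[OF k(1)]
  have l: "(\<lambda>x. h (pfst x) \<oplus>\<^bsub>M\<^esub> k (psnd x)) \<in> lin_maps R (dir_sum P Q) M"
    by (rule lin_mapI) (use mod m hs ks in \<open>auto simp: mod_ac mod_smult\<close>)
  have e: "g (h a \<oplus>\<^bsub>M\<^esub> k b) = f (Pair a b)" if "a \<in> carrier P" "b \<in> carrier Q" for a b
    using fs(2)[of "Pair a \<zero>\<^bsub>Q\<^esub>" "Pair \<zero>\<^bsub>P\<^esub> b"] that h(2) k(2) gs hs(1) ks(1) mod by simp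
  show "\<exists>h\<in>lin_maps R (dir_sum P Q) M. \<forall>x\<in>carrier (dir_sum P Q). g (h x) = f x"
    by (rule bexI[OF _ l]) (auto simp: e)
qed

lemma projective_cone:
  assumes "P \<in> projective_cplxs" "Q \<in> projective_cplxs" "f \<in> Ch P Q"
  shows "cone P Q f \<in> projective_cplxs"
  using assms unfolding projective_cplxs_def by (simp add: projective_dir_sum)

lemma cycles_module:
  assumes A: "A \<in> Cx"
  shows "module R (Mdl A i \<lparr>carrier := {m \<in> carrier (Mdl A i). Dif A i m = \<zero>\<^bsub>Mdl A (i + 1)\<^esub>}\<rparr>)"
proof (rule submodule.submodule_is_module)
  show "submodule {m \<in> carrier (Mdl A i). Dif A i m = \<zero>\<^bsub>Mdl A (i + 1)\<^esub>} R (Mdl A i)"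
    by (rule module.submoduleI[OF cplx_module[OF A]]) (use A in \<open>auto simp: mod_uminus mod_smult\<close>)
qed (rule cplx_module[OF A])

text \<open>
  By acyclicity the differential is a surjection onto the module of cycles, to which projectivity applies.
\<close>

lemma lift_through_acyclic:
  assumes P: "projective R P" "module R P" and A: "A \<in> acyclics R" and f: "f \<in> lin_maps R P (Mdl A i)"
    and z: "\<And>m. m \<in> carrier P \<Longrightarrow> Dif A i (f m) = \<zero>\<^bsub>Mdl A (i + 1)\<^esub>"
  shows "\<exists>h\<in>lin_maps R P (Mdl A (i - 1)). \<forall>m\<in>carrier P. Dif A (i - 1) (h m) = f m"
proof -
  have o: "A \<in> Cx" by (rule acyclic_cplx[OF A])
  define N where "N = Mdl A i \<lparr>carrier := {m \<in> carrier (Mdl A i). Dif A i m = \<zero>\<^bsub>Mdl A (i + 1)\<^esub>}\<rparr>"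
  have N: "module R N" unfolding N_def by (rule cycles_module[OF o])
  have Ns: "carrier N = {m \<in> carrier (Mdl A i). Dif A i m = \<zero>\<^bsub>Mdl A (i + 1)\<^esub>}" "x \<oplus>\<^bsub>N\<^esub> y = x \<oplus>\<^bsub>Mdl A i\<^esub> y" "r \<odot>\<^bsub>N\<^esub> x = r \<odot>\<^bsub>Mdl A i\<^esub> x" for x y r
    by (simp_all add: N_def)
  have g: "Dif A (i - 1) \<in> lin_maps R (Mdl A (i - 1)) N"
  proof (rule lin_mapI)
    fix m assume m: "m \<in> carrier (Mdl A (i - 1))"
    have "Dif A i (Dif A (i - 1) m) = \<zero>\<^bsub>Mdl A (i - 1 + 2)\<^esub>" using o m by (intro cplx_simps) simp_all
    then show "Dif A (i - 1) m \<in> carrier N" using o m by (simp add: Ns)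
  qed (use o in \<open>simp_all add: Ns\<close>)
  have f': "f \<in> lin_maps R P N"
    by (rule lin_mapI) (use lin_mapD[OF f] z in \<open>simp_all add: Ns\<close>)
  have surj: "Dif A (i - 1) ` carrier (Mdl A (i - 1)) = carrier N"
  proof
    show "Dif A (i - 1) ` carrier (Mdl A (i - 1)) \<subseteq> carrier N" using lin_mapD(1)[OF g] by blast
    show "carrier N \<subseteq> Dif A (i - 1) ` carrier (Mdl A (i - 1))"
      using acyclicE[OF A] unfolding Ns by blast
  qed
  show ?thesis using P(1)[unfolded projective_def, rule_format, OF g f'] N surj o by simp
qed

text \<open>
  The homotopy is constructed by descending recursion on the degree, starting at \<open>b\<close>, from which on \<open>P\<close> vanishes.  A
  component \<open>h\<close> in degree \<open>b - n\<close> is \<open>good\<close> if \<open>d h d = f d\<close>; this makes \<open>f - h d\<close> land in the cycles one degree below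
  and so yields the next component, which is good again.
\<close>

lemma projective_to_acyclic:
  assumes P: "P \<in> projective_cplxs" and A: "A \<in> acyclics R" and f: "f \<in> Ch P A"
  shows "homotopic R P A f (\<lambda>i m. \<zero>\<^bsub>Mdl A i\<^esub>)"
proof -
  have o: "P \<in> Cx" "A \<in> Cx" using P acyclic_cplx[OF A] by (simp_all add: projective_cplxs_def)
  have pr: "projective R (Mdl P i)" for i using P by (simp add: projective_cplxs_def)
  note fs = chain_map_simps[OF f o]
  obtain b where b: "carrier (Mdl P i) = {\<zero>\<^bsub>Mdl P i\<^esub>}" if "i \<ge> b" for i
  proof -
    have fin: "finite {i. carrier (Mdl P i) \<noteq> {\<zero>\<^bsub>Mdl P i\<^esub>}}" (is "finite ?S") by (rule cplx_finite[OF o(1)])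
    show thesis
    proof (rule that[of "Max (insert 0 ?S) + 1"])
      fix i assume "Max (insert 0 ?S) + 1 \<le> i"
      moreover have "i \<le> Max (insert 0 ?S)" if "i \<in> ?S" using fin that by (intro Max_ge) simp_all
      ultimately have "i \<notin> ?S" by fastforce
      then show "carrier (Mdl P i) = {\<zero>\<^bsub>Mdl P i\<^esub>}" by simp
    qed
  qed
  define good where "good n h \<longleftrightarrow> h \<in> lin_maps R (Mdl P (b - int n)) (Mdl A (b - int n - 1)) \<and>
     (\<forall>m\<in>carrier (Mdl P (b - int n - 1)). Dif A (b - int n - 1) (h (Dif P (b - int n - 1) m)) = f (b - int n) (Dif P (b - int n - 1) m))" for n h
  define step where "step n h h' \<longleftrightarrow> (\<forall>m\<in>carrier (Mdl P (b - int n - 1)). f (b - int n - 1) m =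
     Dif A (b - int n - 2) (h' m) \<oplus>\<^bsub>Mdl A (b - int n - 1)\<^esub> h (Dif P (b - int n - 1) m))" for n h h'
  have "\<exists>H. \<forall>n. good n (H n) \<and> step n (H n) (H (Suc n))"
  proof (rule dependent_nat_choice[of good step])
    have z: "Dif P (b - 1) m = \<zero>\<^bsub>Mdl P b\<^esub>" if "m \<in> carrier (Mdl P (b - 1))" for m
    proof -
      have "Dif P (b - 1) m \<in> carrier (Mdl P b)" using o that by simp
      then show ?thesis using b[of b] by simp
    qed
    have "good 0 (\<lambda>_. \<zero>\<^bsub>Mdl A (b - 1)\<^esub>)"
      unfolding good_def using o z fs(5) cplx_simps(5)[OF o(2), of "b - 1"] by (auto simp: mod_smult intro!: lin_mapI)
    then show "\<exists>h. good 0 h" by blast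
    fix h n assume h: "good n h"
    define i where "i = b - int n - 1"
    have ii: "b - int n = i + 1" "b - int n - 1 = i" "b - int (Suc n) = i" "b - int n - 2 = i - 1" by (simp_all add: i_def)
    have hl: "h \<in> lin_maps R (Mdl P (i + 1)) (Mdl A i)" using h unfolding good_def ii by simp
    note hs = lin_mapD[OF hl] lin_map_diff[OF hl cplx_module[OF o(1)] cplx_module[OF o(2)]]
    have hz: "Dif A i (h (Dif P i m)) = f (i + 1) (Dif P i m)" if "m \<in> carrier (Mdl P i)" for m
      using h that unfolding good_def ii by simp
    have gl: "(\<lambda>m. f i m \<ominus>\<^bsub>Mdl A i\<^esub> h (Dif P i m)) \<in> lin_maps R (Mdl P i) (Mdl A i)"
      by (rule lin_mapI) (use o in \<open>auto simp: mod_simps fs hs\<close>)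
    have gz: "Dif A i (f i m \<ominus>\<^bsub>Mdl A i\<^esub> h (Dif P i m)) = \<zero>\<^bsub>Mdl A (i + 1)\<^esub>" if m: "m \<in> carrier (Mdl P i)" for m
      using hz[OF m] m o fs(6)[OF m refl] by (simp add: fs hs)
    obtain h' where h': "h' \<in> lin_maps R (Mdl P i) (Mdl A (i - 1))" "\<forall>m\<in>carrier (Mdl P i). Dif A (i - 1) (h' m) = f i m \<ominus>\<^bsub>Mdl A i\<^esub> h (Dif P i m)"
      using lift_through_acyclic[OF pr cplx_module[OF o(1)] A gl gz] by blast
    have "\<forall>m\<in>carrier (Mdl P i). f i m = Dif A (i - 1) (h' m) \<oplus>\<^bsub>Mdl A i\<^esub> h (Dif P i m)"
    proof
      fix m assume m: "m \<in> carrier (Mdl P i)"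
      show "f i m = Dif A (i - 1) (h' m) \<oplus>\<^bsub>Mdl A i\<^esub> h (Dif P i m)"
        unfolding bspec[OF h'(2) m] using m o by (simp add: mod_simps fs hs)
    qed
    then have "step n h h'" unfolding step_def ii(2,4) .
    moreover have "good (Suc n) h'" unfolding good_def ii(3)
    proof (intro conjI h'(1) ballI)
      fix m assume m: "m \<in> carrier (Mdl P (i - 1))"
      have dm: "Dif P (i - 1) m \<in> carrier (Mdl P i)" using m o by simp
      have dd: "Dif P i (Dif P (i - 1) m) = \<zero>\<^bsub>Mdl P (i - 1 + 2)\<^esub>" using m o by (intro cplx_simps) simp_all
      show "Dif A (i - 1) (h' (Dif P (i - 1) m)) = f i (Dif P (i - 1) m)"
        unfolding bspec[OF h'(2) dm] dd using dm o hs(4) by (simp add: fs)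
    qed
    ultimately show "\<exists>h'. good (Suc n) h' \<and> step n h h'" by blast
  qed
  then obtain H where H: "\<And>n. good n (H n)" "\<And>n. step n (H n) (H (Suc n))" by blast
  define h where "h i = (if i \<le> b then H (nat (b - i)) else (\<lambda>_. \<zero>\<^bsub>Mdl A (i - 1)\<^esub>))" for i
  have hg: "graded_map P A h"
    unfolding graded_map_def
  proof
    fix i show "h i \<in> lin_maps R (Mdl P i) (Mdl A (i - 1))"
    proof (cases "i \<le> b")
      case True
      then show ?thesis using H(1)[of "nat (b - i)"] by (simp add: h_def good_def)
    next
      case False
      then show ?thesis using o by (auto simp: h_def mod_smult intro!: lin_mapI)
    qed
  qed
  note hs = graded_map_simps[OF hg o]
  show ?thesis
  proof (rule homotopicI[OF hg])
    fix i m assume m: "m \<in> carrier (Mdl P i)"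
    show "f i m = \<zero>\<^bsub>Mdl A i\<^esub> \<oplus>\<^bsub>Mdl A i\<^esub> (Dif A (i - 1) (h i m) \<oplus>\<^bsub>Mdl A i\<^esub> h (i + 1) (Dif P i m))"
    proof (cases "i < b")
      case True
      define n where "n = nat (b - i - 1)"
      have "nat (b - i) = Suc n" "nat (b - (i + 1)) = n" using True by (simp_all add: n_def)
      then have ii: "b - int n - 1 = i" "b - int n - 2 = i - 1" "h i = H (Suc n)" "h (i + 1) = H n"
        using True by (simp_all add: h_def n_def)
      have "f i m = Dif A (i - 1) (h i m) \<oplus>\<^bsub>Mdl A i\<^esub> h (i + 1) (Dif P i m)"
        using H(2)[of n] m unfolding step_def ii by simp
      then show ?thesis using o m by (simp add: hs)
    next
      case False
      then have "m = \<zero>\<^bsub>Mdl P i\<^esub>" using b[of i] m by simp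
      then show ?thesis using o hs(5)[of i] hs(5)[of "i + 1"] cplx_simps(5)[OF o(2), of "i - 1"] by (simp add: fs)
    qed
  qed
qed

interpretation A: triangulated_subcategory R K "acyclics R" by (rule acyclics_triangulated)

abbreviation "D \<equiv> Db R"

lemma Db_eq: "D = A.V" by (simp add: Db_def)

interpretation D: triangulated R D unfolding Db_eq by (rule A.verdier_quotient_triangulated)

lemma Db_obj [simp]: "Obj D = Cx" unfolding Db_eq by simp

abbreviation "QD \<equiv> quotient_arr K (acyclics R)"

text \<open>
  A denominator \<open>s : W \<rightarrow> P\<close> has an acyclic cone, to which \<open>P\<close> maps trivially; hence \<open>s\<close> has a section \<open>k\<close>, and the
  fraction \<open>f s\<^sup>-\<^sup>1\<close> equals \<open>f k\<close>.
\<close>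

lemma projective_hom_lift:
  assumes P: "P \<in> projective_cplxs" and a: "a \<in> Arr D" "Dom D a = P" "Cod D a = Y"
  obtains f where "f \<in> Ch P Y" "a = QD (karr R P Y f)" "Y \<in> Cx"
proof -
  have aV: "a \<in> Arr A.V" using a by (simp add: Db_eq)
  obtain s f where sf: "(s, f) \<in> roofs K (acyclics R)" "a = fraction K (acyclics R) s f" using aV by (rule A.V_arrE)
  have s: "s \<in> denoms K (acyclics R)" "s \<in> Arr K" "f \<in> Arr K" "Dom K s = Dom K f" using sf(1) unfolding A.roofs_iff by simp_all
  have c: "Cod K s = P" "Cod K f = Y" using a sf by (simp_all add: Db_eq)
  obtain v w where t: "(s, v, w) \<in> Tri K" "Cod K v \<in> acyclics R" using s(1) by (rule A.denomsE)
  note svw = K.triD[OF t(1)]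
  have "v \<in> Arr K" "Dom K v = P" "Cod K v = Cod K v" using svw c by simp_all
  then obtain g where o: "P \<in> Cx" "Cod K v \<in> Cx" and g: "g \<in> Ch P (Cod K v)" "v = karr R P (Cod K v) g" by (rule K_arr_objE)
  have v0: "v = Zero K P (Cod K v)"
    using projective_to_acyclic[OF P t(2) g(1)] karr_eq_iff[OF o g(1) chain_map_zero[OF o]] g(2) by (simp add: K_zero)
  have "v \<cdot>\<^bsub>K\<^esub> Ident K P = Zero K P (Cod K v)" using svw c o v0 by simp
  then have "\<exists>k\<in>Arr K. Dom K k = P \<and> Cod K k = Dom K s \<and> Ident K P = s \<cdot>\<^bsub>K\<^esub> k"
    using K.weak_kernel[OF t(1), of "Ident K P"] o c by simp
  then obtain k where k: "k \<in> Arr K" "Dom K k = P" "Cod K k = Dom K s" "s \<cdot>\<^bsub>K\<^esub> k = Ident K P" by metis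
  have "a = A.Q f \<cdot>\<^bsub>A.V\<^esub> fraction K (acyclics R) s (Ident K (Dom K s))"
    unfolding sf(2) by (rule A.fr_decomp[OF sf(1)])
  moreover have "A.Q k = fraction K (acyclics R) s (Ident K (Dom K s))"
    using A.fr_comp_Q[OF A.roof_inv[OF s(1)] k(1,3)] k c s o D.ident_right[of "fraction K (acyclics R) s (Ident K (Dom K s))" P]
      A.roof_inv[OF s(1)] by (simp add: Db_eq)
  ultimately have "a = A.Q (f \<cdot>\<^bsub>K\<^esub> k)" using k s by (simp add: A.Q_comp)
  moreover have "f \<cdot>\<^bsub>K\<^esub> k \<in> Arr K" "Dom K (f \<cdot>\<^bsub>K\<^esub> k) = P" "Cod K (f \<cdot>\<^bsub>K\<^esub> k) = Y" using k s c by simp_all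
  ultimately show thesis using that by (metis K_arr_objE)
qed

lemma perfect_iff: "X \<in> perfect R \<longleftrightarrow> (\<exists>P\<in>projective_cplxs. iso_obj D X P)"
  unfolding perfect_def projective_cplxs_def using D.iso_obj_objs by auto

lemma QD_Tri: "(u, v, w) \<in> Tri K \<Longrightarrow> (QD u, QD v, QD w) \<in> Tri D"
  unfolding Db_eq by (rule A.Q_Tri)

lemma QD_simps:
  "f \<in> Arr K \<Longrightarrow> QD f \<in> Arr D" "f \<in> Arr K \<Longrightarrow> Dom D (QD f) = Dom K f" "f \<in> Arr K \<Longrightarrow> Cod D (QD f) = Cod K f"
  "X \<in> Cx \<Longrightarrow> QD (Ident K X) = Ident D X" "X \<in> Cx \<Longrightarrow> Y \<in> Cx \<Longrightarrow> QD (Zero K X Y) = Zero D X Y"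
  by (simp_all add: Db_eq)

text \<open>
  If the identity of \<open>C\<close> is killed by a denominator, it factors through the acyclic cone of that denominator, so \<open>C\<close> is a
  retract of an acyclic complex.
\<close>

lemma zero_in_Db_acyclic:
  assumes C: "C \<in> Cx" and z: "Ident D C = Zero D C C"
  shows "C \<in> acyclics R"
proof -
  have r: "(Ident K C, Ident K C) \<in> roofs K (acyclics R)" using C by (simp add: A.roofs_iff A.denoms_ident)
  have "fraction K (acyclics R) (Ident K C) (Ident K C) = Zero A.V (Cod K (Ident K C)) (Cod K (Ident K C))"
    using z C by (simp add: Db_eq A.V_ident)
  then obtain p where p: "p \<in> denoms K (acyclics R)" "p \<in> Arr K" "Cod K p = Dom K (Ident K C)"
    "Ident K C \<cdot>\<^bsub>K\<^esub> p = Zero K (Dom K p) (Cod K (Ident K C))" using A.fr_zeroE[OF r] by metis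
  obtain v w where t: "(p, v, w) \<in> Tri K" "Cod K v \<in> acyclics R" using p(1) by (rule A.denomsE)
  note pvw = K.triD[OF t(1)]
  have "\<exists>k\<in>Arr K. Dom K k = Cod K v \<and> Cod K k = C \<and> Ident K C = k \<cdot>\<^bsub>K\<^esub> v"
    using K.weak_cokernel[OF t(1), of "Ident K C"] p C by simp
  then obtain k where k: "k \<in> Arr K" "Dom K k = Cod K v" "Cod K k = C" "k \<cdot>\<^bsub>K\<^esub> v = Ident K C" by metis
  show ?thesis by (rule acyclic_retract_arr[OF t(2) _ k(1) _ _ k(2,3,4)]) (use pvw p C in simp_all)
qed

text \<open>
  Both arrows at the cone of an isomorphism vanish; the identity of the cone therefore factors through zero.
\<close>

lemma iso_cone_acyclic:
  assumes o: "X \<in> Cx" "Y \<in> Cx" and f: "f \<in> Ch X Y" and i: "iso_arr D (QD (karr R X Y f))"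
  shows "cone X Y f \<in> acyclics R"
proof (rule zero_in_Db_acyclic)
  show C: "cone X Y f \<in> Cx" by (rule cone_cplx[OF o f])
  obtain v w where t: "(karr R X Y f, v, w) \<in> Tri K" and v: "v \<in> Arr K" "Dom K v = Y" "Cod K v = cone X Y f"
    and w: "w \<in> Arr K" "Dom K w = cone X Y f" "Cod K w = shift_cplx X"
    using std_Tri[OF o f] K.triD[OF std_Tri[OF o f]] K_dom K_cod by metis
  note q = QD_Tri[OF t] note q2 = D.rotate[OF q]
  note D1 = D.triD[OF q] and D2 = D.triD[OF q2]
  note qs = QD_simps(1-3)[OF v(1)] QD_simps(1-3)[OF w(1)]
  have d: "Dom D (QD (karr R X Y f)) = X" "Cod D (QD (karr R X Y f)) = Y" "QD (karr R X Y f) \<in> Arr D" using QD_simps(1-3)[OF K_arr[OF o f]] by simp_all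
  have "ShArr D (QD (karr R X Y f)) \<cdot>\<^bsub>D\<^esub> QD w = Zero D (cone X Y f) (ShObj D Y)"
  proof (rule D.neg_eq_zero)
    show "D.neg (ShArr D (QD (karr R X Y f)) \<cdot>\<^bsub>D\<^esub> QD w) = Zero D (cone X Y f) (ShObj D Y)"
      using D.tri_zero[OF D.rotate[OF q2]] D1 D2 d qs v w by simp
  qed (use D1 D2 d qs v w in simp_all)
  then have w0: "QD w = Zero D (cone X Y f) (shift_cplx X)"
    using D.iso_cancel_left[OF D.iso_sh[OF i], of "QD w"] D1 D2 d qs v w by simp
  have v0: "QD v = Zero D Y (cone X Y f)"
    using D.iso_cancel_right[OF i, of "QD v"] D.tri_zero[OF q] D1 d qs v by simp
  have "\<exists>k\<in>Arr D. Dom D k = Cod D (QD w) \<and> Cod D k = Cod D (Ident D (cone X Y f)) \<and> Ident D (cone X Y f) = k \<cdot>\<^bsub>D\<^esub> QD w"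
    by (rule D.weak_cokernel[OF q2]) (use C o v w qs v0 in simp_all)
  then obtain k where k: "k \<in> Arr D" "Dom D k = Cod D (QD w)" "Cod D k = Cod D (Ident D (cone X Y f))" "Ident D (cone X Y f) = k \<cdot>\<^bsub>D\<^esub> QD w" by blast
  show "Ident D (cone X Y f) = Zero D (cone X Y f) (cone X Y f)"
    unfolding k(4) w0 using k(1-3) qs w C o by simp
qed

lemma acyclic_cone_iso:
  assumes o: "X \<in> Cx" "Y \<in> Cx" and f: "f \<in> Ch X Y" and C: "cone X Y f \<in> acyclics R"
  shows "iso_obj D X Y"
proof -
  have "karr R X Y f \<in> denoms K (acyclics R)" by (rule A.denomsI[OF std_Tri[OF o f]]) (use C in simp)
  from A.Q_inverse(3)[OF this] show ?thesis
    by (intro D.iso_objI[of "QD (karr R X Y f)"]) (use o f in \<open>simp_all add: QD_simps Db_eq\<close>)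
qed

text \<open>
  The cones of \<open>f\<close> and of its translate by one degree differ only by the translation and the sign of the second component.
\<close>

lemma unshift_acyclic_cone:
  assumes o: "P \<in> Cx" "X \<in> Cx" and f: "f \<in> Ch P (shift_cplx X)" and C: "cone P (shift_cplx X) f \<in> acyclics R"
  defines "f' \<equiv> (\<lambda>i. f (i - 1))"
  shows "f' \<in> Ch (unshift_cplx P) X" "cone (unshift_cplx P) X f' \<in> acyclics R"
proof -
  note fs0 = chain_map_simps[OF f o(1) shift_cplx[OF o(2)]]
  have fs: "m \<in> carrier (Mdl P i) \<Longrightarrow> j = i + 1 \<Longrightarrow> f i m \<in> carrier (Mdl X j)"
    "m \<in> carrier (Mdl P i) \<Longrightarrow> n \<in> carrier (Mdl P i) \<Longrightarrow> f i (m \<oplus>\<^bsub>Mdl P i\<^esub> n) = f i m \<oplus>\<^bsub>Mdl X (i + 1)\<^esub> f i n"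
    "m \<in> carrier (Mdl P i) \<Longrightarrow> n \<in> carrier (Mdl P i) \<Longrightarrow> f i (m \<ominus>\<^bsub>Mdl P i\<^esub> n) = f i m \<ominus>\<^bsub>Mdl X (i + 1)\<^esub> f i n"
    "r \<in> carrier R \<Longrightarrow> m \<in> carrier (Mdl P i) \<Longrightarrow> f i (r \<odot>\<^bsub>Mdl P i\<^esub> m) = r \<odot>\<^bsub>Mdl X (i + 1)\<^esub> f i m"
    "f i \<zero>\<^bsub>Mdl P i\<^esub> = \<zero>\<^bsub>Mdl X (i + 1)\<^esub>"
    "m \<in> carrier (Mdl P i) \<Longrightarrow> j = i + 1 \<Longrightarrow> f j (Dif P i m) = \<ominus>\<^bsub>Mdl X (i + 2)\<^esub> Dif X (i + 1) (f i m)" for i j m n r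
    using fs0[where i = i] by simp_all
  show f': "f' \<in> Ch (unshift_cplx P) X" unfolding f'_def
    by (rule chain_mapI) (use o in \<open>auto simp: mod_simps fs\<close>)
  show "cone (unshift_cplx P) X f' \<in> acyclics R"
  proof (rule acyclicI)
    show "cone (unshift_cplx P) X f' \<in> Cx" by (rule cone_cplx[OF unshift_cplx[OF o(1)] o(2) f'])
    fix i m assume m: "m \<in> carrier (Mdl (cone (unshift_cplx P) X f') i)"
      "Dif (cone (unshift_cplx P) X f') i m = \<zero>\<^bsub>Mdl (cone (unshift_cplx P) X f') (i + 1)\<^esub>"
    obtain a b where ab: "m = Pair a b" "a \<in> carrier (Mdl P i)" "b \<in> carrier (Mdl X i)" using m(1) by auto
    have da: "Dif P i a = \<zero>\<^bsub>Mdl P (i + 1)\<^esub>" and fab: "f i a \<oplus>\<^bsub>Mdl X (i + 1)\<^esub> Dif X i b = \<zero>\<^bsub>Mdl X (i + 1)\<^esub>"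
      using m(2) ab o by (simp_all add: f'_def mod_simps fs)
    have "Dif (cone P (shift_cplx X) f) (i - 1) (Pair a (\<ominus>\<^bsub>Mdl X i\<^esub> b)) = \<zero>\<^bsub>Mdl (cone P (shift_cplx X) f) (i - 1 + 1)\<^esub>"
      using da fab ab o by (simp add: mod_simps fs)
    then obtain n where n: "n \<in> carrier (Mdl (cone P (shift_cplx X) f) (i - 1 - 1))" "Pair a (\<ominus>\<^bsub>Mdl X i\<^esub> b) = Dif (cone P (shift_cplx X) f) (i - 1 - 1) n"
      using acyclicE[OF C, of "Pair a (\<ominus>\<^bsub>Mdl X i\<^esub> b)" "i - 1"] ab o by auto
    then obtain a' b' where ab': "n = Pair a' b'" "a' \<in> carrier (Mdl P (i - 1))" "b' \<in> carrier (Mdl X (i - 1))" by auto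
    have a: "a = \<ominus>\<^bsub>Mdl P i\<^esub> Dif P (i - 1) a'" and b: "\<ominus>\<^bsub>Mdl X i\<^esub> b = f (i - 1) a' \<oplus>\<^bsub>Mdl X i\<^esub> \<ominus>\<^bsub>Mdl X i\<^esub> Dif X (i - 1) b'"
      using n(2) ab' by simp_all
    have b2: "b = Dif X (i - 1) b' \<ominus>\<^bsub>Mdl X i\<^esub> f (i - 1) a'"
      using b ab(3) ab'(2,3) o by (simp add: mod_simps fs)
    show "\<exists>n\<in>carrier (Mdl (cone (unshift_cplx P) X f') (i - 1)). m = Dif (cone (unshift_cplx P) X f') (i - 1) n"
      by (rule bexI[of _ "Pair (\<ominus>\<^bsub>Mdl P (i - 1)\<^esub> a') b'"])
        (use ab' o in \<open>simp_all add: ab(1) a b2 f'_def mod_simps fs\<close>)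
  qed
qed

text \<open>
  An arrow between perfect complexes is isomorphic, in the derived category, to a chain map between bounded complexes of
  projectives, whose cone is again such a complex.
\<close>

lemma perfect_triangulated: "triangulated_subcategory R D (perfect R)"
proof (unfold_locales)
  show "perfect R \<subseteq> Obj D" by (auto simp: perfect_def)
  show iso: "Y \<in> perfect R" if "X \<in> perfect R" "iso_obj D X Y" for X Y
    using that D.iso_obj_trans[OF D.iso_obj_sym] unfolding perfect_iff by blast
  have "zero_cplx \<in> perfect R" unfolding perfect_iff
    by (rule bexI[of _ zero_cplx]) (simp_all add: projective_cplxs_def projective_zero D.iso_obj_refl)
  moreover have "Ident D zero_cplx = Zero D zero_cplx zero_cplx"
  proof -
    have "Ident K zero_cplx = Zero K zero_cplx zero_cplx"
      unfolding K_ident K_zero by (rule karr_cong) simp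
    from arg_cong[OF this, of QD] show ?thesis by (simp add: Db_eq)
  qed
  ultimately show "\<exists>Z\<in>perfect R. Ident D Z = Zero D Z Z" by blast
  show "Cod D v \<in> perfect R" if t: "(u, v, w) \<in> Tri D" "Dom D u \<in> perfect R" "Cod D u \<in> perfect R" for u v w
  proof -
    note uvw = D.triD[OF t(1)]
    obtain P where P: "P \<in> projective_cplxs" "iso_obj D (Dom D u) P" using t(2) unfolding perfect_iff by blast
    obtain Q where Q: "Q \<in> projective_cplxs" "iso_obj D (Cod D u) Q" using t(3) unfolding perfect_iff by blast
    obtain a where a: "iso_arr D a" "a \<in> Arr D" "Dom D a = Dom D u" "Cod D a = P" using P(2) by (rule D.iso_objE)
    obtain b where b: "iso_arr D b" "b \<in> Arr D" "Dom D b = Cod D u" "Cod D b = Q" using Q(2) by (rule D.iso_objE)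
    obtain a' where a': "a' \<in> Arr D" "Dom D a' = Cod D a" "Cod D a' = Dom D a" "a' \<cdot>\<^bsub>D\<^esub> a = Ident D (Dom D a)" using a(1) by (rule D.isoE)
    have c: "b \<cdot>\<^bsub>D\<^esub> (u \<cdot>\<^bsub>D\<^esub> a') \<in> Arr D" "Dom D (b \<cdot>\<^bsub>D\<^esub> (u \<cdot>\<^bsub>D\<^esub> a')) = P" "Cod D (b \<cdot>\<^bsub>D\<^esub> (u \<cdot>\<^bsub>D\<^esub> a')) = Q"
      using a a' b uvw by simp_all
    obtain f where f: "f \<in> Ch P Q" "b \<cdot>\<^bsub>D\<^esub> (u \<cdot>\<^bsub>D\<^esub> a') = QD (karr R P Q f)" using P(1) c by (rule projective_hom_lift)
    have o: "P \<in> Cx" "Q \<in> Cx" using P Q by (simp_all add: projective_cplxs_def)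
    have sq: "b \<cdot>\<^bsub>D\<^esub> u = QD (karr R P Q f) \<cdot>\<^bsub>D\<^esub> a"
      unfolding f(2)[symmetric] using a a' b uvw by (simp add: D.comp_assoc)
    have "iso_obj D (Cod D v) (Cod D (QD (karr R Q (cone P Q f) (cone_incl P))))"
      by (rule D.cones_iso[OF t(1) QD_Tri[OF std_Tri[OF o f(1)]] a(1) b(1)])
        (use a b o f sq in \<open>simp_all add: QD_simps\<close>)
    then have "iso_obj D (Cod D v) (cone P Q f)" using o f by (simp add: QD_simps)
    then show ?thesis using projective_cone[OF P(1) Q(1) f(1)] unfolding perfect_iff by blast
  qed
  show "X \<in> perfect R" if X: "X \<in> Obj D" and s: "ShObj D X \<in> perfect R" for X
  proof -
    have X': "X \<in> Cx" "ShObj D X = shift_cplx X" using X by (simp_all add: Db_eq)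
    obtain P where P: "P \<in> projective_cplxs" "iso_obj D (shift_cplx X) P" using s unfolding perfect_iff X' by blast
    obtain a where a: "iso_arr D a" "a \<in> Arr D" "Dom D a = P" "Cod D a = shift_cplx X"
      using D.iso_obj_sym[OF P(2)] by (rule D.iso_objE)
    obtain f where f: "f \<in> Ch P (shift_cplx X)" "a = QD (karr R P (shift_cplx X) f)" using P(1) a(2,3,4) by (rule projective_hom_lift)
    have o: "P \<in> Cx" using P by (simp add: projective_cplxs_def)
    have C: "cone P (shift_cplx X) f \<in> acyclics R"
      by (rule iso_cone_acyclic[OF o shift_cplx[OF X'(1)] f(1)]) (use a f in simp)
    note u = unshift_acyclic_cone[OF o X'(1) f(1) C]
    have "iso_obj D (unshift_cplx P) X" by (rule acyclic_cone_iso[OF unshift_cplx[OF o] X'(1) u])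
    moreover have "unshift_cplx P \<in> projective_cplxs" using P o by (simp add: projective_cplxs_def)
    ultimately show ?thesis using D.iso_obj_sym unfolding perfect_iff by blast
  qed
qed

section \<open>The singularity category\<close>

theorem Dsg_triangulated: "triangulated R (Dsg R)"
  unfolding Dsg_def by (rule triangulated_subcategory.verdier_quotient_triangulated[OF perfect_triangulated])

end

theorem proposition2p6:
  fixes R :: "('a, 'm) ring_scheme" (structure)
    and xs :: "'a list"
  assumes "cring R"
    and "noetherian_ring R"
    and "set xs \<subseteq> carrier R"
    and "xs \<noteq> []"
  shows "mult_null (Dsg R) (foldr (\<otimes>) xs \<one>) =
         smd (Dsg R) (star_list (Dsg R) (map (mult_null (Dsg R)) xs))"
  by (rule triangulated.mult_null_prod[OF cring.Dsg_triangulated[OF assms(1)] assms(3,4)])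

end
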